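(* For each $\epsilon>0$, the random dynamical system $\Phi^\epsilon$ on $X=\ell^2$ generated by the random equation $$\frac{dU^\epsilon}{dt}=\nu\Lambda U^\epsilon-\alpha e^{\epsilon z(\theta_t\omega)}U^\epsilon D^-U^\epsilon-\beta e^{2\epsilon z(\theta_t\omega)}(U^\epsilon)^3+\beta(1+\gamma)e^{\epsilon z(\theta_t\omega)}(U^\epsilon)^2-\beta\gamma U^\epsilon-\lambda U^\epsilon+e^{-\epsilon z(\theta_t\omega)}f+\epsilon z(\theta_t\omega)U^\epsilon$$ has a random attractor $\mathcal A^\epsilon(\omega)$ in $X$. Furthermore, $\mathcal A^\epsilon(\omega)$ is upper semi-convergent to the global attractor $\mathcal A$ of the deterministic lattice system $\frac{du}{dt}=\nu\Lambda u-\alpha uD^-u+\beta u(1-u)(u-\gamma)-\lambda u+f$, that is, $$\lim_{\epsilon\to0}\mathrm{dist}_X(\mathcal A^\epsilon(\omega),\mathcal A)=0\qquad\text{for }\mathbb P\text{-a.s. }\omega\in\Omega.$$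
   Context: $X=\ell^2$ is the Hilbert space of real square-summable sequences $u=(u_i)_{i\in\mathbb Z}$ with norm $\|\cdot\|=\|\cdot\|_X$. Parameters: $\alpha,\beta,\nu,\lambda>0$, $\gamma\in(0,1)$, $f\in\ell^2$. $(\Lambda u)_i=-u_{i-1}+2u_i-u_{i+1}$, $(D^-u)_i=u_{i-1}-u_i$; products and powers are componentwise. $\lambda^*=4\nu+\frac{(2\alpha+\beta+\beta\gamma)^2}{4\beta}-\beta\gamma$; standing assumption: $\lambda>\lambda^*$. $\Omega=\{\omega\in C(\mathbb R,\mathbb R):\omega(0)=0\}$ with the Borel $\sigma$-algebra of the compact-open topology, two-sided Wiener measure $\mathbb P$, and shifts $\theta_t\omega(\cdot)=\omega(t+\cdot)-\omega(t)$. The Ornstein-Uhlenbeck process is $z(\theta_t\omega)=-\int_{-\infty}^0e^s(\theta_t\omega)(s)\,ds$. $\Omega$ is replaced (keeping the notation) by a $\theta_t$-invariant full-measure subset on which $t\mapsto z(\theta_t\omega)$ is continuous, $\lim_{t\to\pm\infty}|z(\theta_t\omega)|/|t|=0$ and $\lim_{t\to\pm\infty}\frac1t\int_0^tz(\theta_s\omega)ds=0$. The random equation is the transform, via $U^\epsilon=e^{-\epsilon z(\theta_t\omega)}u$, of the stochastic system with Stratonovich noise $\epsilon u\circ dW$. For $\omega\in\Omega$, $\Phi_0\in X$, $\Phi^\epsilon(t,\omega,\Phi_0)=\Phi^\epsilon(t,\omega)\Phi_0$, $t\ge0$, denotes its unique solution with initial value $\Phi_0$ at $t=0$. $\tilde{\mathcal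 D}$ is the universe of tempered random sets $\mathcal D=\{\mathcal D(\omega)\}_{\omega\in\Omega}$ in $X$: $\lim_{t\to+\infty}e^{-\rho t}\sup\{\|x\|_X:x\in\mathcal D(\theta_{-t}\omega)\}=0$ for all $\rho>0$, $\omega\in\Omega$. $\mathrm{dist}_X(A,B)=\sup_{a\in A}\inf_{b\in B}\|a-b\|_X$. A random ($\tilde{\mathcal D}$-)attractor is a random compact set $\mathcal A^\epsilon=\{\mathcal A^\epsilon(\omega)\}\in\tilde{\mathcal D}$ with $\Phi^\epsilon(t,\omega)\mathcal A^\epsilon(\omega)=\mathcal A^\epsilon(\theta_t\omega)$ for all $t\ge0$, $\omega\in\Omega$, and $\lim_{t\to\infty}\mathrm{dist}_X(\Phi^\epsilon(t,\theta_{-t}\omega)\mathcal D(\theta_{-t}\omega),\mathcal A^\epsilon(\omega))=0$ for all $\mathcal D\in\tilde{\mathcal D}$, $\omega\in\Omega$. The global attractor $\mathcal A$ is the unique compact set in $\ell^2$ invariant under the solution semigroup $u(t,\cdot)$ of the deterministic system ($u(t,\mathcal A)=\mathcal A$, $t\ge0$) and attracting every ball: $\lim_{t\to\infty}\mathrm{dist}_X(u(t,B_r),\mathcal A)=0$ for all $r>0$, $B_r=\{\|u\|\le r\}$. *)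

theory Defs
  imports "HOL-Probability.Probability"
begin

section \<open>The Hilbert space of square-summable real sequences indexed by the integers\<close>

typedef ell2 = "{u :: int \<Rightarrow> real. (\<lambda>i. (u i)\<^sup>2) summable_on UNIV}"
  morphisms coord Abs_ell2
  by (rule exI[of _ "\<lambda>_. 0"]) simp

setup_lifting type_definition_ell2

lemma sq_summable_mult:
  fixes u v :: "int \<Rightarrow> real"
  assumes "(\<lambda>i. (u i)\<^sup>2) summable_on UNIV" "(\<lambda>i. (v i)\<^sup>2) summable_on UNIV"
  shows "(\<lambda>i. u i * v i) summable_on UNIV"
proof (rule abs_summable_summable, rule Infinite_Sum.abs_summable_on_comparison_test)
  show "(\<lambda>i. norm ((u i)\<^sup>2 + (v i)\<^sup>2)) summable_on UNIV"
    using summable_on_add[OF assms] by simp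
  show "norm (u i * v i) \<le> norm ((u i)\<^sup>2 + (v i)\<^sup>2)" for i
  proof -
    have "0 \<le> (\<bar>u i\<bar> - \<bar>v i\<bar>)\<^sup>2 + (u i)\<^sup>2 + (v i)\<^sup>2" by simp
    then show ?thesis by (simp add: power2_diff abs_mult)
  qed
qed

lemma sq_summable_add:
  fixes u v :: "int \<Rightarrow> real"
  assumes "(\<lambda>i. (u i)\<^sup>2) summable_on UNIV" "(\<lambda>i. (v i)\<^sup>2) summable_on UNIV"
  shows "(\<lambda>i. (u i + v i)\<^sup>2) summable_on UNIV"
proof -
  have "(\<lambda>i. ((u i)\<^sup>2 + (v i)\<^sup>2) + 2 * (u i * v i)) summable_on UNIV"
    by (intro summable_on_add summable_on_cmult_right sq_summable_mult assms)
  then show ?thesis by (simp add: power2_sum mult.assoc)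
qed

lemma sq_summable_scale:
  fixes u :: "int \<Rightarrow> real"
  assumes "(\<lambda>i. (u i)\<^sup>2) summable_on UNIV"
  shows "(\<lambda>i. (c * u i)\<^sup>2) summable_on UNIV"
  using summable_on_cmult_right[OF assms, of "c\<^sup>2"] by (simp add: power_mult_distrib)

lemma sq_summable_bounded:
  fixes u :: "int \<Rightarrow> real"
  assumes "(\<lambda>i. (u i)\<^sup>2) summable_on UNIV"
  shows "\<exists>K\<ge>0. \<forall>i. \<bar>u i\<bar> \<le> K"
proof -
  define S where "S = (\<Sum>\<^sub>\<infinity>i. (u i)\<^sup>2)"
  have "\<bar>u i\<bar> \<le> sqrt S" for i
  proof -
    have "sum (\<lambda>i. (u i)\<^sup>2) {i} \<le> S"
      unfolding S_def by (rule finite_sum_le_infsum[OF assms]) auto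
    then show ?thesis by (simp add: real_le_rsqrt)
  qed
  then show ?thesis by (meson abs_ge_zero order_trans)
qed

lemma sq_summable_bounded_mult:
  fixes u w :: "int \<Rightarrow> real"
  assumes "(\<lambda>i. (u i)\<^sup>2) summable_on UNIV" "\<And>i. \<bar>w i\<bar> \<le> K"
  shows "(\<lambda>i. (w i * u i)\<^sup>2) summable_on UNIV"
proof (rule abs_summable_summable, rule Infinite_Sum.abs_summable_on_comparison_test)
  show "(\<lambda>i. norm ((K * u i)\<^sup>2)) summable_on UNIV"
    using sq_summable_scale[OF assms(1), of K] by simp
  show "norm ((w i * u i)\<^sup>2) \<le> norm ((K * u i)\<^sup>2)" for i
    using assms(2)[of i] by (simp add: power_mult_distrib mult_right_mono power2_le_iff_abs_le)
qed

lemma sq_summable_shift: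
  fixes u :: "int \<Rightarrow> real"
  assumes "(\<lambda>i. (u i)\<^sup>2) summable_on UNIV"
  shows "(\<lambda>i. (u (i + k))\<^sup>2) summable_on UNIV"
  using summable_on_reindex_bij_betw[of "\<lambda>i. i + k" UNIV UNIV "\<lambda>i. (u i)\<^sup>2"]
    assms bij_plus_right[of k] by simp

instantiation ell2 :: real_inner
begin

lift_definition zero_ell2 :: ell2 is "\<lambda>_. 0" by simp
lift_definition plus_ell2 :: "ell2 \<Rightarrow> ell2 \<Rightarrow> ell2" is "\<lambda>u v i. u i + v i"
  by (rule sq_summable_add)
lift_definition uminus_ell2 :: "ell2 \<Rightarrow> ell2" is "\<lambda>u i. - u i" by simp
lift_definition minus_ell2 :: "ell2 \<Rightarrow> ell2 \<Rightarrow> ell2" is "\<lambda>u v i. u i - v i"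
  using sq_summable_add[of _ "\<lambda>i. - _ i"] by fastforce
lift_definition scaleR_ell2 :: "real \<Rightarrow> ell2 \<Rightarrow> ell2" is "\<lambda>c u i. c * u i"
  by (rule sq_summable_scale)
lift_definition inner_ell2 :: "ell2 \<Rightarrow> ell2 \<Rightarrow> real" is "\<lambda>u v. \<Sum>\<^sub>\<infinity>i. u i * v i" .
definition norm_ell2 :: "ell2 \<Rightarrow> real" where "norm (u :: ell2) = sqrt (inner u u)"
definition sgn_ell2 :: "ell2 \<Rightarrow> ell2" where "sgn (u :: ell2) = inverse (norm u) *\<^sub>R u"
definition dist_ell2 :: "ell2 \<Rightarrow> ell2 \<Rightarrow> real" where "dist (u :: ell2) v = norm (u - v)"
definition uniformity_ell2 :: "(ell2 \<times> ell2) filter"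
  where "uniformity = (INF e\<in>{0<..}. principal {(x :: ell2, y). dist x y < e})"
definition open_ell2 :: "ell2 set \<Rightarrow> bool"
  where "open (S :: ell2 set) = (\<forall>x\<in>S. \<forall>\<^sub>F (x', y) in uniformity. x' = x \<longrightarrow> y \<in> S)"

instance
proof
  fix u v w :: ell2 and a b :: real
  show "u + v + w = u + (v + w)" by transfer (simp add: add.assoc)
  show "u + v = v + u" by transfer (simp add: add.commute)
  show "0 + u = u" by transfer simp
  show "- u + u = 0" by transfer simp
  show "u - v = u + - v" by transfer simp
  show "a *\<^sub>R (u + v) = a *\<^sub>R u + a *\<^sub>R v" by transfer (simp add: distrib_left)
  show "(a + b) *\<^sub>R u = a *\<^sub>R u + b *\<^sub>R u" by transfer (simp add: distrib_right)
  show "a *\<^sub>R b *\<^sub>R u = (a * b) *\<^sub>R u" by transfer (simp add: mult.assoc)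
  show "1 *\<^sub>R u = u" by transfer simp
  show "sgn u = inverse (norm u) *\<^sub>R u" by (rule sgn_ell2_def)
  show "dist u v = norm (u - v)" by (rule dist_ell2_def)
  show "uniformity = (INF e\<in>{0<..}. principal {(x :: ell2, y). dist x y < e})"
    by (rule uniformity_ell2_def)
  show "open S = (\<forall>x\<in>S. \<forall>\<^sub>F (x', y) in uniformity. x' = x \<longrightarrow> y \<in> S)" for S :: "ell2 set"
    by (rule open_ell2_def)
  show "inner u v = inner v u" by transfer (simp add: mult.commute)
  show "inner (u + v) w = inner u w + inner v w"
    by transfer (simp add: distrib_right infsum_add sq_summable_mult)
  show "inner (a *\<^sub>R u) v = a * inner u v"
    by transfer (simp add: mult.assoc infsum_cmult_right')
  show "0 \<le> inner u u" by transfer (simp add: infsum_nonneg)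
  show "inner u u = 0 \<longleftrightarrow> u = 0"
  proof transfer
    fix u :: "int \<Rightarrow> real"
    assume s: "(\<lambda>i. (u i)\<^sup>2) summable_on UNIV"
    show "(\<Sum>\<^sub>\<infinity>i. u i * u i) = 0 \<longleftrightarrow> u = (\<lambda>_. 0)"
    proof
      assume z: "(\<Sum>\<^sub>\<infinity>i. u i * u i) = 0"
      have "u i * u i = 0" for i
        by (rule nonneg_infsum_le_0D[of "\<lambda>i. u i * u i" UNIV])
           (use z s in \<open>auto simp: power2_eq_square\<close>)
      then show "u = (\<lambda>_. 0)" by auto
    qed simp
  qed
  show "norm u = sqrt (inner u u)" by (rule norm_ell2_def)
qed

end

text \<open>The product on \<^typ>\<open>ell2\<close> is the componentwise one; it has no unit.\<close>

instantiation ell2 :: comm_ring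
begin

lift_definition times_ell2 :: "ell2 \<Rightarrow> ell2 \<Rightarrow> ell2" is "\<lambda>u v i. u i * v i"
  using sq_summable_bounded sq_summable_bounded_mult by blast

instance
proof
  fix u v w :: ell2
  show "u * v * w = u * (v * w)" by transfer (simp add: mult.assoc)
  show "u * v = v * u" by transfer (simp add: mult.commute)
  show "(u + v) * w = u * w + v * w" by transfer (simp add: distrib_right)
qed

end

section \<open>The vector fields\<close>

lift_definition Lap :: "ell2 \<Rightarrow> ell2" is "\<lambda>u i. - u (i - 1) + 2 * u i - u (i + 1)"
proof -
  fix u :: "int \<Rightarrow> real"
  assume s: "(\<lambda>i. (u i)\<^sup>2) summable_on UNIV"
  have "(\<lambda>i. ((- 1) * u (i + (- 1)) + 2 * u i + (- 1) * u (i + 1))\<^sup>2) summable_on UNIV"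
    by (intro sq_summable_add sq_summable_scale sq_summable_shift s)
  then show "(\<lambda>i. (- u (i - 1) + 2 * u i - u (i + 1))\<^sup>2) summable_on UNIV" by simp
qed

lift_definition Dminus :: "ell2 \<Rightarrow> ell2" is "\<lambda>u i. u (i - 1) - u i"
proof -
  fix u :: "int \<Rightarrow> real"
  assume s: "(\<lambda>i. (u i)\<^sup>2) summable_on UNIV"
  have "(\<lambda>i. (u (i + (- 1)) + (- 1) * u i)\<^sup>2) summable_on UNIV"
    by (intro sq_summable_add sq_summable_scale sq_summable_shift s)
  then show "(\<lambda>i. (u (i - 1) - u i)\<^sup>2) summable_on UNIV" by simp
qed

lift_definition reaction :: "real \<Rightarrow> ell2 \<Rightarrow> ell2"
  is "\<lambda>\<gamma> u i. u i * (1 - u i) * (u i - \<gamma>)"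
proof -
  fix \<gamma> :: real and u :: "int \<Rightarrow> real"
  assume s: "(\<lambda>i. (u i)\<^sup>2) summable_on UNIV"
  obtain K where K: "K \<ge> 0" "\<And>i. \<bar>u i\<bar> \<le> K" using sq_summable_bounded[OF s] by blast
  have "\<bar>(1 - u i) * (u i - \<gamma>)\<bar> \<le> (1 + K) * (K + \<bar>\<gamma>\<bar>)" for i
    unfolding abs_mult using K(1) K(2)[of i] by (intro mult_mono) auto
  from sq_summable_bounded_mult[OF s this]
  show "(\<lambda>i. (u i * (1 - u i) * (u i - \<gamma>))\<^sup>2) summable_on UNIV"
    by (simp add: mult.commute mult.left_commute)
qed

definition deterministic_field ::
    "real \<Rightarrow> real \<Rightarrow> real \<Rightarrow> real \<Rightarrow> real \<Rightarrow> ell2 \<Rightarrow> ell2 \<Rightarrow> ell2" where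
  "deterministic_field \<alpha> \<beta> \<gamma> \<nu> lam f u =
     \<nu> *\<^sub>R Lap u - \<alpha> *\<^sub>R (u * Dminus u) + \<beta> *\<^sub>R reaction \<gamma> u - lam *\<^sub>R u + f"

text \<open>Here \<open>\<zeta>\<close> stands for the value of the Ornstein--Uhlenbeck process at the current time.\<close>

definition random_field ::
    "real \<Rightarrow> real \<Rightarrow> real \<Rightarrow> real \<Rightarrow> real \<Rightarrow> ell2 \<Rightarrow> real \<Rightarrow> real \<Rightarrow> ell2 \<Rightarrow> ell2" where
  "random_field \<alpha> \<beta> \<gamma> \<nu> lam f \<epsilon> \<zeta> U =
     \<nu> *\<^sub>R Lap U
     - (\<alpha> * exp (\<epsilon> * \<zeta>)) *\<^sub>R (U * Dminus U)
     - (\<beta> * exp (2 * \<epsilon> * \<zeta>)) *\<^sub>R (U * U * U)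
     + (\<beta> * (1 + \<gamma>) * exp (\<epsilon> * \<zeta>)) *\<^sub>R (U * U)
     - (\<beta> * \<gamma>) *\<^sub>R U
     - lam *\<^sub>R U
     + exp (- \<epsilon> * \<zeta>) *\<^sub>R f
     + (\<epsilon> * \<zeta>) *\<^sub>R U"

definition lambda_star :: "real \<Rightarrow> real \<Rightarrow> real \<Rightarrow> real \<Rightarrow> real" where
  "lambda_star \<alpha> \<beta> \<gamma> \<nu> = 4 * \<nu> + (2 * \<alpha> + \<beta> + \<beta> * \<gamma>)\<^sup>2 / (4 * \<beta>) - \<beta> * \<gamma>"

section \<open>Solutions\<close>

definition solves ::
    "(real \<Rightarrow> 'a::real_normed_vector \<Rightarrow> 'a) \<Rightarrow> 'a \<Rightarrow> (real \<Rightarrow> 'a) \<Rightarrow> bool" where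
  "solves F x u \<longleftrightarrow>
     u 0 = x \<and> (\<forall>t\<ge>0. (u has_vector_derivative F t (u t)) (at t within {0..}))"

definition well_posed :: "(real \<Rightarrow> 'a::real_normed_vector \<Rightarrow> 'a) \<Rightarrow> bool" where
  "well_posed F \<longleftrightarrow>
     (\<forall>x. (\<exists>u. solves F x u) \<and>
          (\<forall>u v. solves F x u \<longrightarrow> solves F x v \<longrightarrow> (\<forall>t\<ge>0. u t = v t)))"

definition solution_map ::
    "(real \<Rightarrow> 'a::real_normed_vector \<Rightarrow> 'a) \<Rightarrow> real \<Rightarrow> 'a \<Rightarrow> 'a" where
  "solution_map F t x = (THE y. \<exists>u. solves F x u \<and> u t = y)"

section \<open>The driving noise\<close>

definition paths :: "(real \<Rightarrow> real) set" where
  "paths = {\<omega>. continuous_on UNIV \<omega> \<and> \<omega> 0 = 0}"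

definition compact_open :: "(real \<Rightarrow> real) topology" where
  "compact_open =
     topology_generated_by {{\<omega> \<in> paths. \<omega> ` K \<subseteq> U} | K U. compact K \<and> open U}"

text \<open>
  Two-sided Wiener measure is characterised as the law under which the coordinate process
  (which vanishes at time 0) has independent increments over the whole real line, the one
  from \<open>s\<close> to \<open>t\<close> being centred Gaussian with variance \<open>t - s\<close>.
\<close>

definition two_sided_wiener_measure :: "(real \<Rightarrow> real) measure \<Rightarrow> bool" where
  "two_sided_wiener_measure P \<longleftrightarrow>
     prob_space P \<and>
     space P = paths \<and>
     sets P = sigma_sets paths {S. openin compact_open S} \<and>
     (\<forall>s t. s < t \<longrightarrow>
        distributed P lborel (\<lambda>\<omega>. \<omega> t - \<omega> s) (\<lambda>x. ennreal (normal_density 0 (sqrt (t - s)) x))) \<and>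
     (\<forall>(t :: nat \<Rightarrow> real) n. mono t \<longrightarrow>
        prob_space.indep_vars P (\<lambda>_. borel) (\<lambda>i \<omega>. \<omega> (t (Suc i)) - \<omega> (t i)) {..<n})"

definition shift :: "real \<Rightarrow> (real \<Rightarrow> real) \<Rightarrow> real \<Rightarrow> real" where
  "shift t \<omega> = (\<lambda>s. \<omega> (t + s) - \<omega> t)"

definition ou :: "(real \<Rightarrow> real) \<Rightarrow> real" where
  "ou \<omega> = - (LINT s:{..0}|lborel. exp s * \<omega> s)"

text \<open>
  The shift-invariant sets of full measure to which the path space may be cut down.  The
  integrability clause only says that the integral defining \<^const>\<open>ou\<close> exists.
\<close>

definition admissible_paths :: "(real \<Rightarrow> real) measure \<Rightarrow> (real \<Rightarrow> real) set \<Rightarrow> bool" where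
  "admissible_paths P \<Omega> \<longleftrightarrow>
     \<Omega> \<in> sets P \<and> emeasure P \<Omega> = 1 \<and>
     (\<forall>t. shift t ` \<Omega> = \<Omega>) \<and>
     (\<forall>\<omega>\<in>\<Omega>.
        set_integrable lborel {..0} (\<lambda>s. exp s * \<omega> s) \<and>
        continuous_on UNIV (\<lambda>t. ou (shift t \<omega>)) \<and>
        ((\<lambda>t. \<bar>ou (shift t \<omega>)\<bar> / \<bar>t\<bar>) \<longlongrightarrow> 0) at_top \<and>
        ((\<lambda>t. \<bar>ou (shift t \<omega>)\<bar> / \<bar>t\<bar>) \<longlongrightarrow> 0) at_bot \<and>
        ((\<lambda>t. 1 / t * (LBINT s=ereal 0..ereal t. ou (shift s \<omega>))) \<longlongrightarrow> 0) at_top \<and>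
        ((\<lambda>t. 1 / t * (LBINT s=ereal 0..ereal t. ou (shift s \<omega>))) \<longlongrightarrow> 0) at_bot)"

section \<open>Random dynamical systems and attractors\<close>

text \<open>The base flow is always \<^const>\<open>shift\<close>.\<close>

definition random_dynamical_system ::
    "(real \<Rightarrow> real) measure \<Rightarrow> (real \<Rightarrow> (real \<Rightarrow> real) \<Rightarrow> 'a::metric_space \<Rightarrow> 'a) \<Rightarrow> bool" where
  "random_dynamical_system M \<Phi> \<longleftrightarrow>
     (\<lambda>(t, \<omega>, x). \<Phi> t \<omega> x)
        \<in> restrict_space borel {0..} \<Otimes>\<^sub>M (M \<Otimes>\<^sub>M borel) \<rightarrow>\<^sub>M borel \<and>
     (\<forall>\<omega>\<in>space M. \<forall>x. \<Phi> 0 \<omega> x = x) \<and>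
     (\<forall>\<omega>\<in>space M. \<forall>s\<ge>0. \<forall>t\<ge>0. \<forall>x. \<Phi> (t + s) \<omega> x = \<Phi> t (shift s \<omega>) (\<Phi> s \<omega> x)) \<and>
     (\<forall>\<omega>\<in>space M. \<forall>t\<ge>0. continuous_on UNIV (\<Phi> t \<omega>))"

text \<open>
  Suprema are taken in the extended nonnegative reals, so that unbounded sets have infinite
  size and the infimum over the empty set is infinite.
\<close>

definition semidist :: "'a::metric_space set \<Rightarrow> 'a set \<Rightarrow> ennreal" where
  "semidist A B = (SUP a\<in>A. INF b\<in>B. ennreal (dist a b))"

definition random_set :: "'w measure \<Rightarrow> ('w \<Rightarrow> 'a::metric_space set) \<Rightarrow> bool" where
  "random_set M D \<longleftrightarrow>
     (\<forall>\<omega>\<in>space M. D \<omega> \<noteq> {}) \<and> (\<forall>x. (\<lambda>\<omega>. infdist x (D \<omega>)) \<in> borel_measurable M)"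

definition tempered_random_set ::
    "(real \<Rightarrow> real) measure \<Rightarrow> ((real \<Rightarrow> real) \<Rightarrow> 'a::real_normed_vector set) \<Rightarrow> bool" where
  "tempered_random_set M D \<longleftrightarrow>
     random_set M D \<and>
     (\<forall>\<rho>>0. \<forall>\<omega>\<in>space M.
        ((\<lambda>t. ennreal (exp (- \<rho> * t)) * (SUP x\<in>D (shift (- t) \<omega>). ennreal (norm x))) \<longlongrightarrow> 0) at_top)"

definition random_attractor ::
    "(real \<Rightarrow> real) measure \<Rightarrow> (real \<Rightarrow> (real \<Rightarrow> real) \<Rightarrow> 'a::real_normed_vector \<Rightarrow> 'a) \<Rightarrow>
     ((real \<Rightarrow> real) \<Rightarrow> 'a set) \<Rightarrow> bool" where
  "random_attractor M \<Phi> A \<longleftrightarrow>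
     tempered_random_set M A \<and>
     (\<forall>\<omega>\<in>space M. compact (A \<omega>)) \<and>
     (\<forall>\<omega>\<in>space M. \<forall>t\<ge>0. \<Phi> t \<omega> ` A \<omega> = A (shift t \<omega>)) \<and>
     (\<forall>D. tempered_random_set M D \<longrightarrow>
        (\<forall>\<omega>\<in>space M.
           ((\<lambda>t. semidist (\<Phi> t (shift (- t) \<omega>) ` D (shift (- t) \<omega>)) (A \<omega>)) \<longlongrightarrow> 0) at_top))"

definition global_attractor ::
    "(real \<Rightarrow> 'a::real_normed_vector \<Rightarrow> 'a) \<Rightarrow> 'a set \<Rightarrow> bool" where
  "global_attractor S A \<longleftrightarrow>
     compact A \<and>
     (\<forall>t\<ge>0. S t ` A = A) \<and>
     (\<forall>r>0. ((\<lambda>t. semidist (S t ` cball 0 r) A) \<longlongrightarrow> 0) at_top)"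

section \<open>The two lattice systems\<close>

definition random_rhs ::
    "real \<Rightarrow> real \<Rightarrow> real \<Rightarrow> real \<Rightarrow> real \<Rightarrow> ell2 \<Rightarrow> real \<Rightarrow> (real \<Rightarrow> real) \<Rightarrow> real \<Rightarrow> ell2 \<Rightarrow> ell2"
  where "random_rhs \<alpha> \<beta> \<gamma> \<nu> lam f \<epsilon> \<omega> = (\<lambda>t. random_field \<alpha> \<beta> \<gamma> \<nu> lam f \<epsilon> (ou (shift t \<omega>)))"

definition random_flow ::
    "real \<Rightarrow> real \<Rightarrow> real \<Rightarrow> real \<Rightarrow> real \<Rightarrow> ell2 \<Rightarrow> real \<Rightarrow> real \<Rightarrow> (real \<Rightarrow> real) \<Rightarrow> ell2 \<Rightarrow> ell2"
  where "random_flow \<alpha> \<beta> \<gamma> \<nu> lam f \<epsilon> t \<omega> = solution_map (random_rhs \<alpha> \<beta> \<gamma> \<nu> lam f \<epsilon> \<omega>) t"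

definition deterministic_rhs ::
    "real \<Rightarrow> real \<Rightarrow> real \<Rightarrow> real \<Rightarrow> real \<Rightarrow> ell2 \<Rightarrow> real \<Rightarrow> ell2 \<Rightarrow> ell2"
  where "deterministic_rhs \<alpha> \<beta> \<gamma> \<nu> lam f = (\<lambda>t. deterministic_field \<alpha> \<beta> \<gamma> \<nu> lam f)"

definition deterministic_flow ::
    "real \<Rightarrow> real \<Rightarrow> real \<Rightarrow> real \<Rightarrow> real \<Rightarrow> ell2 \<Rightarrow> real \<Rightarrow> ell2 \<Rightarrow> ell2"
  where "deterministic_flow \<alpha> \<beta> \<gamma> \<nu> lam f = solution_map (deterministic_rhs \<alpha> \<beta> \<gamma> \<nu> lam f)"

end

theory Submission
  imports Defs
begin

text \<open>
  Along a path \<open>y = \<epsilon> z(\<theta>_t \<omega>)\<close> the equation is an ordinary differential equation in \<open>ell2\<close>, and the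
  deterministic system is the case \<open>y = 0\<close>. Let \<open>E k u\<close> be the energy of \<open>u\<close> with the weights
  \<open>q powr - max 0 (k - |i|)\<close>. Neighbouring weights differ at most by the factor \<open>q\<close>, so for \<open>q > 1\<close> close to 1
  the energy estimate behind \<open>lambda_star\<close> survives for every \<open>k\<close>, without commutator terms:
  \<open>(E k u)' \<le> (- \<delta> + 2 y) E k u + exp (- 2 y) E k f / \<delta>\<close>. Hence, with \<open>r(\<omega>)\<close> the pullback limit of
  the scalar equation \<open>r' = (- \<delta> + 2 y) r + exp (- 2 y) / \<delta>\<close>, the sets
  \<open>K(\<omega>) = {u. \<forall>k. E k u \<le> r(\<omega>) E k f}\<close> are forward invariant and pullback attracting; they are compact
  because \<open>E k f\<close> tends to 0. The attractor is the decreasing intersection of the images of \<open>K\<close>, and it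
  is measurable since \<open>K(\<omega>)\<close> is a multiple of one deterministic compact set. Every random attractor
  lies in \<open>K(\<omega>)\<close>, whose size stays bounded along each path as \<open>\<epsilon>\<close> tends to 0; semicontinuity follows
  from invariance and the convergence of the flows on bounded time intervals.
\<close>

section \<open>The space of square-summable sequences\<close>

text \<open>\<open>Lap\<close> is a nonnegative operator, so the linear coupling feeds energy;
  coupling and convection must be beaten by \<open>lam\<close> and the cubic damping, and
  \<open>lambda_star\<close> is that balance: 4 \<nu> bounds the coupling, and the square comes from
  completing the square between cubic and quartic terms. Cut-off functions, the usual tool for
  tails, would leave errors that depend on the size of the solution. A weight ratio q only replaces
  4 \<nu> by (3 + q) \<nu> and 2 \<alpha> by (5 + q) \<alpha> / 3, and the strict inequality for
  \<open>lam\<close> pays for this. The forcing enters the k-th estimate only as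
  \<open>E k f\<close>, so a single scalar equation bounds every k and one number r(\<omega>)
  describes the absorbing set: compactness becomes a deterministic fact, and a scalar integral is
  the only random quantity in K(\<omega>). Intensity and noise occur only as the product \<epsilon>
  z, and its exponential cancels when the square is completed, so the damping bound does not
  deteriorate with the noise.\<close>

lemma coord_sq_summable: "(\<lambda>i. (coord u i)\<^sup>2) summable_on A"
  using coord[of u] summable_on_subset_banach by fastforce

lemma coord_mult_summable: "(\<lambda>i. coord u i * coord v i) summable_on A"
  using sq_summable_mult[of "coord u" "coord v"] coord_sq_summable summable_on_subset_banach
  by blast

lemmas coord_simps [simp] =
  zero_ell2.rep_eq plus_ell2.rep_eq minus_ell2.rep_eq uminus_ell2.rep_eq scaleR_ell2.rep_eq
  times_ell2.rep_eq

lemma ell2_eqI: "(\<And>i. coord u i = coord v i) \<Longrightarrow> u = v"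
  by (simp add: coord_inject[symmetric] ext)

lemma norm_sq_eq_infsum: "(norm u)\<^sup>2 = (\<Sum>\<^sub>\<infinity>i. (coord u i)\<^sup>2)"
  by (simp add: power2_norm_eq_inner inner_ell2.rep_eq)
    (simp add: power2_eq_square)

lemma sum_coord_sq_le: "finite I \<Longrightarrow> (\<Sum>i\<in>I. (coord u i)\<^sup>2) \<le> (norm u)\<^sup>2"
  unfolding norm_sq_eq_infsum by (rule finite_sum_le_infsum) (auto intro: coord_sq_summable)

lemma abs_coord_le_norm: "\<bar>coord u i\<bar> \<le> norm u"
  using sum_coord_sq_le[of "{i}" u] by (simp add: power2_le_iff_abs_le)

lemma norm_le_if_abs_coord_le:
  assumes "\<And>i. \<bar>coord u i\<bar> \<le> c * \<bar>coord v i\<bar>" "0 \<le> c"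
  shows "norm u \<le> c * norm v"
proof -
  have "(norm u)\<^sup>2 \<le> (norm (c *\<^sub>R v))\<^sup>2"
    unfolding norm_sq_eq_infsum
  proof (rule infsum_mono[OF coord_sq_summable coord_sq_summable])
    show "(coord u i)\<^sup>2 \<le> (coord (c *\<^sub>R v) i)\<^sup>2" for i
      using power_mono[OF assms(1)[of i], of 2] by (simp add: power_mult_distrib)
  qed
  then have "norm u \<le> norm (c *\<^sub>R v)" by (rule power2_le_imp_le) simp
  then show ?thesis using assms(2) by simp
qed

lemma bounded_linear_coord: "bounded_linear (\<lambda>u. coord u i)"
  by (rule bounded_linear_intro[of _ 1]) (auto simp: abs_coord_le_norm)

text \<open>Every coordinate is bounded by the norm, so the componentwise product is
  submultiplicative. Multiplication thereby becomes a bounded bilinear map, which yields the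
  Lipschitz bounds for the quadratic and cubic terms.\<close>

instance ell2 :: real_normed_algebra
proof
  fix u v :: ell2 and a :: real
  show "a *\<^sub>R u * v = a *\<^sub>R (u * v)" "u * a *\<^sub>R v = a *\<^sub>R (u * v)"
    by (auto intro!: ell2_eqI)
  show "norm (u * v) \<le> norm u * norm v"
    by (rule norm_le_if_abs_coord_le) (auto simp: abs_mult intro!: mult_right_mono abs_coord_le_norm)
qed

text \<open>Bounds on finite sums survive coordinatewise limits. This is how a pointwise limit is
  shown to lie in the space, together with its norm bound.\<close>

lemma ell2_of_finite_sums:
  fixes l :: "int \<Rightarrow> real"
  assumes "\<And>I. finite I \<Longrightarrow> (\<Sum>i\<in>I. (l i)\<^sup>2) \<le> c\<^sup>2" "0 \<le> c"
  obtains u where "coord u = l" "norm u \<le> c"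
proof -
  have s: "(\<lambda>i. (l i)\<^sup>2) summable_on UNIV"
    by (rule nonneg_bdd_above_summable_on) (use assms(1) in \<open>auto intro!: bdd_aboveI[of _ "c\<^sup>2"]\<close>)
  then have c: "coord (Abs_ell2 l) = l" by (simp add: Abs_ell2_inverse)
  have "(norm (Abs_ell2 l))\<^sup>2 \<le> c\<^sup>2"
    unfolding norm_sq_eq_infsum c by (rule infsum_le_finite_sums[OF s]) (use assms in auto)
  then show thesis using that c assms(2) power2_le_imp_le by blast
qed

instance ell2 :: banach
proof
  fix X :: "nat \<Rightarrow> ell2"
  assume X: "Cauchy X"
  have "Cauchy (\<lambda>n. coord (X n) i)" for i
    by (rule bounded_linear.Cauchy[OF bounded_linear_coord X])
  then have "\<exists>l. (\<lambda>n. coord (X n) i) \<longlonglongrightarrow> l" for i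
    using Cauchy_convergent convergent_def by blast
  then obtain l where l: "\<And>i. (\<lambda>n. coord (X n) i) \<longlonglongrightarrow> l i" by metis
  have fin: "(\<Sum>i\<in>I. (coord (X n) i - l i)\<^sup>2) \<le> e\<^sup>2"
    if "finite I" and e: "\<And>m. m \<ge> N \<Longrightarrow> norm (X n - X m) \<le> e" for I n N e
  proof (rule LIMSEQ_le_const2)
    show "(\<lambda>m. \<Sum>i\<in>I. (coord (X n) i - coord (X m) i)\<^sup>2) \<longlonglongrightarrow> (\<Sum>i\<in>I. (coord (X n) i - l i)\<^sup>2)"
      by (intro tendsto_intros l)
    have "(\<Sum>i\<in>I. (coord (X n) i - coord (X m) i)\<^sup>2) \<le> e\<^sup>2" if "m \<ge> N" for m
      using sum_coord_sq_le[OF \<open>finite I\<close>, of "X n - X m"] power_mono[OF e[OF that], of 2] by simp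
    then show "\<exists>N. \<forall>m\<ge>N. (\<Sum>i\<in>I. (coord (X n) i - coord (X m) i)\<^sup>2) \<le> e\<^sup>2" by blast
  qed
  have Xd: "\<exists>N. \<forall>n\<ge>N. \<forall>m\<ge>N. norm (X n - X m) \<le> e" if "e > 0" for e
    using X that unfolding Cauchy_iff by (meson less_imp_le)
  obtain N where N: "\<And>n m. n \<ge> N \<Longrightarrow> m \<ge> N \<Longrightarrow> norm (X n - X m) \<le> 1" using Xd[of 1] by auto
  \<comment> \<open>The Cauchy property bounds only differences, so \<open>X N\<close> minus the
    pointwise limit is realised first and the limit is recovered as \<open>X N - w\<close>.\<close>
  obtain w where w: "coord w = (\<lambda>i. coord (X N) i - l i)"
    by (rule ell2_of_finite_sums[of "\<lambda>i. coord (X N) i - l i" 1]) (use fin[of _ N N 1] N[of N] in auto)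
  have wl: "coord (X N - w) i = l i" for i by (simp add: w)
  have "X \<longlonglongrightarrow> X N - w"
  proof (rule metric_LIMSEQ_I)
    fix r :: real assume "r > 0"
    then obtain M where M: "\<And>n m. n \<ge> M \<Longrightarrow> m \<ge> M \<Longrightarrow> norm (X n - X m) \<le> r / 2"
      using Xd[of "r / 2"] by auto
    have "dist (X n) (X N - w) < r" if n: "n \<ge> M" for n
    proof -
      obtain v where v: "coord v = (\<lambda>i. coord (X n) i - l i)" "norm v \<le> r / 2"
        by (rule ell2_of_finite_sums[of "\<lambda>i. coord (X n) i - l i" "r / 2"])
          (use fin[of _ M n "r / 2"] M[OF n] \<open>r > 0\<close> in auto)
      have "v = X n - (X N - w)" by (rule ell2_eqI) (simp add: v w)
      then show ?thesis using v \<open>r > 0\<close> by (simp add: dist_norm)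
    qed
    then show "\<exists>M. \<forall>n\<ge>M. dist (X n) (X N - w) < r" by blast
  qed
  then show "convergent X" by (rule convergentI)
qed

text \<open>The type of \<open>w\<close> carries no bound, and \<open>Abs_ell2\<close> is
  unspecified off the square-summable sequences; the coordinates are the expected ones for bounded
  \<open>w\<close>, the case treated below.\<close>

definition wmul :: "(int \<Rightarrow> real) \<Rightarrow> ell2 \<Rightarrow> ell2" where
  "wmul w u = Abs_ell2 (\<lambda>i. w i * coord u i)"

lemma coord_wmul:
  assumes "\<And>i. \<bar>w i\<bar> \<le> (K::real)"
  shows "coord (wmul w u) i = w i * coord u i"
  unfolding wmul_def
  using sq_summable_bounded_mult[OF coord_sq_summable assms] by (subst Abs_ell2_inverse) auto

lemma bounded_linear_wmul:
  assumes "\<And>i. \<bar>w i\<bar> \<le> (K::real)"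
  shows "bounded_linear (wmul w)"
proof (rule bounded_linear_intro[of _ K])
  have K: "0 \<le> K" using assms[of 0] by linarith
  show "norm (wmul w u) \<le> norm u * K" for u
    using norm_le_if_abs_coord_le[of "wmul w u" K u] K
    by (simp add: coord_wmul[OF assms] abs_mult assms mult_right_mono mult.commute)
qed (auto intro!: ell2_eqI simp: coord_wmul[OF assms] distrib_left)

definition unit_vec :: "int \<Rightarrow> ell2" where
  "unit_vec j = Abs_ell2 (\<lambda>i. if i = j then 1 else 0)"

lemma coord_unit_vec [simp]: "coord (unit_vec j) i = (if i = j then 1 else 0)"
proof -
  have "(\<lambda>i. (if i = j then 1 else 0 :: real)\<^sup>2) summable_on UNIV"
    using summable_on_cong_neutral[of UNIV "{j}" "\<lambda>i. (if i = j then 1 else 0 :: real)\<^sup>2"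
        "\<lambda>i. (if i = j then 1 else 0 :: real)\<^sup>2"] by simp
  then show ?thesis unfolding unit_vec_def by (subst Abs_ell2_inverse) auto
qed

lemma coord_sum: "coord (sum g I) i = (\<Sum>j\<in>I. coord (g j) i)"
  by (induction I rule: infinite_finite_induct) auto

lemma coord_finite_part:
  "finite I \<Longrightarrow> coord (\<Sum>j\<in>I. c j *\<^sub>R unit_vec j) i = (if i \<in> I then c i else 0)"
  by (simp add: coord_sum if_distrib cong: if_cong)

section \<open>Finitely supported approximations, separability and measurability\<close>

lemma finite_parts_tendsto:
  "((\<lambda>I. \<Sum>j\<in>I. coord u j *\<^sub>R unit_vec j) \<longlongrightarrow> u) (finite_subsets_at_top UNIV)"
proof -
  have "((\<lambda>I. (\<Sum>i\<in>I. (coord u i)\<^sup>2)) \<longlongrightarrow> (norm u)\<^sup>2) (finite_subsets_at_top UNIV)"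
    unfolding norm_sq_eq_infsum by (rule infsum_tendsto) (rule coord_sq_summable)
  then have "((\<lambda>I. sqrt ((norm u)\<^sup>2 - (\<Sum>i\<in>I. (coord u i)\<^sup>2))) \<longlongrightarrow> sqrt ((norm u)\<^sup>2 - (norm u)\<^sup>2))
      (finite_subsets_at_top UNIV)"
    by (intro tendsto_intros)
  moreover have "norm ((\<Sum>j\<in>I. coord u j *\<^sub>R unit_vec j) - u) = sqrt ((norm u)\<^sup>2 - (\<Sum>i\<in>I. (coord u i)\<^sup>2))"
    if I: "finite I" for I
  proof -
    \<comment> \<open>Pythagoras: the squared remainder is the mass outside \<open>I\<close>, hence
      the full squared norm minus a finite sum.\<close>
    have "(norm ((\<Sum>j\<in>I. coord u j *\<^sub>R unit_vec j) - u))\<^sup>2 = (\<Sum>\<^sub>\<infinity>i\<in>-I. (coord u i)\<^sup>2)"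
      unfolding norm_sq_eq_infsum using I
      by (intro infsum_cong_neutral) (auto simp: coord_finite_part)
    also have "\<dots> = (norm u)\<^sup>2 - (\<Sum>i\<in>I. (coord u i)\<^sup>2)"
      using infsum_Un_disjoint[OF coord_sq_summable[of u I] coord_sq_summable[of u "-I"]] I
      by (simp add: norm_sq_eq_infsum Compl_partition)
    finally show ?thesis by (metis norm_ge_zero real_sqrt_abs abs_of_nonneg)
  qed
  ultimately have "((\<lambda>I. norm ((\<Sum>j\<in>I. coord u j *\<^sub>R unit_vec j) - u)) \<longlongrightarrow> 0)
      (finite_subsets_at_top UNIV)"
    by (subst tendsto_cong[of _ "\<lambda>I. sqrt ((norm u)\<^sup>2 - (\<Sum>i\<in>I. (coord u i)\<^sup>2))"])
      (auto intro!: eventually_finite_subsets_at_top_weakI)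
  then show ?thesis by (simp add: Lim_null[of _ u] tendsto_norm_zero_iff)
qed

text \<open>Measurability passes to limits of sequences rather than of nets of finite sets, so the
  lattice is exhausted in the order of \<open>int_decode\<close>.\<close>

lemma tendsto_finite_parts_nat:
  "(\<lambda>n. \<Sum>j\<in>int_decode ` {..<n}. coord u j *\<^sub>R unit_vec j) \<longlonglongrightarrow> u"
proof (rule filterlim_compose[OF finite_parts_tendsto])
  show "filterlim (\<lambda>n. int_decode ` {..<n}) (finite_subsets_at_top UNIV) sequentially"
    unfolding filterlim_finite_subsets_at_top
  proof (intro allI impI)
    fix I :: "int set" assume I: "finite I \<and> I \<subseteq> UNIV"
    have "I \<subseteq> int_decode ` {..<n}" if "n \<ge> Suc (Max (int_encode ` I))" for n
    proof
      fix i assume "i \<in> I"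
      then have "int_encode i \<le> Max (int_encode ` I)" using I by (intro Max_ge) auto
      then have "int_encode i < n" using that by linarith
      then show "i \<in> int_decode ` {..<n}" by (intro image_eqI[of _ _ "int_encode i"]) auto
    qed
    then show "\<forall>\<^sub>F n in sequentially. finite (int_decode ` {..<n}) \<and> I \<subseteq> int_decode ` {..<n} \<and> int_decode ` {..<n} \<subseteq> UNIV"
      unfolding eventually_sequentially by blast
  qed
qed

text \<open>Indexing the dense family by the countable type \<open>rat list\<close> makes the basis
  of balls in the second countability proof visibly countable.\<close>

definition rational_vec :: "rat list \<Rightarrow> ell2" where
  "rational_vec xs = (\<Sum>k<length xs. of_rat (xs ! k) *\<^sub>R unit_vec (int_decode k))"

lemma rational_vec_dense:
  assumes "e > 0"
  shows "\<exists>xs. dist (rational_vec xs) u < e"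
proof -
  have "\<forall>\<^sub>F n in sequentially. dist (\<Sum>j\<in>int_decode ` {..<n}. coord u j *\<^sub>R unit_vec j) u < e / 2"
    using tendsto_finite_parts_nat assms by (intro tendstoD) auto
  then obtain n where n: "dist (\<Sum>j\<in>int_decode ` {..<n}. coord u j *\<^sub>R unit_vec j) u < e / 2"
    using eventually_happens by force
  have "\<exists>q :: rat. norm ((of_rat q - coord u (int_decode k)) *\<^sub>R unit_vec (int_decode k)) < e / (2 * Suc n)" for k
  proof -
    \<comment> \<open>The summand 1 makes \<open>N\<close> positive without evaluating the norm of a
      unit vector; \<open>Suc n\<close> in \<open>d\<close> likewise covers
      \<open>n = 0\<close>.\<close>
    define N where "N = norm (unit_vec (int_decode k)) + 1"
    have N: "N > 0" by (simp add: N_def add_nonneg_pos)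
    define d where "d = e / (2 * Suc n) / N"
    have "d > 0" using N assms by (simp add: d_def)
    then obtain q where q: "coord u (int_decode k) - d < of_rat q" "of_rat q < coord u (int_decode k) + d"
      using of_rat_dense[of "coord u (int_decode k) - d" "coord u (int_decode k) + d"] by auto
    then have "\<bar>of_rat q - coord u (int_decode k)\<bar> < d" by linarith
    then have "\<bar>of_rat q - coord u (int_decode k)\<bar> * norm (unit_vec (int_decode k)) < d * N"
      by (intro mult_strict_mono') (auto simp: N_def)
    then show ?thesis using N by (auto simp: d_def)
  qed
  then obtain q :: "nat \<Rightarrow> rat" where
    q: "\<And>k. norm ((of_rat (q k) - coord u (int_decode k)) *\<^sub>R unit_vec (int_decode k)) < e / (2 * Suc n)"
    by metis
  have r: "rational_vec (map q [0..<n]) = (\<Sum>k<n. of_rat (q k) *\<^sub>R unit_vec (int_decode k))"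
    unfolding rational_vec_def by (intro sum.cong) auto
  have "(\<Sum>j\<in>int_decode ` {..<n}. coord u j *\<^sub>R unit_vec j)
      = (\<Sum>k<n. coord u (int_decode k) *\<^sub>R unit_vec (int_decode k))"
    by (subst sum.reindex) (auto intro: inj_on_subset[OF inj_int_decode])
  then have "dist (rational_vec (map q [0..<n])) (\<Sum>j\<in>int_decode ` {..<n}. coord u j *\<^sub>R unit_vec j)
      = norm (\<Sum>k<n. (of_rat (q k) - coord u (int_decode k)) *\<^sub>R unit_vec (int_decode k))"
    by (simp add: r dist_norm sum_subtractf scaleR_diff_left)
  also have "\<dots> \<le> (\<Sum>k<n. e / (2 * Suc n))"
    by (rule order_trans[OF norm_sum]) (intro sum_mono less_imp_le q)
  also have "\<dots> \<le> e / 2" using assms by (simp add: field_simps)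
  finally have "dist (rational_vec (map q [0..<n])) u < e"
    using n dist_triangle[of "rational_vec (map q [0..<n])" u
      "\<Sum>j\<in>int_decode ` {..<n}. coord u j *\<^sub>R unit_vec j"] by linarith
  then show ?thesis by blast
qed

text \<open>Second countability identifies products of Borel algebras with the Borel algebra of the
  product, and it provides the countable dense subset of \<open>kset 1\<close> behind the
  measurability of the attractor.\<close>

instance ell2 :: second_countable_topology
proof
  define B where "B = (\<lambda>(xs, n). ball (rational_vec xs) (1 / real (Suc n))) ` UNIV"
  have "topological_basis B"
  proof (rule topological_basisI)
    show "open V" if "V \<in> B" for V using that by (auto simp: B_def)
    fix S :: "ell2 set" and u assume "open S" "u \<in> S"
    then obtain e where e: "e > 0" "ball u e \<subseteq> S" using openE by blast
    obtain n where n: "1 / real (Suc n) < e / 2"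
      using reals_Archimedean[of "e / 2"] e by (auto simp: inverse_eq_divide)
    obtain xs where xs: "dist (rational_vec xs) u < 1 / real (Suc n)"
      using rational_vec_dense[of "1 / real (Suc n)" u] by auto
    have "ball (rational_vec xs) (1 / real (Suc n)) \<subseteq> ball u e"
    proof
      fix v assume "v \<in> ball (rational_vec xs) (1 / real (Suc n))"
      then show "v \<in> ball u e"
        using n xs dist_triangle[of u v "rational_vec xs"] by (simp add: dist_commute)
    qed
    then show "\<exists>V\<in>B. u \<in> V \<and> V \<subseteq> S"
      using e xs unfolding B_def by (intro bexI[of _ "ball (rational_vec xs) (1 / real (Suc n))"]) auto
  qed
  moreover have "countable B" unfolding B_def by (rule countable_image) simp
  ultimately show "\<exists>B :: ell2 set set. countable B \<and> open = generate_topology B"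
    by (blast intro: topological_basis_imp_subbasis)
qed

text \<open>A vector is the limit of its finite parts, so coordinates decide measurability;
  vector-valued integrals can then be treated as real parameter integrals.\<close>

lemma borel_measurable_ell2I:
  assumes "\<And>i. (\<lambda>x. coord (g x) i) \<in> borel_measurable M"
  shows "g \<in> borel_measurable M"
proof (rule borel_measurable_LIMSEQ_metric)
  show "(\<lambda>x. \<Sum>j\<in>int_decode ` {..<n}. coord (g x) j *\<^sub>R unit_vec j) \<in> borel_measurable M" for n
    by (intro borel_measurable_sum borel_measurable_scaleR assms) auto
qed (rule tendsto_finite_parts_nat)

section \<open>Weighted energy estimates\<close>

text \<open>The subtraction is truncated, so the weight is 1 outside the window \<open>|i| < k\<close>.\<close>

definition wt :: "real \<Rightarrow> nat \<Rightarrow> int \<Rightarrow> real" where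
  "wt q k i = (1 / q) ^ (k - nat \<bar>i\<bar>)"

definition weight :: "real \<Rightarrow> nat \<Rightarrow> ell2 \<Rightarrow> ell2" where
  "weight q k = wmul (wt q k)"

definition tail_energy :: "real \<Rightarrow> nat \<Rightarrow> ell2 \<Rightarrow> real" where
  "tail_energy q k u = inner u (weight q k u)"

section \<open>Weights with bounded neighbour ratio and the weighted energy\<close>

context
  fixes q :: real
  assumes q: "1 \<le> q"
begin

lemma wt_pos: "0 < wt q k i"
  using q by (simp add: wt_def)

lemma wt_le_1: "wt q k i \<le> 1"
  using q by (auto simp: wt_def intro!: power_le_one)

lemma wt_0 [simp]: "wt q 0 i = 1"
  by (simp add: wt_def)

lemma wt_eq_1: "int k \<le> \<bar>i\<bar> \<Longrightarrow> wt q k i = 1"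
  by (simp add: wt_def)

lemma wt_antimono: "k \<le> l \<Longrightarrow> wt q l i \<le> wt q k i"
  unfolding wt_def using q by (intro power_decreasing) auto

text \<open>The exponent \<open>k - nat \<bar>i\<bar>\<close> changes by at most one between
  neighbours, also across the truncation. Together with positivity this is all that
  \<open>lattice_energy_pointwise\<close> asks of the weights.\<close>

lemma wt_neighbour:
  assumes "\<bar>j - i\<bar> \<le> 1"
  shows "wt q k i \<le> q * wt q k j"
proof -
  have "(1 / q) ^ Suc (k - nat \<bar>i\<bar>) \<le> (1 / q) ^ (k - nat \<bar>j\<bar>)"
    using q assms by (intro power_decreasing) auto
  then have "q * (1 / q) ^ Suc (k - nat \<bar>i\<bar>) \<le> q * (1 / q) ^ (k - nat \<bar>j\<bar>)"
    using q by (intro mult_left_mono) auto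
  then show ?thesis using q by (simp add: wt_def)
qed

lemma abs_wt_le_1: "\<bar>wt q k i\<bar> \<le> 1"
  using wt_pos[of k i] wt_le_1[of k i] by simp

lemma coord_weight [simp]: "coord (weight q k u) i = wt q k i * coord u i"
  unfolding weight_def by (rule coord_wmul[OF abs_wt_le_1])

lemma bounded_linear_weight: "bounded_linear (weight q k)"
  unfolding weight_def by (rule bounded_linear_wmul[OF abs_wt_le_1])

lemma weight_0 [simp]: "weight q 0 u = u"
  by (rule ell2_eqI) simp

lemma inner_weight: "inner u (weight q k v) = (\<Sum>\<^sub>\<infinity>i. wt q k i * (coord u i * coord v i))"
  by (simp add: inner_ell2.rep_eq algebra_simps)

lemma weight_symmetric: "inner u (weight q k v) = inner v (weight q k u)"
  by (simp add: inner_weight algebra_simps)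

lemma weighted_summable: "(\<lambda>i. wt q k i * (coord u i * coord v i)) summable_on A"
  using coord_mult_summable[of u "weight q k v" A] by (simp add: algebra_simps)

lemma tail_energy_infsum: "tail_energy q k u = (\<Sum>\<^sub>\<infinity>i. wt q k i * (coord u i)\<^sup>2)"
  unfolding tail_energy_def inner_weight power2_eq_square ..

lemma weighted_sq_summable: "(\<lambda>i. wt q k i * (coord u i)\<^sup>2) summable_on A"
  using weighted_summable[of k u u A] by (simp add: power2_eq_square)

lemma tail_energy_nonneg: "0 \<le> tail_energy q k u"
  unfolding tail_energy_infsum using wt_pos[of k] by (intro infsum_nonneg) (auto simp: less_imp_le)

lemma tail_energy_0 [simp]: "tail_energy q 0 u = (norm u)\<^sup>2"
  by (simp add: tail_energy_def power2_norm_eq_inner)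

lemma tail_energy_antimono: "k \<le> l \<Longrightarrow> tail_energy q l u \<le> tail_energy q k u"
  unfolding tail_energy_infsum
  using wt_antimono[of k l] by (intro infsum_mono weighted_sq_summable) (auto intro: mult_right_mono)

lemma tail_energy_le: "tail_energy q k u \<le> (norm u)\<^sup>2"
  using tail_energy_antimono[of 0 k u] by simp

lemma tail_energy_scaleR: "tail_energy q k (c *\<^sub>R u) = c\<^sup>2 * tail_energy q k u"
  unfolding tail_energy_infsum by (simp add: power_mult_distrib mult.left_commute[of _ "c\<^sup>2"] infsum_cmult_right')

lemma continuous_on_tail_energy: "continuous_on A (tail_energy q k)"
  unfolding tail_energy_def[abs_def]
  by (rule continuous_on_inner[OF continuous_on_id
        bounded_linear.continuous_on[OF bounded_linear_weight continuous_on_id]])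

text \<open>The weight is 1 off the window, so a small \<open>tail_energy\<close> forces closeness
  to a vector supported in the window. Total boundedness rests on this.\<close>

lemma sum_outside_le_tail_energy:
  "(norm (u - (\<Sum>j\<in>{- int k<..<int k}. coord u j *\<^sub>R unit_vec j)))\<^sup>2 \<le> tail_energy q k u"
  unfolding norm_sq_eq_infsum tail_energy_infsum
proof (rule infsum_mono[OF coord_sq_summable weighted_sq_summable])
  show "(coord (u - (\<Sum>j\<in>{- int k<..<int k}. coord u j *\<^sub>R unit_vec j)) i)\<^sup>2
      \<le> wt q k i * (coord u i)\<^sup>2" for i
    using wt_pos[of k i] wt_eq_1[of k i] by (auto simp: coord_finite_part)
qed

text \<open>Expanding the nonnegative energy of \<open>d *\<^sub>R u - f\<close> gives this form of
  Young's inequality. Both terms carry the same window \<open>k\<close>, so the forcing is measured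
  by its own tail.\<close>

lemma tail_energy_young:
  assumes "d > 0"
  shows "2 * inner f (weight q k u) \<le> d * tail_energy q k u + tail_energy q k f / d"
proof -
  have "0 \<le> tail_energy q k (d *\<^sub>R u - f)" by (rule tail_energy_nonneg)
  also have "\<dots> = d\<^sup>2 * tail_energy q k u - 2 * d * inner f (weight q k u) + tail_energy q k f"
    unfolding tail_energy_def linear_diff[OF bounded_linear.linear[OF bounded_linear_weight]]
      linear_scale[OF bounded_linear.linear[OF bounded_linear_weight]]
    by (simp add: inner_diff_left inner_diff_right weight_symmetric[of u k f] power2_eq_square algebra_simps)
  finally have "2 * d * inner f (weight q k u) \<le> d * (d * tail_energy q k u + tail_energy q k f / d)"
    using assms by (simp add: power2_eq_square algebra_simps)
  then show ?thesis using assms by (simp add: mult.assoc mult.left_commute[of 2])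
qed

lemma tail_energy_derivative:
  assumes "(u has_vector_derivative v) (at t within A)"
  shows "((\<lambda>s. tail_energy q k (u s)) has_real_derivative 2 * inner v (weight q k (u t))) (at t within A)"
proof -
  have "((\<lambda>s. weight q k (u s)) has_vector_derivative weight q k v) (at t within A)"
    by (rule bounded_linear.has_vector_derivative[OF bounded_linear_weight assms])
  then have "((\<lambda>s. inner (u s) (weight q k (u s))) has_derivative
      (\<lambda>h. inner (u t) (h *\<^sub>R weight q k v) + inner (h *\<^sub>R v) (weight q k (u t)))) (at t within A)"
    using assms unfolding has_vector_derivative_def by (rule has_derivative_inner[rotated])
  then show ?thesis
    unfolding tail_energy_def has_field_derivative_def
    by (rule has_derivative_eq_rhs) (auto simp: weight_symmetric[of "u t" k v] algebra_simps)
qed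

end

text \<open>Far out the weights stay 1, but there the plain energy of a fixed \<open>u\<close> is
  small; on the remaining finite set each weight tends to 0 because \<open>q > 1\<close>.\<close>

lemma eventually_tail_energy_less:
  assumes q: "1 < q" and "e > 0"
  shows "\<forall>\<^sub>F k in sequentially. tail_energy q k u < e"
proof -
  obtain n where n: "norm ((\<Sum>j\<in>int_decode ` {..<n}. coord u j *\<^sub>R unit_vec j) - u) < sqrt (e / 2)"
    using tendstoD[OF tendsto_finite_parts_nat[of u], of "sqrt (e / 2)"] \<open>e > 0\<close>
    by (auto simp: dist_norm eventually_sequentially)
  define I where "I = int_decode ` {..<n}"
  have I: "finite I" by (simp add: I_def)
  have "(\<Sum>\<^sub>\<infinity>i\<in>-I. (coord u i)\<^sup>2) = (norm ((\<Sum>j\<in>I. coord u j *\<^sub>R unit_vec j) - u))\<^sup>2"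
    unfolding norm_sq_eq_infsum using I by (intro infsum_cong_neutral) (auto simp: coord_finite_part)
  also have "\<dots> < (sqrt (e / 2))\<^sup>2" using n unfolding I_def by (intro power_strict_mono) auto
  finally have out: "(\<Sum>\<^sub>\<infinity>i\<in>-I. (coord u i)\<^sup>2) < e / 2" using \<open>e > 0\<close> by simp
  have "(\<lambda>k. wt q k i) \<longlonglongrightarrow> 0" for i
  proof -
    have "(\<lambda>k. (1 / q) ^ k) \<longlonglongrightarrow> 0" using q by (intro LIMSEQ_realpow_zero) auto
    \<comment> \<open>Delaying the index by \<open>nat \<bar>i\<bar>\<close> removes the truncated
      subtraction and leaves a pure power.\<close>
    then have "(\<lambda>k. wt q (k + nat \<bar>i\<bar>) i) \<longlonglongrightarrow> 0" by (simp add: wt_def)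
    then show ?thesis by (rule LIMSEQ_offset)
  qed
  then have "(\<lambda>k. \<Sum>i\<in>I. wt q k i * (coord u i)\<^sup>2) \<longlonglongrightarrow> (\<Sum>i\<in>I. 0 * (coord u i)\<^sup>2)"
    by (intro tendsto_intros)
  then have ev: "\<forall>\<^sub>F k in sequentially. (\<Sum>i\<in>I. wt q k i * (coord u i)\<^sup>2) < e / 2"
    using \<open>e > 0\<close> by (intro order_tendstoD) auto
  have le: "tail_energy q k u \<le> (\<Sum>i\<in>I. wt q k i * (coord u i)\<^sup>2) + (\<Sum>\<^sub>\<infinity>i\<in>-I. (coord u i)\<^sup>2)" for k
  proof -
    have "tail_energy q k u = (\<Sum>\<^sub>\<infinity>i\<in>I \<union> - I. wt q k i * (coord u i)\<^sup>2)"
      using q by (simp add: tail_energy_infsum)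
    also have "\<dots> = (\<Sum>i\<in>I. wt q k i * (coord u i)\<^sup>2) + (\<Sum>\<^sub>\<infinity>i\<in>-I. wt q k i * (coord u i)\<^sup>2)"
      using q I by (subst infsum_Un_disjoint) (auto intro: weighted_sq_summable)
    also have "(\<Sum>\<^sub>\<infinity>i\<in>-I. wt q k i * (coord u i)\<^sup>2) \<le> (\<Sum>\<^sub>\<infinity>i\<in>-I. (coord u i)\<^sup>2)"
      using q mult_right_mono[OF wt_le_1[of q k]]
      by (intro infsum_mono weighted_sq_summable coord_sq_summable) fastforce+
    finally show ?thesis by simp
  qed
  show ?thesis using ev by eventually_elim (use le out in \<open>fastforce intro: le_less_trans\<close>)
qed

text \<open>Translation invariance of the sum over all integers replaces summation by parts: there
  is no boundary, so flux differences sum to 0.\<close>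

lemma infsum_shift_difference:
  fixes p :: "int \<Rightarrow> real"
  assumes "p summable_on UNIV"
  shows "(\<lambda>i. p (i + k) - p i) summable_on UNIV" "(\<Sum>\<^sub>\<infinity>i. p (i + k) - p i) = 0"
proof -
  have s: "(\<lambda>i. p (i + k)) summable_on UNIV"
    using summable_on_reindex_bij_betw[of "\<lambda>i. i + k" UNIV UNIV p] assms bij_plus_right[of k] by simp
  have e: "(\<Sum>\<^sub>\<infinity>i. p (i + k)) = infsum p UNIV"
    using infsum_reindex_bij_betw[of "\<lambda>i. i + k" UNIV UNIV p] bij_plus_right[of k] by simp
  have "(\<lambda>i. - p i) summable_on UNIV" using assms by (rule summable_on_uminus[THEN iffD2])
  then show "(\<lambda>i. p (i + k) - p i) summable_on UNIV" "(\<Sum>\<^sub>\<infinity>i. p (i + k) - p i) = 0"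
    using summable_on_add[OF s, of "\<lambda>i. - p i"] infsum_add[OF s, of "\<lambda>i. - p i"] e
    by (simp_all add: infsum_uminus)
qed

text \<open>The difference of the two sides is a multiple of
  \<open>(a - b)\<^sup>2 * (2 * a + b)\<close>. The mixed convection term is traded for pure cubes,
  one of which telescopes between neighbours.\<close>

lemma cubic_young:
  fixes a b :: real
  assumes "0 \<le> a" "0 \<le> b"
  shows "a\<^sup>2 * b \<le> (2 * a ^ 3 + b ^ 3) / 3"
proof -
  have "0 \<le> (a - b)\<^sup>2 * (2 * a + b)" using assms by simp
  also have "\<dots> = 2 * a ^ 3 + b ^ 3 - 3 * (a\<^sup>2 * b)" by (simp add: power2_eq_square power3_eq_cube algebra_simps)
  finally show ?thesis by simp
qed

text \<open>The last three terms on the right telescope when the inequality is summed over the lattice.\<close>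

lemma lattice_energy_pointwise:
  fixes a b c e w wb wc q \<alpha> \<beta> \<gamma> \<nu> :: real
  assumes pos: "\<alpha> > 0" "\<beta> > 0" "\<gamma> > 0" "\<nu> > 0" "e > 0" "w > 0"
    and w: "w \<le> q * wb" "w \<le> q * wc"
  shows "w * a * (\<nu> * (2 * a - b - c) - \<alpha> * e * (a * (b - a)) - \<beta> * e\<^sup>2 * (a * a * a) + \<beta> * (1 + \<gamma>) * e * (a * a))
    \<le> w * a\<^sup>2 * ((3 + q) * \<nu> + ((5 + q) / 3 * \<alpha> + \<beta> * (1 + \<gamma>))\<^sup>2 / (4 * \<beta>))
      + q * \<alpha> * e / 3 * (wb * \<bar>b\<bar> ^ 3 - w * \<bar>a\<bar> ^ 3)
      + q * \<nu> / 2 * (wb * b\<^sup>2 - w * a\<^sup>2) + q * \<nu> / 2 * (wc * c\<^sup>2 - w * a\<^sup>2)"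
proof -
  \<comment> \<open>\<open>s\<close> collects the cubic contributions at one site: 5/3 from the site
    itself (1 directly, 2/3 from \<open>cubic_young\<close>), \<open>q / 3\<close> from a telescoped
    neighbour cube, and the reaction term. At \<open>q = 1\<close> it is the base of the square in
    \<open>lambda_star\<close>.\<close>
  define s where "s = (5 + q) / 3 * \<alpha> + \<beta> * (1 + \<gamma>)"
  define A where "A = \<bar>a\<bar>"
  have A: "A \<ge> 0" "a\<^sup>2 = A\<^sup>2" by (auto simp: A_def)
  \<comment> \<open>This term adds energy. Dropping the squares of \<open>a + b\<close> and
    \<open>a + c\<close> leaves 3 at the site and 1/2 at each neighbour, which telescoping turns
    into \<open>3 + q\<close>.\<close>
  have lap: "w * (a * (2 * a - b - c)) \<le> w * (3 * a\<^sup>2) + q * wb * b\<^sup>2 / 2 + q * wc * c\<^sup>2 / 2"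
  proof -
    have "a * (2 * a - b - c) = 3 * a\<^sup>2 + b\<^sup>2 / 2 + c\<^sup>2 / 2 - ((a + b)\<^sup>2 + (a + c)\<^sup>2) / 2"
      by (simp add: power2_eq_square algebra_simps)
    then have "a * (2 * a - b - c) \<le> 3 * a\<^sup>2 + b\<^sup>2 / 2 + c\<^sup>2 / 2" by simp
    then have "w * (a * (2 * a - b - c)) \<le> w * (3 * a\<^sup>2 + b\<^sup>2 / 2 + c\<^sup>2 / 2)"
      using pos by (intro mult_left_mono) auto
    also have "\<dots> = w * (3 * a\<^sup>2) + w * (b\<^sup>2 / 2) + w * (c\<^sup>2 / 2)" by (simp add: algebra_simps)
    also have "w * (b\<^sup>2 / 2) \<le> q * wb * (b\<^sup>2 / 2)" using w by (intro mult_right_mono) auto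
    also have "w * (c\<^sup>2 / 2) \<le> q * wc * (c\<^sup>2 / 2)" using w by (intro mult_right_mono) auto
    finally show ?thesis by simp
  qed
  have conv: "w * (- (a\<^sup>2 * (b - a))) \<le> w * (5 / 3 * A ^ 3) + q * wb * \<bar>b\<bar> ^ 3 / 3"
  proof -
    have "- (a\<^sup>2 * (b - a)) = a\<^sup>2 * (a - b)" by (simp add: algebra_simps)
    also have "\<dots> \<le> A\<^sup>2 * (A + \<bar>b\<bar>)" unfolding A(2)[symmetric] by (intro mult_left_mono) (auto simp: A_def)
    also have "\<dots> = A ^ 3 + A\<^sup>2 * \<bar>b\<bar>" by (simp add: power2_eq_square power3_eq_cube algebra_simps)
    also have "\<dots> \<le> 5 / 3 * A ^ 3 + \<bar>b\<bar> ^ 3 / 3"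
      using cubic_young[of A "\<bar>b\<bar>"] A by (simp add: field_simps)
    finally have "w * (- (a\<^sup>2 * (b - a))) \<le> w * (5 / 3 * A ^ 3 + \<bar>b\<bar> ^ 3 / 3)"
      using pos by (intro mult_left_mono) auto
    also have "\<dots> = w * (5 / 3 * A ^ 3) + w * (\<bar>b\<bar> ^ 3 / 3)" by (simp add: algebra_simps)
    also have "w * (\<bar>b\<bar> ^ 3 / 3) \<le> q * wb * (\<bar>b\<bar> ^ 3 / 3)" using w by (intro mult_right_mono) auto
    finally show ?thesis by simp
  qed
  \<comment> \<open>The quartic damping absorbs the cubic terms by completing the square. The factor
    \<open>e\<close> cancels, so the bound is independent of the noise.\<close>
  have react: "s * e * A ^ 3 - \<beta> * e\<^sup>2 * A ^ 4 \<le> A\<^sup>2 * (s\<^sup>2 / (4 * \<beta>))"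
  proof -
    have "0 \<le> A\<^sup>2 / \<beta> * (\<beta> * e * A - s / 2)\<^sup>2" using pos by simp
    also have "\<dots> = \<beta> * e\<^sup>2 * A ^ 4 - s * e * A ^ 3 + A\<^sup>2 * (s\<^sup>2 / (4 * \<beta>))"
      using pos by (simp add: field_simps power2_eq_square power3_eq_cube power4_eq_xxxx)
    finally show ?thesis by simp
  qed
  have cub: "\<beta> * (1 + \<gamma>) * e * a ^ 3 \<le> \<beta> * (1 + \<gamma>) * e * A ^ 3"
    using pos by (intro mult_left_mono) (auto simp: A_def power_abs[symmetric])
  have "w * (s * e * A ^ 3 - \<beta> * e\<^sup>2 * A ^ 4) \<le> w * (A\<^sup>2 * (s\<^sup>2 / (4 * \<beta>)))"
    using pos by (intro mult_left_mono react) auto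
  moreover have "s * e * A ^ 3 = 5 / 3 * \<alpha> * e * A ^ 3 + q / 3 * \<alpha> * e * A ^ 3 + \<beta> * (1 + \<gamma>) * e * A ^ 3"
    by (simp add: s_def field_simps)
  ultimately have react': "w * (5 / 3 * \<alpha> * e * A ^ 3) + w * (q / 3 * \<alpha> * e * A ^ 3)
      + w * (\<beta> * (1 + \<gamma>) * e * A ^ 3) - w * (\<beta> * e\<^sup>2 * A ^ 4) \<le> w * (A\<^sup>2 * (s\<^sup>2 / (4 * \<beta>)))"
    by (simp only: right_diff_distrib distrib_left)
  have cub': "w * (\<beta> * (1 + \<gamma>) * e * a ^ 3) \<le> w * (\<beta> * (1 + \<gamma>) * e * A ^ 3)"
    using pos by (intro mult_left_mono cub) auto
  have lap': "\<nu> * (w * (a * (2 * a - b - c))) \<le> \<nu> * (w * (3 * a\<^sup>2) + q * wb * b\<^sup>2 / 2 + q * wc * c\<^sup>2 / 2)"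
    using pos by (intro mult_left_mono lap) auto
  have conv': "\<alpha> * e * (w * (- (a\<^sup>2 * (b - a)))) \<le> \<alpha> * e * (w * (5 / 3 * A ^ 3) + q * wb * \<bar>b\<bar> ^ 3 / 3)"
    using pos by (intro mult_left_mono conv) auto
  have "w * a * (\<nu> * (2 * a - b - c) - \<alpha> * e * (a * (b - a)) - \<beta> * e\<^sup>2 * (a * a * a) + \<beta> * (1 + \<gamma>) * e * (a * a))
      = \<nu> * (w * (a * (2 * a - b - c))) + \<alpha> * e * (w * (- (a\<^sup>2 * (b - a)))) - w * (\<beta> * e\<^sup>2 * A ^ 4)
        + w * (\<beta> * (1 + \<gamma>) * e * a ^ 3)"
  proof -
    have "A ^ 4 = (A\<^sup>2)\<^sup>2" by simp
    then have "A ^ 4 = a * a * a * a" unfolding A(2)[symmetric] by (simp add: power2_eq_square)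
    then show ?thesis by (simp add: power2_eq_square power3_eq_cube algebra_simps)
  qed
  also have "\<dots> \<le> \<nu> * (w * (3 * a\<^sup>2) + q * wb * b\<^sup>2 / 2 + q * wc * c\<^sup>2 / 2)
      + \<alpha> * e * (w * (5 / 3 * A ^ 3) + q * wb * \<bar>b\<bar> ^ 3 / 3) + w * (\<beta> * (1 + \<gamma>) * e * A ^ 3)
      - w * (\<beta> * e\<^sup>2 * A ^ 4)"
    using lap' conv' cub' by linarith
  also have "\<dots> \<le> \<nu> * (w * (3 * a\<^sup>2) + q * wb * b\<^sup>2 / 2 + q * wc * c\<^sup>2 / 2)
      + \<alpha> * e * (q * wb * \<bar>b\<bar> ^ 3 / 3) + w * (A\<^sup>2 * (s\<^sup>2 / (4 * \<beta>))) - w * (q / 3 * \<alpha> * e * A ^ 3)"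
    using react' by (simp add: algebra_simps)
  also have "\<dots> = w * a\<^sup>2 * ((3 + q) * \<nu> + s\<^sup>2 / (4 * \<beta>))
      + q * \<alpha> * e / 3 * (wb * \<bar>b\<bar> ^ 3 - w * \<bar>a\<bar> ^ 3)
      + q * \<nu> / 2 * (wb * b\<^sup>2 - w * a\<^sup>2) + q * \<nu> / 2 * (wc * c\<^sup>2 - w * a\<^sup>2)"
    by (simp add: A_def algebra_simps)
  finally show ?thesis by (simp add: s_def)
qed

section \<open>The energy balance of the lattice field\<close>

lemma coord_Lap [simp]: "coord (Lap u) i = - coord u (i - 1) + 2 * coord u i - coord u (i + 1)"
  and coord_Dminus [simp]: "coord (Dminus u) i = coord u (i - 1) - coord u i"
  and coord_reaction [simp]: "coord (reaction g u) i = coord u i * (1 - coord u i) * (coord u i - g)"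
  by (simp_all add: Lap.rep_eq Dminus.rep_eq reaction.rep_eq)

lemma random_field_coord:
  "coord (random_field \<alpha> \<beta> \<gamma> \<nu> lam f 1 z u) i =
    \<nu> * (2 * coord u i - coord u (i - 1) - coord u (i + 1))
    - \<alpha> * exp z * (coord u i * (coord u (i - 1) - coord u i))
    - \<beta> * (exp z)\<^sup>2 * (coord u i * coord u i * coord u i)
    + \<beta> * (1 + \<gamma>) * exp z * (coord u i * coord u i)
    + (z - lam - \<beta> * \<gamma>) * coord u i + exp (- z) * coord f i"
proof -
  have "exp (2 * z) = (exp z)\<^sup>2" by (simp add: exp_double)
  then show ?thesis by (simp add: random_field_def algebra_simps)
qed

text \<open>At \<open>q = 1\<close> this is
  \<open>lam - lambda_star \<alpha> \<beta> \<gamma> \<nu>\<close>; by continuity it stays positive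
  for some \<open>q\<close> above 1, the room needed for nonconstant weights.\<close>

definition decay_rate :: "real \<Rightarrow> real \<Rightarrow> real \<Rightarrow> real \<Rightarrow> real \<Rightarrow> real \<Rightarrow> real" where
  "decay_rate \<alpha> \<beta> \<gamma> \<nu> lam q =
     lam + \<beta> * \<gamma> - (3 + q) * \<nu> - ((5 + q) / 3 * \<alpha> + \<beta> * (1 + \<gamma>))\<^sup>2 / (4 * \<beta>)"

lemma decay_rate_positive:
  assumes "\<beta> > 0" "lam > lambda_star \<alpha> \<beta> \<gamma> \<nu>"
  obtains q where "q > 1" "decay_rate \<alpha> \<beta> \<gamma> \<nu> lam q > 0"
proof -
  have "isCont (decay_rate \<alpha> \<beta> \<gamma> \<nu> lam) 1"
    unfolding decay_rate_def[abs_def] using assms(1) by (intro continuous_intros) auto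
  then have "(decay_rate \<alpha> \<beta> \<gamma> \<nu> lam \<longlongrightarrow> decay_rate \<alpha> \<beta> \<gamma> \<nu> lam 1) (at_right 1)"
    by (simp add: isCont_def filterlim_at_split)
  moreover have "decay_rate \<alpha> \<beta> \<gamma> \<nu> lam 1 > 0"
    using assms by (simp add: decay_rate_def lambda_star_def algebra_simps)
  ultimately have "\<forall>\<^sub>F q in at_right 1. decay_rate \<alpha> \<beta> \<gamma> \<nu> lam q > 0"
    by (rule order_tendstoD(1))
  moreover have "\<forall>\<^sub>F q :: real in at_right 1. q > 1" by (simp add: eventually_at_right_less)
  ultimately have "\<forall>\<^sub>F q in at_right 1. q > 1 \<and> decay_rate \<alpha> \<beta> \<gamma> \<nu> lam q > 0"
    by (rule eventually_conj[rotated])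
  then show thesis using that eventually_happens[of _ "at_right (1::real)"] by (auto simp: trivial_limit_at_right_real)
qed

lemma random_field_energy:
  assumes pos: "\<alpha> > 0" "\<beta> > 0" "\<gamma> > 0" "\<nu> > 0" and q: "q \<ge> 1"
  shows "inner (random_field \<alpha> \<beta> \<gamma> \<nu> lam f 1 z u) (weight q k u)
    \<le> (- decay_rate \<alpha> \<beta> \<gamma> \<nu> lam q + z) * tail_energy q k u + exp (- z) * inner f (weight q k u)"
proof -
  define F where "F = random_field \<alpha> \<beta> \<gamma> \<nu> lam f 1 z u"
  define w where "w = wt q k"
  define x where "x = coord u"
  \<comment> \<open>\<open>p\<close> and \<open>m\<close> are fluxes whose shifted differences carry
    the neighbour terms of the pointwise inequality. Convection looks only to the left, hence one
    shift of \<open>p\<close>; the Laplacian needs both shifts of \<open>m\<close>.\<close>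
  define p where "p = (\<lambda>i. q * \<alpha> * exp z / 3 * (w i * \<bar>x i\<bar> ^ 3))"
  define m where "m = (\<lambda>i. q * \<nu> / 2 * (w i * (x i)\<^sup>2))"
  define R where "R = (\<lambda>i. (- decay_rate \<alpha> \<beta> \<gamma> \<nu> lam q + z) * (w i * (x i)\<^sup>2) + exp (- z) * (w i * (coord f i * x i)))"
  have pw: "w i * (coord F i * x i) \<le> R i + ((p (i + - 1) - p i) + ((m (i + - 1) - m i) + (m (i + 1) - m i)))" for i
  proof -
    have "w i * x i * (\<nu> * (2 * x i - x (i - 1) - x (i + 1)) - \<alpha> * exp z * (x i * (x (i - 1) - x i))
        - \<beta> * (exp z)\<^sup>2 * (x i * x i * x i) + \<beta> * (1 + \<gamma>) * exp z * (x i * x i))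
      \<le> w i * (x i)\<^sup>2 * ((3 + q) * \<nu> + ((5 + q) / 3 * \<alpha> + \<beta> * (1 + \<gamma>))\<^sup>2 / (4 * \<beta>))
        + q * \<alpha> * exp z / 3 * (w (i - 1) * \<bar>x (i - 1)\<bar> ^ 3 - w i * \<bar>x i\<bar> ^ 3)
        + q * \<nu> / 2 * (w (i - 1) * (x (i - 1))\<^sup>2 - w i * (x i)\<^sup>2)
        + q * \<nu> / 2 * (w (i + 1) * (x (i + 1))\<^sup>2 - w i * (x i)\<^sup>2)"
      unfolding w_def
      by (rule lattice_energy_pointwise) (use pos q in \<open>auto intro!: wt_neighbour wt_pos\<close>)
    moreover have "w i * (coord F i * x i) = w i * x i * (\<nu> * (2 * x i - x (i - 1) - x (i + 1))
        - \<alpha> * exp z * (x i * (x (i - 1) - x i)) - \<beta> * (exp z)\<^sup>2 * (x i * x i * x i)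
        + \<beta> * (1 + \<gamma>) * exp z * (x i * x i)) + (z - lam - \<beta> * \<gamma>) * (w i * (x i)\<^sup>2)
        + exp (- z) * (w i * (coord f i * x i))"
      unfolding F_def random_field_coord x_def[symmetric] by (simp add: algebra_simps power2_eq_square)
    ultimately show ?thesis
      unfolding R_def p_def m_def decay_rate_def by (simp add: algebra_simps)
  qed
  \<comment> \<open>Cubes are summable because one factor is bounded by \<open>norm u\<close>,
    leaving the weighted energy.\<close>
  have "(\<lambda>i. w i * \<bar>x i\<bar> ^ 3) summable_on UNIV"
  proof (rule abs_summable_summable, rule Infinite_Sum.abs_summable_on_comparison_test)
    show "(\<lambda>i. norm (norm u * (w i * (x i)\<^sup>2))) summable_on UNIV"
      using summable_on_cmult_right[OF weighted_sq_summable[OF q, of k u UNIV], of "norm u"] wt_pos[OF q, of k]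
      by (simp add: w_def x_def abs_mult less_imp_le)
    show "norm (w i * \<bar>x i\<bar> ^ 3) \<le> norm (norm u * (w i * (x i)\<^sup>2))" for i
      using mult_right_mono[OF abs_coord_le_norm[of u i], of "\<bar>w i * (x i)\<^sup>2\<bar>"]
      by (simp add: w_def x_def abs_mult power3_eq_cube power2_eq_square mult_ac)
  qed
  then have ps: "p summable_on UNIV" unfolding p_def by (rule summable_on_cmult_right)
  have ms: "m summable_on UNIV"
    unfolding m_def w_def x_def by (intro summable_on_cmult_right weighted_sq_summable q)
  have Rs: "R summable_on UNIV"
    unfolding R_def w_def x_def
    by (intro summable_on_add summable_on_cmult_right weighted_sq_summable weighted_summable q)
  have "inner F (weight q k u) = (\<Sum>\<^sub>\<infinity>i. w i * (coord F i * x i))"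
    using q by (simp add: inner_weight w_def x_def)
  also have "\<dots> \<le> (\<Sum>\<^sub>\<infinity>i. R i + ((p (i + - 1) - p i) + ((m (i + - 1) - m i) + (m (i + 1) - m i))))"
    using weighted_summable[OF q, of k F u UNIV]
    by (intro infsum_mono pw summable_on_add Rs infsum_shift_difference ps ms) (simp add: w_def x_def)
  also have "\<dots> = infsum R UNIV"
  proof -
    define a b c where abc: "a = (\<lambda>i. p (i + - 1) - p i)" "b = (\<lambda>i. m (i + - 1) - m i)" "c = (\<lambda>i. m (i + 1) - m i)"
    have "a summable_on UNIV" "b summable_on UNIV" "c summable_on UNIV"
      "infsum a UNIV = 0" "infsum b UNIV = 0" "infsum c UNIV = 0"
      unfolding abc by (intro infsum_shift_difference ps ms)+
    then have "(\<Sum>\<^sub>\<infinity>i. R i + (a i + (b i + c i))) = infsum R UNIV"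
      by (simp add: infsum_add summable_on_add Rs)
    then show ?thesis unfolding abc .
  qed
  also have "\<dots> = (- decay_rate \<alpha> \<beta> \<gamma> \<nu> lam q + z) * tail_energy q k u + exp (- z) * inner f (weight q k u)"
    unfolding R_def w_def x_def using q
    by (simp add: infsum_add summable_on_cmult_right weighted_sq_summable weighted_summable
        infsum_cmult_right' tail_energy_infsum inner_weight)
  finally show ?thesis by (simp add: F_def)
qed

section \<open>Maps that are Lipschitz on bounded sets\<close>

text \<open>Balls of an infinite-dimensional space are not compact, so local Lipschitz continuity
  would give no uniform constant on them. The class is closed under sums, bounded bilinear products
  and composition, which covers all terms of the field.\<close>

definition bounded_lipschitz :: "('a::metric_space \<Rightarrow> 'b::metric_space) \<Rightarrow> bool" where
  "bounded_lipschitz g \<longleftrightarrow> (\<forall>S. bounded S \<longrightarrow> (\<exists>L. L-lipschitz_on S g))"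

lemma bounded_lipschitzD:
  "bounded_lipschitz g \<Longrightarrow> bounded S \<Longrightarrow> \<exists>L. L-lipschitz_on S g"
  unfolding bounded_lipschitz_def by blast

lemma bounded_lipschitz_const: "bounded_lipschitz (\<lambda>_. c)"
  unfolding bounded_lipschitz_def by (intro allI impI exI) (rule lipschitz_on_constant)

lemma bounded_lipschitz_add:
  fixes g h :: "'a::metric_space \<Rightarrow> 'b::real_normed_vector"
  shows "bounded_lipschitz g \<Longrightarrow> bounded_lipschitz h \<Longrightarrow> bounded_lipschitz (\<lambda>x. g x + h x)"
  unfolding bounded_lipschitz_def using lipschitz_on_add[of _ _ g _ h] by fast

lemma bounded_lipschitz_diff:
  fixes g h :: "'a::metric_space \<Rightarrow> 'b::real_normed_vector"
  shows "bounded_lipschitz g \<Longrightarrow> bounded_lipschitz h \<Longrightarrow> bounded_lipschitz (\<lambda>x. g x - h x)"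
  unfolding bounded_lipschitz_def using lipschitz_on_diff[of _ _ g _ h] by fast

lemma bounded_linear_bounded_lipschitz: "bounded_linear g \<Longrightarrow> bounded_lipschitz g"
  unfolding bounded_lipschitz_def by (metis bounded_linear.lipschitz_boundE)

lemma lipschitz_on_bounded_image:
  assumes "L-lipschitz_on S g" "bounded S"
  shows "bounded (g ` S)"
proof -
  obtain x e where e: "\<And>y. y \<in> S \<Longrightarrow> dist x y \<le> e" using assms(2) by (auto simp: bounded_def)
  show ?thesis
  proof (cases "S = {}")
    case False
    then obtain z where z: "z \<in> S" by blast
    have "dist (g z) (g y) \<le> L * (2 * e)" if "y \<in> S" for y
    proof -
      have "dist z y \<le> 2 * e" using e[OF z] e[OF that] dist_triangle3[of z y x] by linarith
      then show ?thesis
        using lipschitz_onD[OF assms(1) z that] mult_left_mono[OF _ lipschitz_on_nonneg[OF assms(1)]]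
        by fastforce
    qed
    then show ?thesis by (auto simp: bounded_def)
  qed simp
qed

lemma bounded_lipschitz_compose:
  fixes g :: "'b::metric_space \<Rightarrow> 'c::metric_space" and h :: "'a::metric_space \<Rightarrow> 'b"
  assumes "bounded_lipschitz g" "bounded_lipschitz h"
  shows "bounded_lipschitz (\<lambda>x. g (h x))"
  unfolding bounded_lipschitz_def
proof (intro allI impI)
  fix S :: "'a set" assume S: "bounded S"
  obtain L where L: "L-lipschitz_on S h" using bounded_lipschitzD[OF assms(2) S] ..
  obtain M where M: "M-lipschitz_on (h ` S) g"
    using bounded_lipschitzD[OF assms(1) lipschitz_on_bounded_image[OF L S]] ..
  show "\<exists>L. L-lipschitz_on S (\<lambda>x. g (h x))" using lipschitz_on_compose2[OF L M] ..
qed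

lemma bounded_bilinear_bounded_lipschitz:
  fixes g :: "'d::metric_space \<Rightarrow> 'a::real_normed_vector" and h :: "'d \<Rightarrow> 'b::real_normed_vector"
    and B :: "'a \<Rightarrow> 'b \<Rightarrow> 'c::real_normed_vector"
  assumes bil: "bounded_bilinear B" and "bounded_lipschitz g" "bounded_lipschitz h"
  shows "bounded_lipschitz (\<lambda>x. B (g x) (h x))"
  unfolding bounded_lipschitz_def
proof (intro allI impI)
  fix S :: "'d set" assume S: "bounded S"
  obtain L where L: "L-lipschitz_on S g" using bounded_lipschitzD[OF assms(2) S] ..
  obtain M where M: "M-lipschitz_on S h" using bounded_lipschitzD[OF assms(3) S] ..
  obtain b where b: "\<And>x. x \<in> S \<Longrightarrow> norm (g x) \<le> b" "0 < b"
    using lipschitz_on_bounded_image[OF L S] by (auto simp: bounded_pos)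
  obtain C where C: "\<And>x. x \<in> S \<Longrightarrow> norm (h x) \<le> C" "0 < C"
    using lipschitz_on_bounded_image[OF M S] by (auto simp: bounded_pos)
  obtain K where K: "\<And>a c. norm (B a c) \<le> norm a * norm c * K" "0 \<le> K"
    using bounded_bilinear.nonneg_bounded[OF bil] by blast
  have LM: "0 \<le> L" "0 \<le> M" using L M lipschitz_on_nonneg by auto
  have "((L * C + b * M) * K)-lipschitz_on S (\<lambda>x. B (g x) (h x))"
  proof (rule lipschitz_onI)
    fix x y assume xy: "x \<in> S" "y \<in> S"
    have "B (g x) (h x) - B (g y) (h y) = B (g x - g y) (h x) + B (g y) (h x - h y)"
      by (simp add: bounded_bilinear.diff_left[OF bil] bounded_bilinear.diff_right[OF bil])
    then have "norm (B (g x) (h x) - B (g y) (h y))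
        \<le> norm (g x - g y) * norm (h x) * K + norm (g y) * norm (h x - h y) * K"
      by (simp only:) (intro order_trans[OF norm_triangle_ineq] add_mono K)
    also have "\<dots> \<le> (L * dist x y) * C * K + b * (M * dist x y) * K"
      using lipschitz_onD[OF L xy] lipschitz_onD[OF M xy] b C K LM xy
      by (intro add_mono mult_mono) (auto simp: dist_norm)
    finally show "dist (B (g x) (h x)) (B (g y) (h y)) \<le> (L * C + b * M) * K * dist x y"
      by (simp add: dist_norm algebra_simps)
  qed (use LM b C K in simp)
  then show "\<exists>L. L-lipschitz_on S (\<lambda>x. B (g x) (h x))" ..
qed

lemma bounded_lipschitz_exp: "bounded_lipschitz (exp :: real \<Rightarrow> real)"
  unfolding bounded_lipschitz_def
proof (intro allI impI)
  fix S :: "real set" assume "bounded S"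
  then obtain B where B: "\<And>x. x \<in> S \<Longrightarrow> \<bar>x\<bar> \<le> B" by (auto simp: bounded_iff)
  have *: "exp x - exp y \<le> exp B * (x - y)" if "x \<in> S" "y \<le> x" for x y
  proof -
    have "exp x - exp y = exp x * (1 - exp (y - x))" by (simp add: exp_diff field_simps)
    also have "\<dots> \<le> exp x * (x - y)" using exp_ge_add_one_self[of "y - x"] by (intro mult_left_mono) (linarith, simp)
    also have "\<dots> \<le> exp B * (x - y)" using B[OF that(1)] that by (intro mult_right_mono) auto
    finally show ?thesis .
  qed
  have "(exp B)-lipschitz_on S exp"
  proof (rule lipschitz_onI)
    fix x y assume "x \<in> S" "y \<in> S"
    then show "dist (exp x) (exp y) \<le> exp B * dist x y"
      using *[of x y] *[of y x] by (cases "y \<le> x") (auto simp: dist_real_def)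
  qed simp
  then show "\<exists>L. L-lipschitz_on S exp" ..
qed

lemmas bounded_lipschitz_intros =
  bounded_lipschitz_const bounded_lipschitz_add bounded_lipschitz_diff
  bounded_bilinear_bounded_lipschitz[OF bounded_bilinear_scaleR]
  bounded_bilinear_bounded_lipschitz[OF bounded_bilinear_mult]
  bounded_lipschitz_compose[OF bounded_lipschitz_exp]
  bounded_linear_bounded_lipschitz[OF bounded_linear_fst]
  bounded_linear_bounded_lipschitz[OF bounded_linear_snd]

lemma bounded_lipschitz_continuous_on:
  fixes g :: "'a::real_normed_vector \<Rightarrow> 'b::metric_space"
  assumes "bounded_lipschitz g"
  shows "continuous_on UNIV g"
proof (rule continuous_at_imp_continuous_on, rule ballI)
  fix x
  obtain L where "L-lipschitz_on (ball x 1) g" using bounded_lipschitzD[OF assms bounded_ball] ..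
  then have "continuous_on (ball x 1) g" by (rule lipschitz_on_continuous_on)
  then show "isCont g x" by (simp add: continuous_on_eq_continuous_at)
qed

section \<open>Dissipative ordinary differential equations\<close>

text \<open>The integrating factor \<open>exp (- A r)\<close> makes \<open>h\<close> nonincreasing.
  The exponent is supplied as a primitive \<open>A\<close>, and \<open>g\<close> may change sign, as
  the difference of an energy and its bound does in \<open>flow_dissipation\<close>.\<close>

lemma gronwall_differential:
  fixes g A :: "real \<Rightarrow> real"
  assumes "s \<le> t"
    and g: "\<And>r. r \<in> {s..t} \<Longrightarrow> (g has_real_derivative g' r) (at r within {s..t})"
    and A: "\<And>r. r \<in> {s..t} \<Longrightarrow> (A has_real_derivative a r) (at r within {s..t})"
    and le: "\<And>r. r \<in> {s..t} \<Longrightarrow> g' r \<le> a r * g r"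
  shows "g t \<le> exp (A t - A s) * g s"
proof -
  define h where "h = (\<lambda>r. exp (- A r) * g r)"
  have h: "(h has_real_derivative exp (- A r) * (g' r - a r * g r)) (at r within {s..t})" if "r \<in> {s..t}" for r
    unfolding h_def by (rule derivative_eq_intros g A that refl | simp add: algebra_simps)+
  have "h t \<le> h s"
  proof (rule DERIV_nonpos_imp_decreasing_open[OF assms(1)])
    show "continuous_on {s..t} h"
      unfolding continuous_on_eq_continuous_within using h has_field_derivative_imp_has_derivative
        has_derivative_continuous by blast
    fix r assume r: "s < r" "r < t"
    have "(h has_real_derivative exp (- A r) * (g' r - a r * g r)) (at r)"
      using h[of r] r by (simp add: at_within_Icc_at)
    moreover have "exp (- A r) * (g' r - a r * g r) \<le> 0"
      using le[of r] r by (intro mult_nonneg_nonpos) auto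
    ultimately show "\<exists>y. DERIV h r :> y \<and> y \<le> 0" by blast
  qed
  then have "exp (A t) * h t \<le> exp (A t) * h s" by simp
  then show ?thesis by (simp add: h_def exp_diff exp_minus field_simps)
qed

lemma norm_sq_has_derivative:
  fixes u :: "real \<Rightarrow> 'a::real_inner"
  assumes "(u has_vector_derivative v) (at t within A)"
  shows "((\<lambda>s. (norm (u s))\<^sup>2) has_real_derivative 2 * inner v (u t)) (at t within A)"
proof -
  have "((\<lambda>s. inner (u s) (u s)) has_derivative (\<lambda>h. inner (u t) (h *\<^sub>R v) + inner (h *\<^sub>R v) (u t))) (at t within A)"
    using assms assms unfolding has_vector_derivative_def by (rule has_derivative_inner)
  then show ?thesis
    unfolding power2_norm_eq_inner has_field_derivative_def
    by (rule has_derivative_eq_rhs) (auto simp: inner_commute[of "u t" v] algebra_simps)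
qed

text \<open>One estimate serves three purposes: uniqueness and dependence on the initial value with
  \<open>d = 0\<close>, and the vanishing noise limit with two different driving paths.\<close>

lemma ode_stability:
  fixes u v :: "real \<Rightarrow> 'a::real_inner"
  assumes u: "\<And>t. t \<in> {0..T} \<Longrightarrow> (u has_vector_derivative F (y t) (u t)) (at t within {0..T})"
    and v: "\<And>t. t \<in> {0..T} \<Longrightarrow> (v has_vector_derivative F (z t) (v t)) (at t within {0..T})"
    and S: "\<And>t. t \<in> {0..T} \<Longrightarrow> (y t, u t) \<in> S" "\<And>t. t \<in> {0..T} \<Longrightarrow> (z t, v t) \<in> S"
    and L: "L-lipschitz_on S (\<lambda>(z, u). F z u)"
    and d: "\<And>t. t \<in> {0..T} \<Longrightarrow> \<bar>y t - z t\<bar> \<le> d" and t: "t \<in> {0..T}"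
  shows "(norm (u t - v t))\<^sup>2 \<le> ((norm (u 0 - v 0))\<^sup>2 + d\<^sup>2) * exp (3 * L * t)"
proof -
  \<comment> \<open>Adding the constant \<open>d\<^sup>2\<close> makes the differential inequality
    homogeneous: the term mixing \<open>d\<close> with the distance is absorbed into
    \<open>3 * L * g r\<close>.\<close>
  define g where "g = (\<lambda>t. (norm (u t - v t))\<^sup>2 + d\<^sup>2)"
  have t0: "0 \<le> t" and sub: "{0..t} \<subseteq> {0..T}" using t by auto
  have "g t \<le> exp (3 * L * t - 3 * L * 0) * g 0"
  proof (rule gronwall_differential[OF t0])
    fix r assume r: "r \<in> {0..t}"
    then have rT: "r \<in> {0..T}" using sub by blast
    have uv: "((\<lambda>s. u s - v s) has_vector_derivative F (y r) (u r) - F (z r) (v r)) (at r within {0..t})"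
      by (rule has_vector_derivative_within_subset[OF _ sub])
        (rule has_vector_derivative_diff[OF u[OF rT] v[OF rT]])
    show "(g has_real_derivative 2 * inner (F (y r) (u r) - F (z r) (v r)) (u r - v r)) (at r within {0..t})"
      unfolding g_def by (rule derivative_eq_intros norm_sq_has_derivative[OF uv] refl | simp)+
    show "((\<lambda>s. 3 * L * s) has_real_derivative 3 * L) (at r within {0..t})"
      by (rule derivative_eq_intros refl | simp)+
    define n where "n = norm (u r - v r)"
    have L0: "0 \<le> L" using L by (rule lipschitz_on_nonneg)
    have "norm (F (y r) (u r) - F (z r) (v r)) \<le> L * dist (y r, u r) (z r, v r)"
      using lipschitz_onD[OF L S(1)[OF rT] S(2)[OF rT]] by (simp add: dist_norm)
    also have "\<dots> \<le> L * (d + n)"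
    proof (rule mult_left_mono[OF _ L0])
      have "dist (y r, u r) (z r, v r) \<le> \<bar>y r - z r\<bar> + n"
        unfolding dist_Pair_Pair n_def by (rule order_trans[OF sqrt_sum_squares_le_sum]) (auto simp: dist_norm)
      then show "dist (y r, u r) (z r, v r) \<le> d + n" using d[OF rT] by linarith
    qed
    finally have F: "norm (F (y r) (u r) - F (z r) (v r)) \<le> L * (d + n)" .
    have "inner (F (y r) (u r) - F (z r) (v r)) (u r - v r) \<le> norm (F (y r) (u r) - F (z r) (v r)) * n"
      unfolding n_def by (rule norm_cauchy_schwarz)
    also have "\<dots> \<le> L * (d + n) * n" using F by (intro mult_right_mono) (auto simp: n_def)
    finally have "2 * inner (F (y r) (u r) - F (z r) (v r)) (u r - v r) \<le> L * (2 * (d + n) * n)" by (simp add: algebra_simps)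
    also have "\<dots> \<le> L * (3 * (n\<^sup>2 + d\<^sup>2))"
    proof (rule mult_left_mono[OF _ L0])
      have "0 \<le> (d - n)\<^sup>2 + 2 * d\<^sup>2" by simp
      then show "2 * (d + n) * n \<le> 3 * (n\<^sup>2 + d\<^sup>2)" by (simp add: power2_eq_square algebra_simps)
    qed
    finally show "2 * inner (F (y r) (u r) - F (z r) (v r)) (u r - v r) \<le> 3 * L * g r"
      by (simp add: g_def n_def algebra_simps)
  qed
  then have "(norm (u t - v t))\<^sup>2 + d\<^sup>2 \<le> ((norm (u 0 - v 0))\<^sup>2 + d\<^sup>2) * exp (3 * L * t)"
    by (simp add: g_def mult.commute)
  then show ?thesis using zero_le_power2[of d] by linarith
qed

lemma solution_map_eq:
  assumes "well_posed G" "solves G x u" "0 \<le> t"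
  shows "solution_map G t x = u t"
  unfolding solution_map_def
  by (rule the_equality) (use assms in \<open>auto simp: well_posed_def\<close>)

section \<open>Picard iteration for globally Lipschitz fields\<close>

primrec picard :: "(real \<Rightarrow> 'a \<Rightarrow> 'a) \<Rightarrow> 'a::banach \<Rightarrow> nat \<Rightarrow> real \<Rightarrow> 'a" where
  "picard G x 0 = (\<lambda>t. x)"
| "picard G x (Suc n) = (\<lambda>t. x + integral {0..t} (\<lambda>s. G s (picard G x n s)))"

lemma picard_continuous_on:
  fixes G :: "real \<Rightarrow> 'a::banach \<Rightarrow> 'a"
  assumes cont: "continuous_on UNIV (\<lambda>(t, u). G t u)"
  shows "continuous_on {0..T} (picard G x n)"
    and "continuous_on {0..T} (\<lambda>s. G s (picard G x n s))"
proof -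
  have Gc: "continuous_on A (\<lambda>s. G s (w s))" if "continuous_on A w" for A w
    using continuous_on_compose2[OF cont continuous_on_Pair[OF continuous_on_id that]] by simp
  show pc: "continuous_on {0..T} (picard G x n)" for n
  proof (induction n)
    case (Suc n)
    have "continuous_on {0..T} (\<lambda>t. integral {0..t} (\<lambda>s. G s (picard G x n s)))"
      by (intro indefinite_integral_continuous_1 integrable_continuous_real Gc Suc)
    then show ?case by (auto intro!: continuous_intros)
  qed simp
  then show "continuous_on {0..T} (\<lambda>s. G s (picard G x n s))" by (rule Gc)
qed

lemma picard_solves:
  fixes G :: "real \<Rightarrow> 'a::banach \<Rightarrow> 'a"
  assumes cont: "continuous_on UNIV (\<lambda>(t, u). G t u)"
    and lip: "\<And>T. \<exists>L. \<forall>t\<in>{0..T}. L-lipschitz_on UNIV (G t)"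
  shows "\<exists>u. solves G x u \<and> (\<forall>t\<ge>0. (\<lambda>n. picard G x n t) \<longlonglongrightarrow> u t)"
proof -
  define p where "p = picard G x"
  have Gc: "continuous_on A (\<lambda>s. G s (w s))" if "continuous_on A w" for A w
    using continuous_on_compose2[OF cont continuous_on_Pair[OF continuous_on_id that]] by simp
  have pc: "continuous_on {0..T} (p n)" for n T
    unfolding p_def by (rule picard_continuous_on[OF cont])
  have int: "(\<lambda>s. G s (p n s)) integrable_on {0..t}" for n t
    by (intro integrable_continuous_real Gc pc)
  have lim: "\<exists>u. uniform_limit {0..T} p u sequentially" for T
  proof -
    obtain L0 where L0: "\<And>t. t \<in> {0..T} \<Longrightarrow> L0-lipschitz_on UNIV (G t)" using lip[of T] by blast
    define L where "L = \<bar>L0\<bar> + 1"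
    have L: "0 < L" "\<And>t. t \<in> {0..T} \<Longrightarrow> L-lipschitz_on UNIV (G t)"
      by (auto simp: L_def intro: lipschitz_on_mono[OF L0])
    have "bounded ((\<lambda>t. p (Suc 0) t - p 0 t) ` {0..T})"
      by (intro compact_imp_bounded compact_continuous_image continuous_intros pc) auto
    then obtain C where C: "0 < C" "\<And>t. t \<in> {0..T} \<Longrightarrow> norm (p (Suc 0) t - p 0 t) \<le> C"
      by (auto simp: bounded_pos)
    \<comment> \<open>Against the weight \<open>exp (2 * L * t)\<close> each integration gains a
      factor 1/2 on all of \<open>{0..T}\<close>, so one geometric series converges without
      splitting the interval.\<close>
    have est: "t \<in> {0..T} \<Longrightarrow> norm (p (Suc n) t - p n t) \<le> C * (1 / 2) ^ n * exp (2 * L * t)" for n t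
    proof (induction n arbitrary: t)
      case 0
      have "C * 1 \<le> C * exp (2 * L * t)" using 0 L C by (intro mult_left_mono) auto
      then show ?case using C(2)[OF 0] by simp
    next
      case (Suc n)
      have t: "0 \<le> t" "t \<le> T" using Suc.prems by auto
      define B where "B = C * (1 / 2) ^ n"
      have ei: "((\<lambda>s. L * (B * exp (2 * L * s))) has_integral B / 2 * exp (2 * L * t) - B / 2 * exp (2 * L * 0)) {0..t}"
      proof (rule fundamental_theorem_of_calculus[OF t(1)])
        fix s
        show "((\<lambda>s. B / 2 * exp (2 * L * s)) has_vector_derivative L * (B * exp (2 * L * s))) (at s within {0..t})"
          unfolding has_real_derivative_iff_has_vector_derivative[symmetric]
          by (rule derivative_eq_intros refl | simp)+
      qed
      have "p (Suc (Suc n)) t - p (Suc n) t = integral {0..t} (\<lambda>s. G s (p (Suc n) s) - G s (p n s))"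
        using int[of "Suc n" t] int[of n t] by (simp add: integral_diff p_def)
      also have "norm \<dots> \<le> integral {0..t} (\<lambda>s. L * (B * exp (2 * L * s)))"
      proof (rule integral_norm_bound_integral)
        show "(\<lambda>s. G s (p (Suc n) s) - G s (p n s)) integrable_on {0..t}"
          by (intro integrable_diff int)
        show "(\<lambda>s. L * (B * exp (2 * L * s))) integrable_on {0..t}" using ei by blast
        fix s assume s: "s \<in> {0..t}"
        then have sT: "s \<in> {0..T}" using t by auto
        have "norm (G s (p (Suc n) s) - G s (p n s)) \<le> L * norm (p (Suc n) s - p n s)"
          using lipschitz_onD[OF L(2)[OF sT]] by (simp add: dist_norm)
        also have "\<dots> \<le> L * (B * exp (2 * L * s))"
          using Suc.IH[OF sT] L by (intro mult_left_mono) (auto simp: B_def)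
        finally show "norm (G s (p (Suc n) s) - G s (p n s)) \<le> L * (B * exp (2 * L * s))" .
      qed
      also have "\<dots> = B / 2 * exp (2 * L * t) - B / 2 * exp (2 * L * 0)" using ei by blast
      also have "\<dots> \<le> C * (1 / 2) ^ Suc n * exp (2 * L * t)" using C by (simp add: B_def)
      finally show ?case .
    qed
    have M: "norm (p (Suc n) t - p n t) \<le> C * (1 / 2) ^ n * exp (2 * L * T)" if "t \<in> {0..T}" for n t
      by (rule order_trans[OF est[OF that]]) (use that L C in \<open>auto intro!: mult_left_mono\<close>)
    have "uniform_limit {0..T} (\<lambda>n t. \<Sum>i<n. p (Suc i) t - p i t) (\<lambda>t. \<Sum>i. p (Suc i) t - p i t) sequentially"
      by (rule Weierstrass_m_test[OF M]) (auto intro!: summable_mult summable_mult2 summable_geometric)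
    then have "uniform_limit {0..T} (\<lambda>n t. p 0 t + (\<Sum>i<n. p (Suc i) t - p i t))
        (\<lambda>t. p 0 t + (\<Sum>i. p (Suc i) t - p i t)) sequentially"
      by (intro uniform_limit_add uniform_limit_const)
    moreover have "(\<lambda>n t. p 0 t + (\<Sum>i<n. p (Suc i) t - p i t)) = p"
    proof (intro ext)
      show "p 0 t + (\<Sum>i<n. p (Suc i) t - p i t) = p n t" for n t
        using sum_lessThan_telescope[of "\<lambda>i. p i t" n] by simp
    qed
    ultimately show ?thesis by auto
  qed
  \<comment> \<open>The pointwise limit does not mention \<open>T\<close>, so the uniform limits on
    different intervals are glued automatically.\<close>
  define u where "u = (\<lambda>t. lim (\<lambda>n. p n t))"
  have ul: "uniform_limit {0..T} p u sequentially" for T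
  proof -
    obtain w where w: "uniform_limit {0..T} p w sequentially" using lim[of T] ..
    have "w t = u t" if "t \<in> {0..T}" for t
      unfolding u_def using tendsto_uniform_limitI[OF w that] by (simp add: limI)
    then show ?thesis using w uniform_limit_cong'[of "{0..T}" p p w u] by simp
  qed
  have pu: "(\<lambda>n. p n t) \<longlonglongrightarrow> u t" if "0 \<le> t" for t
    using tendsto_uniform_limitI[OF ul[of t], of t] that by simp
  have uc: "continuous_on {0..T} u" for T
    by (rule uniform_limit_theorem[OF _ ul]) (auto intro!: pc always_eventually)
  have ueq: "u t = x + integral {0..t} (\<lambda>s. G s (u s))" if t: "0 \<le> t" for t
  proof -
    obtain L where L: "\<And>s. s \<in> {0..t} \<Longrightarrow> L-lipschitz_on UNIV (G s)" using lip[of t] by blast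
    have L0: "0 \<le> L" using lipschitz_on_nonneg[OF L[of 0]] t by simp
    have "uniform_limit {0..t} (\<lambda>n s. G s (p n s)) (\<lambda>s. G s (u s)) sequentially"
    proof (rule uniform_limitI)
      fix e :: real assume e: "0 < e"
      have "\<forall>\<^sub>F n in sequentially. \<forall>s\<in>{0..t}. dist (p n s) (u s) < e / (L + 1)"
        using e L0 by (intro uniform_limitD[OF ul]) auto
      then show "\<forall>\<^sub>F n in sequentially. \<forall>s\<in>{0..t}. dist (G s (p n s)) (G s (u s)) < e"
      proof (eventually_elim, intro ballI)
        fix n s assume n: "\<forall>s\<in>{0..t}. dist (p n s) (u s) < e / (L + 1)" and s: "s \<in> {0..t}"
        have "dist (G s (p n s)) (G s (u s)) \<le> L * dist (p n s) (u s)"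
          using lipschitz_onD[OF L[OF s]] by simp
        also have "\<dots> \<le> L * (e / (L + 1))" using n s L0 by (intro mult_left_mono) (auto intro: less_imp_le)
        also have "\<dots> < e" using e L0 by (simp add: field_simps)
        finally show "dist (G s (p n s)) (G s (u s)) < e" .
      qed
    qed
    then obtain I J where IJ: "\<And>n. ((\<lambda>s. G s (p n s)) has_integral I n) {0..t}"
      "((\<lambda>s. G s (u s)) has_integral J) {0..t}" "I \<longlonglongrightarrow> J"
      by (rule uniform_limit_integral) (auto intro!: Gc pc)
    then have "(\<lambda>n. integral {0..t} (\<lambda>s. G s (p n s))) \<longlonglongrightarrow> integral {0..t} (\<lambda>s. G s (u s))"
      by (simp add: IJ(1,2)[THEN integral_unique])
    then have "(\<lambda>n. p (Suc n) t) \<longlonglongrightarrow> x + integral {0..t} (\<lambda>s. G s (u s))"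
      by (simp add: p_def) (intro tendsto_intros)
    moreover have "(\<lambda>n. p (Suc n) t) \<longlonglongrightarrow> u t" using pu[OF t] by (rule LIMSEQ_Suc)
    ultimately show ?thesis using LIMSEQ_unique by blast
  qed
  have "solves G x u"
    unfolding solves_def
  proof (intro conjI allI impI)
    show "u 0 = x" using ueq[of 0] by simp
    fix t :: real assume t: "0 \<le> t"
    \<comment> \<open>The longer interval leaves room to the right of \<open>t\<close>, so the
      derivative within it agrees with the one within the half-line.\<close>
    have "((\<lambda>r. x + integral {0..r} (\<lambda>s. G s (u s))) has_vector_derivative G t (u t)) (at t within {0..t + 1})"
      using integral_has_vector_derivative[of 0 "t + 1" "\<lambda>s. G s (u s)" t] t
      by (auto intro!: derivative_eq_intros Gc uc)
    then have "(u has_vector_derivative G t (u t)) (at t within {0..t + 1})"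
      by (rule has_vector_derivative_transform[rotated 2]) (use t ueq in auto)
    moreover have "at t within {0..t + 1} = at t within {0..}"
      by (rule at_within_nhd[of _ "{..<t + 1}"]) auto
    ultimately show "(u has_vector_derivative G t (u t)) (at t within {0..})" by simp
  qed
  then show ?thesis using pu unfolding p_def by blast
qed

section \<open>Truncation to a ball and dissipative fields\<close>

definition radial_cut :: "real \<Rightarrow> 'a::real_normed_vector \<Rightarrow> 'a" where
  "radial_cut R u = (R / max R (norm u)) *\<^sub>R u"

lemma radial_cut_id: "0 < R \<Longrightarrow> norm u \<le> R \<Longrightarrow> radial_cut R u = u"
  by (simp add: radial_cut_def max_def)

lemma norm_radial_cut: "0 < R \<Longrightarrow> norm (radial_cut R u) \<le> R"
  by (auto simp: radial_cut_def max_def divide_simps)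

text \<open>Moving by \<open>u - v\<close> at fixed scaling and changing the scaling along
  \<open>v\<close> each contribute at most \<open>norm (u - v)\<close>, whence the constant
  2.\<close>

lemma radial_cut_lipschitz:
  assumes "0 < R"
  shows "2-lipschitz_on UNIV (radial_cut R)"
proof (rule lipschitz_onI)
  fix u v :: 'a
  define a b where ab: "a = max R (norm u)" "b = max R (norm v)"
  have a: "0 < a" "R \<le> a" "norm v \<le> b" "0 < b" using assms by (auto simp: ab)
  have diff: "\<bar>b - a\<bar> \<le> norm (u - v)"
    using norm_triangle_ineq3[of v u] unfolding ab by (auto simp: norm_minus_commute max_def)
  have "radial_cut R u - radial_cut R v = (R / a) *\<^sub>R (u - v) + (R * (b - a) / (a * b)) *\<^sub>R v"
  proof -
    have "R * (b - a) / (a * b) = R / a - R / b" using a by (simp add: field_simps)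
    then show ?thesis
      unfolding \<open>R * (b - a) / (a * b) = R / a - R / b\<close>
      by (simp only: radial_cut_def ab[symmetric] scaleR_diff_left scaleR_diff_right) simp
  qed
  also have "norm \<dots> \<le> R / a * norm (u - v) + R * \<bar>b - a\<bar> / (a * b) * norm v"
    using a assms by (intro norm_triangle_le add_mono) (auto simp: abs_mult)
  also have "\<dots> \<le> 1 * norm (u - v) + 1 * norm (u - v)"
  proof (rule add_mono)
    show "R / a * norm (u - v) \<le> 1 * norm (u - v)"
      using a assms by (intro mult_right_mono) auto
    have "R * \<bar>b - a\<bar> / (a * b) * norm v = (R / a) * (norm v / b) * \<bar>b - a\<bar>" by simp
    also have "\<dots> \<le> (1 * 1) * norm (u - v)"
      using a assms diff by (intro mult_mono) auto
    finally show "R * \<bar>b - a\<bar> / (a * b) * norm v \<le> 1 * norm (u - v)" by simp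
  qed
  finally show "dist (radial_cut R u) (radial_cut R v) \<le> 2 * dist u v" by (simp add: dist_norm)
qed simp

text \<open>The one-sided growth bound has a term linear in the norm instead of a constant: in
  \<open>cut_bound\<close> it is applied to a rescaled vector and divided by the scaling factor,
  which a constant would not survive uniformly.\<close>

locale dissipative_field =
  fixes F :: "real \<Rightarrow> 'a::{real_inner, banach} \<Rightarrow> 'a"
  assumes lipschitz: "bounded_lipschitz (\<lambda>(z, u). F z u)"
    and growth: "\<exists>C\<ge>0. \<forall>z u. \<bar>z\<bar> \<le> Z \<longrightarrow> inner (F z u) u \<le> C * ((norm u)\<^sup>2 + norm u)"
begin

definition trajectory :: "real \<Rightarrow> (real \<Rightarrow> real) \<Rightarrow> (real \<Rightarrow> 'a) \<Rightarrow> bool" where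
  "trajectory T y u \<longleftrightarrow>
     (\<forall>t\<in>{0..T}. (u has_vector_derivative F (y t) (u t)) (at t within {0..T}))"

lemma solves_trajectory:
  assumes "solves (\<lambda>t. F (y t)) x u"
  shows "trajectory T y u"
  unfolding trajectory_def
proof
  fix t assume "t \<in> {0..T}"
  then show "(u has_vector_derivative F (y t) (u t)) (at t within {0..T})"
    using assms unfolding solves_def
    by (intro has_vector_derivative_within_subset[of u _ t "{0..}" "{0..T}"]) auto
qed

lemma stability_on_bounded:
  "\<exists>L. \<forall>y z u v d T. trajectory T y u \<longrightarrow> trajectory T z v \<longrightarrow>
     (\<forall>t\<in>{0..T}. \<bar>y t\<bar> \<le> Z \<and> \<bar>z t\<bar> \<le> Z \<and> norm (u t) \<le> r \<and> norm (v t) \<le> r \<and> \<bar>y t - z t\<bar> \<le> d) \<longrightarrow>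
     (\<forall>t\<in>{0..T}. (norm (u t - v t))\<^sup>2 \<le> ((norm (u 0 - v 0))\<^sup>2 + d\<^sup>2) * exp (L * t))"
proof -
  have "bounded ({- Z..Z} \<times> cball (0 :: 'a) r)" by (intro bounded_Times) auto
  then obtain L where L: "L-lipschitz_on ({- Z..Z} \<times> cball 0 r) (\<lambda>(z, u). F z u)"
    using bounded_lipschitzD[OF lipschitz] by blast
  show ?thesis
  proof (intro exI[of _ "3 * L"] allI impI ballI)
    fix y z :: "real \<Rightarrow> real" and u v and d T t
    assume uv: "trajectory T y u" "trajectory T z v"
      and bd: "\<forall>t\<in>{0..T}. \<bar>y t\<bar> \<le> Z \<and> \<bar>z t\<bar> \<le> Z \<and> norm (u t) \<le> r \<and> norm (v t) \<le> r \<and> \<bar>y t - z t\<bar> \<le> d"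
      and t: "t \<in> {0..T}"
    show "(norm (u t - v t))\<^sup>2 \<le> ((norm (u 0 - v 0))\<^sup>2 + d\<^sup>2) * exp (3 * L * t)"
      by (rule ode_stability[where S = "{- Z..Z} \<times> cball 0 r" and F = F, OF _ _ _ _ L _ t])
        (use uv bd in \<open>auto simp: trajectory_def abs_le_iff minus_le_iff\<close>)
  qed
qed

text \<open>\<open>c\<close> stands for the factor by which \<open>radial_cut\<close> shrinks the
  solution, and \<open>c = 1\<close> gives the original field. The bound does not involve
  \<open>c\<close>, hence not the truncation radius.\<close>

lemma cut_bound:
  assumes C: "0 \<le> C" "\<And>z u. \<bar>z\<bar> \<le> Z \<Longrightarrow> inner (F z u) u \<le> C * ((norm u)\<^sup>2 + norm u)"
    and y: "\<And>t. t \<in> {0..T} \<Longrightarrow> \<bar>y t\<bar> \<le> Z"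
    and c: "\<And>t. t \<in> {0..T} \<Longrightarrow> 0 < c t \<and> c t \<le> (1 :: real)"
    and u: "\<And>t. t \<in> {0..T} \<Longrightarrow> (u has_vector_derivative F (y t) (c t *\<^sub>R u t)) (at t within {0..T})"
    and t: "t \<in> {0..T}"
  shows "1 + (norm (u t))\<^sup>2 \<le> (1 + (norm (u 0))\<^sup>2) * exp (4 * C * T)"
proof -
  have t0: "0 \<le> t" and sub: "{0..t} \<subseteq> {0..T}" using t by auto
  have "1 + (norm (u t))\<^sup>2 \<le> exp (4 * C * t - 4 * C * 0) * (1 + (norm (u 0))\<^sup>2)"
  proof (rule gronwall_differential[OF t0])
    fix r assume "r \<in> {0..t}"
    then have r: "r \<in> {0..T}" using sub by blast
    have "(u has_vector_derivative F (y r) (c r *\<^sub>R u r)) (at r within {0..t})"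
      using u[OF r] sub by (rule has_vector_derivative_within_subset)
    from DERIV_add[OF DERIV_const norm_sq_has_derivative[OF this], of 1]
    show "((\<lambda>r. 1 + (norm (u r))\<^sup>2) has_real_derivative 2 * inner (F (y r) (c r *\<^sub>R u r)) (u r)) (at r within {0..t})"
      by simp
    show "((\<lambda>r. 4 * C * r) has_real_derivative 4 * C) (at r within {0..t})"
      by (rule derivative_eq_intros refl | simp)+
    define n where "n = norm (u r)"
    have cr: "0 < c r" "c r \<le> 1" using c[OF r] by auto
    have "c r * inner (F (y r) (c r *\<^sub>R u r)) (u r) \<le> C * ((norm (c r *\<^sub>R u r))\<^sup>2 + norm (c r *\<^sub>R u r))"
      using C(2)[OF y[OF r], of "c r *\<^sub>R u r"] by simp
    also have "\<dots> = c r * (C * (c r * n\<^sup>2 + n))"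
      using cr by (simp add: n_def power2_eq_square algebra_simps)
    finally have "inner (F (y r) (c r *\<^sub>R u r)) (u r) \<le> C * (c r * n\<^sup>2 + n)" using cr by simp
    also have "\<dots> \<le> C * (2 * (1 + n\<^sup>2))"
    proof (rule mult_left_mono[OF _ C(1)])
      have "c r * n\<^sup>2 \<le> n\<^sup>2" using cr by (intro mult_left_le_one_le) auto
      moreover have "0 \<le> (1 - n)\<^sup>2" by simp
      then have "2 * n \<le> 1 + n\<^sup>2" by (simp add: power2_eq_square algebra_simps)
      moreover have "0 \<le> n" by (simp add: n_def)
      ultimately show "c r * n\<^sup>2 + n \<le> 2 * (1 + n\<^sup>2)" by (smt (verit) zero_le_power2)
    qed
    finally show "2 * inner (F (y r) (c r *\<^sub>R u r)) (u r) \<le> 4 * C * (1 + (norm (u r))\<^sup>2)"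
      by (simp add: n_def algebra_simps)
  qed
  also have "\<dots> \<le> exp (4 * C * T) * (1 + (norm (u 0))\<^sup>2)"
    using t C by (intro mult_right_mono) (auto intro: mult_left_mono)
  finally show ?thesis by (simp add: mult.commute)
qed

lemma solution_bounds:
  "\<exists>B. \<forall>y u. trajectory T y u \<longrightarrow> (\<forall>t\<in>{0..T}. \<bar>y t\<bar> \<le> Z) \<longrightarrow> norm (u 0) \<le> r \<longrightarrow>
     (\<forall>t\<in>{0..T}. norm (u t) \<le> B)"
proof -
  obtain C where C: "0 \<le> C" "\<And>z u. \<bar>z\<bar> \<le> Z \<Longrightarrow> inner (F z u) u \<le> C * ((norm u)\<^sup>2 + norm u)"
    using growth by blast
  show ?thesis
  proof (intro exI[of _ "sqrt ((1 + r\<^sup>2) * exp (4 * C * T))"] allI impI ballI)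
    fix y :: "real \<Rightarrow> real" and u t
    assume u: "trajectory T y u" and y: "\<forall>t\<in>{0..T}. \<bar>y t\<bar> \<le> Z" and u0: "norm (u 0) \<le> r"
      and t: "t \<in> {0..T}"
    have "1 + (norm (u t))\<^sup>2 \<le> (1 + (norm (u 0))\<^sup>2) * exp (4 * C * T)"
      by (rule cut_bound[OF C, where y = y and c = "\<lambda>_. 1"]) (use y u t in \<open>auto simp: trajectory_def\<close>)
    also have "\<dots> \<le> (1 + r\<^sup>2) * exp (4 * C * T)" using u0 by (intro mult_right_mono) (auto intro: power_mono)
    finally show "norm (u t) \<le> sqrt ((1 + r\<^sup>2) * exp (4 * C * T))" by (intro real_le_rsqrt) simp
  qed
qed

lemma field_continuous_on: "continuous_on UNIV (\<lambda>(z, u). F z u)"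
  by (rule bounded_lipschitz_continuous_on[OF lipschitz])

lemma cut_field_continuous_on:
  assumes y: "continuous_on UNIV y" and R: "0 < R"
  shows "continuous_on UNIV (\<lambda>(t, u). F (y t) (radial_cut R u))"
proof -
  have "continuous_on UNIV (\<lambda>p. (y (fst p), radial_cut R (snd p :: 'a)))"
    by (intro continuous_on_Pair continuous_on_compose2[OF y]
        continuous_on_compose2[OF lipschitz_on_continuous_on[OF radial_cut_lipschitz[OF R]]]
        continuous_intros) auto
  from continuous_on_compose2[OF field_continuous_on this]
  show ?thesis by (simp add: case_prod_unfold)
qed

text \<open>
  The solution is a double limit of explicit Picard iterates of truncated fields, from which its
  measurability in time, initial value and parameters can be read off.
\<close>

lemma flow_approximation:
  assumes y: "continuous_on UNIV y"
  shows "well_posed (\<lambda>t. F (y t))"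
    and "\<And>x. \<exists>w. \<forall>t\<ge>0. (\<forall>n. (\<lambda>m. picard (\<lambda>s u. F (y s) (radial_cut (real (Suc n)) u)) x m t) \<longlonglongrightarrow> w n t) \<and>
      (\<lambda>n. w n t) \<longlonglongrightarrow> solution_map (\<lambda>t. F (y t)) t x"
proof -
  define R where "R = (\<lambda>n. real (Suc n))"
  have R: "0 < R n" for n by (simp add: R_def)
  define G where "G = (\<lambda>n (s :: real) u. F (y s) (radial_cut (R n) u))"
  have ybd: "\<exists>Z. \<forall>t\<in>{0..T}. \<bar>y t\<bar> \<le> Z" for T
  proof -
    have "bounded (y ` {0..T})"
      by (intro compact_imp_bounded compact_continuous_image continuous_on_subset[OF y]) auto
    then show ?thesis by (auto simp: bounded_iff)
  qed
  have Glip: "\<exists>L. \<forall>t\<in>{0..T}. L-lipschitz_on UNIV (G n t)" for n T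
  proof -
    obtain Z where Z: "\<And>t. t \<in> {0..T} \<Longrightarrow> \<bar>y t\<bar> \<le> Z" using ybd[of T] by blast
    have "bounded ({- Z..Z} \<times> cball (0 :: 'a) (R n))" by (intro bounded_Times) auto
    then obtain L where L: "L-lipschitz_on ({- Z..Z} \<times> cball 0 (R n)) (\<lambda>(z, u). F z u)"
      using bounded_lipschitzD[OF lipschitz] by blast
    have "(L * 2)-lipschitz_on UNIV (G n t)" if t: "t \<in> {0..T}" for t
    proof (rule lipschitz_onI)
      fix u v :: 'a
      have in_ball: "(y t, radial_cut (R n) w) \<in> {- Z..Z} \<times> cball 0 (R n)" for w :: 'a
        using Z[OF t] norm_radial_cut[OF R[of n], of w] by auto
      have "dist (G n t u) (G n t v) \<le> L * dist (radial_cut (R n) u) (radial_cut (R n) v)"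
        using lipschitz_onD[OF L in_ball[of u] in_ball[of v]] by (simp add: G_def dist_Pair_Pair)
      also have "\<dots> \<le> L * (2 * dist u v)"
        using lipschitz_onD[OF radial_cut_lipschitz[OF R[of n]], of u v] lipschitz_on_nonneg[OF L]
        by (intro mult_left_mono) auto
      finally show "dist (G n t u) (G n t v) \<le> L * 2 * dist u v" by simp
    qed (use lipschitz_on_nonneg[OF L] in simp)
    then show ?thesis by blast
  qed
  have Gcont: "continuous_on UNIV (\<lambda>(t, u). G n t u)" for n
    unfolding G_def by (rule cut_field_continuous_on[OF y R])
  define sol where "sol = (\<lambda>T x u. u 0 = x \<and> trajectory T y u)"
  have sol_solves: "sol T x u" if "solves (\<lambda>t. F (y t)) x u" for T x u
    using that solves_trajectory[OF that] by (simp add: sol_def solves_def)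
  have sol_unique: "u t = v t" if u: "sol T x u" and v: "sol T x v" and t: "t \<in> {0..T}" for T x u v t
  proof -
    have "bounded (w ` {0..T})" if "sol T x w" for w
      using that unfolding sol_def trajectory_def
      by (intro compact_imp_bounded compact_continuous_image)
        (auto simp: continuous_on_eq_continuous_within intro!: has_vector_derivative_continuous)
    from this[OF u] this[OF v] obtain r1 r2 where
      "\<forall>t\<in>{0..T}. norm (u t) \<le> r1" "\<forall>t\<in>{0..T}. norm (v t) \<le> r2"
      unfolding bounded_iff by blast
    then have r: "\<And>t. t \<in> {0..T} \<Longrightarrow> norm (u t) \<le> max r1 r2 \<and> norm (v t) \<le> max r1 r2"
      by (meson max.coboundedI1 max.coboundedI2)
    obtain Z where Z: "\<And>t. t \<in> {0..T} \<Longrightarrow> \<bar>y t\<bar> \<le> Z" using ybd[of T] by blast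
    obtain L where L: "\<And>y z u v d T t. trajectory T y u \<Longrightarrow> trajectory T z v \<Longrightarrow>
     (\<forall>t\<in>{0..T}. \<bar>y t\<bar> \<le> Z \<and> \<bar>z t\<bar> \<le> Z \<and> norm (u t) \<le> max r1 r2 \<and> norm (v t) \<le> max r1 r2 \<and> \<bar>y t - z t\<bar> \<le> d) \<Longrightarrow>
     t \<in> {0..T} \<Longrightarrow> (norm (u t - v t))\<^sup>2 \<le> ((norm (u 0 - v 0))\<^sup>2 + d\<^sup>2) * exp (L * t)"
      using stability_on_bounded[of Z "max r1 r2"] by blast
    have "(norm (u t - v t))\<^sup>2 \<le> ((norm (u 0 - v 0))\<^sup>2 + 0\<^sup>2) * exp (L * t)"
      by (rule L[OF _ _ _ t]) (use u v r Z in \<open>auto simp: sol_def\<close>)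
    also have "\<dots> = 0" using u v by (simp add: sol_def)
    finally have "(norm (u t - v t))\<^sup>2 \<le> 0" .
    then show "u t = v t" by simp
  qed
  define w where
    "w x n = (SOME w. solves (G n) x w \<and> (\<forall>t\<ge>0. (\<lambda>m. picard (G n) x m t) \<longlonglongrightarrow> w t))" for x n
  have "solves (G n) x (w x n) \<and> (\<forall>t\<ge>0. (\<lambda>m. picard (G n) x m t) \<longlonglongrightarrow> w x n t)" for n x
    unfolding w_def by (rule someI_ex[OF picard_solves[OF Gcont Glip]])
  then have w: "\<And>x n. solves (G n) x (w x n)"
      "\<And>x n t. 0 \<le> t \<Longrightarrow> (\<lambda>m. picard (G n) x m t) \<longlonglongrightarrow> w x n t"
    by auto
  \<comment> \<open>The bound from \<open>cut_bound\<close> is common to all truncations; once the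
    radius exceeds it the truncation is inactive, and the truncated solution solves the original
    equation up to \<open>T\<close>.\<close>
  have ev: "\<exists>N. \<forall>n\<ge>N. sol T x (w x n)" for T x
  proof -
    obtain Z where Z: "\<And>t. t \<in> {0..T} \<Longrightarrow> \<bar>y t\<bar> \<le> Z" using ybd[of T] by blast
    obtain C where C: "0 \<le> C" "\<And>z u. \<bar>z\<bar> \<le> Z \<Longrightarrow> inner (F z u) u \<le> C * ((norm u)\<^sup>2 + norm u)"
      using growth by blast
    obtain N where N: "(1 + (norm x)\<^sup>2) * exp (4 * C * T) \<le> real N" using real_arch_simple by blast
    have "sol T x (w x n)" if "n \<ge> N" for n
    proof -
      have d: "(w x n has_vector_derivative F (y t) (radial_cut (R n) (w x n t))) (at t within {0..T})"
        if "t \<in> {0..T}" for t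
        using w(1)[of n x] that unfolding solves_def G_def
        by (intro has_vector_derivative_within_subset[of "w x n" _ t "{0..}" "{0..T}"]) auto
      have w0: "w x n 0 = x" using w(1)[of n x] by (simp add: solves_def)
      have "radial_cut (R n) (w x n t) = w x n t" if t: "t \<in> {0..T}" for t
      proof (rule radial_cut_id[OF R])
        have "1 + (norm (w x n t))\<^sup>2 \<le> (1 + (norm (w x n 0))\<^sup>2) * exp (4 * C * T)"
          by (rule cut_bound[OF C Z _ _ t, where c = "\<lambda>t. R n / max (R n) (norm (w x n t))"])
            (use R[of n] d in \<open>auto simp: radial_cut_def\<close>)
        also have "\<dots> \<le> R n" using N \<open>n \<ge> N\<close> by (simp add: w0 R_def)
        finally have "(norm (w x n t))\<^sup>2 \<le> R n" by simp
        \<comment> \<open>\<open>R n\<close> is at least 1, which turns the bound on the squared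
          norm into one on the norm.\<close>
        also have "\<dots> \<le> (R n)\<^sup>2" by (simp add: R_def power2_eq_square)
        finally show "norm (w x n t) \<le> R n" using R[of n] by (simp add: power2_le_iff_abs_le)
      qed
      then show ?thesis using d w0 by (simp add: sol_def trajectory_def)
    qed
    then show ?thesis by blast
  qed
  \<comment> \<open>By uniqueness the sequence is eventually constant on each bounded interval, so
    its limit inherits the equation directly.\<close>
  define u where "u = (\<lambda>x t. lim (\<lambda>n. w x n t))"
  have u_eq: "\<exists>N. \<forall>n\<ge>N. sol T x (w x n) \<and> (\<forall>t\<in>{0..T}. u x t = w x n t)" for T x
  proof -
    obtain N where N: "\<And>n. n \<ge> N \<Longrightarrow> sol T x (w x n)" using ev by blast
    have "u x t = w x n t" if n: "n \<ge> N" and t: "t \<in> {0..T}" for n t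
    proof -
      have "\<forall>\<^sub>F m in sequentially. w x m t = w x n t"
        using eventually_ge_at_top[of N] by eventually_elim (use sol_unique[OF N N t] n in blast)
      then have "(\<lambda>m. w x m t) \<longlonglongrightarrow> w x n t" by (rule tendsto_eventually)
      then show ?thesis unfolding u_def by (rule limI)
    qed
    then show ?thesis using N by blast
  qed
  have u_solves: "solves (\<lambda>t. F (y t)) x (u x)" for x
    unfolding solves_def
  proof (intro conjI allI impI)
    fix t :: real assume t: "0 \<le> t"
    obtain n where n: "sol (t + 1) x (w x n)" "\<And>s. s \<in> {0..t + 1} \<Longrightarrow> u x s = w x n s"
      using u_eq[of "t + 1" x] by blast
    have "(w x n has_vector_derivative F (y t) (w x n t)) (at t within {0..t + 1})"
      using n(1) t unfolding sol_def trajectory_def by auto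
    then have "(u x has_vector_derivative F (y t) (u x t)) (at t within {0..t + 1})"
      using n(2)[of t] t by (auto intro: has_vector_derivative_transform[rotated 2] simp: n(2))
    moreover have "at t within {0..t + 1} = at t within {0..}"
      by (rule at_within_nhd[of _ "{..<t + 1}"]) auto
    ultimately show "(u x has_vector_derivative F (y t) (u x t)) (at t within {0..})" by simp
  next
    obtain n where n: "sol 0 x (w x n)" "u x 0 = w x n 0" using u_eq[of 0 x] by auto
    then show "u x 0 = x" by (simp add: sol_def)
  qed
  show wp: "well_posed (\<lambda>t. F (y t))"
    unfolding well_posed_def
  proof (intro allI conjI impI)
    show "\<exists>u. solves (\<lambda>t. F (y t)) x u" for x using u_solves by blast
    show "v t = v' t" if "solves (\<lambda>t. F (y t)) x v" "solves (\<lambda>t. F (y t)) x v'" "0 \<le> t" for x v v' t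
      using sol_unique[OF sol_solves[OF that(1), of t] sol_solves[OF that(2)]] that(3) by simp
  qed
  fix x
  have "(\<lambda>n. w x n t) \<longlonglongrightarrow> u x t" if t: "0 \<le> t" for t
  proof -
    obtain N where "\<forall>n\<ge>N. sol t x (w x n) \<and> (\<forall>s\<in>{0..t}. u x s = w x n s)"
      using u_eq[of t x] ..
    then have N: "u x t = w x n t" if "n \<ge> N" for n using that t by simp
    have "\<forall>\<^sub>F n in sequentially. w x n t = u x t"
      using eventually_ge_at_top[of N] by eventually_elim (simp add: N)
    then show ?thesis by (rule tendsto_eventually)
  qed
  then show "\<exists>w. \<forall>t\<ge>0. (\<forall>n. (\<lambda>m. picard (\<lambda>s u. F (y s) (radial_cut (real (Suc n)) u)) x m t) \<longlonglongrightarrow> w n t) \<and>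
      (\<lambda>n. w n t) \<longlonglongrightarrow> solution_map (\<lambda>t. F (y t)) t x"
    using w(2)[of _ _ x] solution_map_eq[OF wp u_solves] unfolding G_def R_def
    by (intro exI[of _ "w x"]) simp
qed

end

section \<open>The lattice field\<close>

definition shift_seq :: "int \<Rightarrow> ell2 \<Rightarrow> ell2" where
  "shift_seq k u = Abs_ell2 (\<lambda>i. coord u (i + k))"

lemma coord_shift_seq [simp]: "coord (shift_seq k u) i = coord u (i + k)"
  unfolding shift_seq_def
  using sq_summable_shift[OF coord_sq_summable[of u UNIV], of k] by (subst Abs_ell2_inverse) auto

lemma norm_shift_seq: "norm (shift_seq k u) = norm u"
proof -
  have "(norm (shift_seq k u))\<^sup>2 = (norm u)\<^sup>2"
    using infsum_reindex_bij_betw[of "\<lambda>i. i + k" UNIV UNIV "\<lambda>i. (coord u i)\<^sup>2"] bij_plus_right[of k]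
    by (simp add: norm_sq_eq_infsum)
  then show ?thesis by simp
qed

lemma bounded_linear_shift_seq: "bounded_linear (shift_seq k)"
  by (rule bounded_linear_intro[of _ 1]) (auto intro!: ell2_eqI simp: norm_shift_seq)

lemma bounded_linear_Lap: "bounded_linear Lap"
proof -
  have "Lap = (\<lambda>u. 2 *\<^sub>R u - shift_seq (- 1) u - shift_seq 1 u)"
    by (rule ext, rule ell2_eqI) simp
  then show ?thesis
    by (rule ssubst) (intro bounded_linear_sub bounded_linear_scaleR_right bounded_linear_shift_seq)
qed

lemma bounded_linear_Dminus: "bounded_linear Dminus"
proof -
  have "Dminus = (\<lambda>u. shift_seq (- 1) u - u)"
    by (rule ext, rule ell2_eqI) simp
  then show ?thesis
    by (rule ssubst) (intro bounded_linear_sub bounded_linear_ident bounded_linear_shift_seq)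
qed

lemma random_field_bounded_lipschitz:
  "bounded_lipschitz (\<lambda>(z, u). random_field \<alpha> \<beta> \<gamma> \<nu> lam f 1 z u)"
  unfolding random_field_def case_prod_unfold
  by (intro bounded_lipschitz_intros
      bounded_lipschitz_compose[OF bounded_linear_bounded_lipschitz[OF bounded_linear_Lap]]
      bounded_lipschitz_compose[OF bounded_linear_bounded_lipschitz[OF bounded_linear_Dminus]])

text \<open>Only the product of intensity and noise enters the field, so everything can be proved
  for intensity 1 along the rescaled path.\<close>

lemma random_field_rescale:
  "random_field \<alpha> \<beta> \<gamma> \<nu> lam f \<epsilon> z = random_field \<alpha> \<beta> \<gamma> \<nu> lam f 1 (\<epsilon> * z)"
  by (simp add: random_field_def fun_eq_iff mult.assoc)

lemma deterministic_field_eq: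
  "deterministic_field \<alpha> \<beta> \<gamma> \<nu> lam f = random_field \<alpha> \<beta> \<gamma> \<nu> lam f 1 0"
  by (rule ext, rule ell2_eqI)
    (simp add: deterministic_field_def random_field_def algebra_simps)

locale lattice =
  fixes \<alpha> \<beta> \<gamma> \<nu> lam q :: real and f :: ell2
  assumes pos: "0 < \<alpha>" "0 < \<beta>" "0 < \<gamma>" "0 < \<nu>"
    and q: "1 < q" and rate: "0 < decay_rate \<alpha> \<beta> \<gamma> \<nu> lam q"
begin

definition \<delta> :: real where "\<delta> = decay_rate \<alpha> \<beta> \<gamma> \<nu> lam q"

abbreviation F :: "real \<Rightarrow> ell2 \<Rightarrow> ell2" where "F \<equiv> random_field \<alpha> \<beta> \<gamma> \<nu> lam f 1"

abbreviation E :: "nat \<Rightarrow> ell2 \<Rightarrow> real" where "E \<equiv> tail_energy q"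

lemma q_ge_1: "1 \<le> q" using q by simp

lemma delta_pos: "0 < \<delta>" using rate by (simp add: \<delta>_def)

text \<open>Of the damping \<open>2 * \<delta>\<close>, Young's inequality spends half on the
  forcing. The rate is the same for all \<open>k\<close> and the source is proportional to
  \<open>E k f\<close>, so one scalar equation governs all windows.\<close>

lemma tail_energy_dissipation:
  "2 * inner (F z u) (weight q k u) \<le> (- \<delta> + 2 * z) * E k u + exp (- 2 * z) * E k f / \<delta>"
proof -
  have "2 * inner (F z u) (weight q k u) \<le> 2 * (- \<delta> + z) * E k u + 2 * inner (exp (- z) *\<^sub>R f) (weight q k u)"
    using random_field_energy[OF pos q_ge_1, of lam f z u k] by (simp add: \<delta>_def algebra_simps)
  also have "\<dots> \<le> 2 * (- \<delta> + z) * E k u + (\<delta> * E k u + E k (exp (- z) *\<^sub>R f) / \<delta>)"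
    by (intro add_left_mono tail_energy_young q_ge_1 delta_pos)
  also have "E k (exp (- z) *\<^sub>R f) = exp (- 2 * z) * E k f"
    using exp_double[of "- z"] by (simp add: tail_energy_scaleR q_ge_1)
  finally show ?thesis by (simp add: algebra_simps)
qed

sublocale dissipative_field F
proof
  show "bounded_lipschitz (\<lambda>(z, u). F z u)" by (rule random_field_bounded_lipschitz)
  fix Z :: real
  show "\<exists>C\<ge>0. \<forall>z u. \<bar>z\<bar> \<le> Z \<longrightarrow> inner (F z u) u \<le> C * ((norm u)\<^sup>2 + norm u)"
  proof (intro exI[of _ "\<bar>Z\<bar> + exp Z * norm f"] conjI allI impI)
    fix z u assume z: "\<bar>z\<bar> \<le> Z"
    have "inner (F z u) u \<le> (- \<delta> + z) * (norm u)\<^sup>2 + exp (- z) * inner f u"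
      using random_field_energy[OF pos q_ge_1, of lam f z u 0] by (simp add: \<delta>_def q_ge_1)
    also have "\<dots> \<le> \<bar>Z\<bar> * (norm u)\<^sup>2 + exp Z * (norm f * norm u)"
      using z delta_pos norm_cauchy_schwarz[of f u]
      by (intro add_mono mult_right_mono order_trans[OF mult_left_mono mult_right_mono]) auto
    also have "\<dots> \<le> (\<bar>Z\<bar> + exp Z * norm f) * ((norm u)\<^sup>2 + norm u)"
      by (simp add: algebra_simps)
    finally show "inner (F z u) u \<le> (\<bar>Z\<bar> + exp Z * norm f) * ((norm u)\<^sup>2 + norm u)" .
  qed simp
qed

abbreviation flow :: "(real \<Rightarrow> real) \<Rightarrow> real \<Rightarrow> ell2 \<Rightarrow> ell2" where
  "flow y \<equiv> solution_map (\<lambda>t. F (y t))"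

lemma random_flow_eq:
  "random_flow \<alpha> \<beta> \<gamma> \<nu> lam f \<epsilon> t \<omega> = flow (\<lambda>t. \<epsilon> * ou (shift t \<omega>)) t"
  by (simp add: random_flow_def random_rhs_def random_field_rescale[of _ _ _ _ _ _ \<epsilon>])

lemma deterministic_flow_eq: "deterministic_flow \<alpha> \<beta> \<gamma> \<nu> lam f = flow (\<lambda>t. 0)"
  by (simp add: deterministic_flow_def deterministic_rhs_def deterministic_field_eq)

section \<open>Joint measurability of the flow\<close>

lemma field_measurable [measurable]:
  "(\<lambda>(z, u). F z u) \<in> borel_measurable (borel \<Otimes>\<^sub>M borel)"
  unfolding borel_prod by (rule borel_measurable_continuous_onI[OF field_continuous_on])

lemma radial_cut_measurable [measurable]:
  "0 < R \<Longrightarrow> (radial_cut R :: ell2 \<Rightarrow> ell2) \<in> borel_measurable borel"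
  by (intro borel_measurable_continuous_onI lipschitz_on_continuous_on[OF radial_cut_lipschitz])

lemma coord_measurable [measurable]: "(\<lambda>u. coord u i) \<in> borel_measurable borel"
  by (intro borel_measurable_continuous_onI linear_continuous_on bounded_linear_coord)

lemma picard_measurable:
  fixes y :: "'p \<Rightarrow> real \<Rightarrow> real"
  assumes y: "(\<lambda>(t, p). y p t) \<in> borel_measurable (borel \<Otimes>\<^sub>M N)"
    and yc: "\<And>p. p \<in> space N \<Longrightarrow> continuous_on UNIV (y p)" and R: "0 < R"
  shows "(\<lambda>(t, p, x). picard (\<lambda>s u. F (y p s) (radial_cut R u)) x m t)
    \<in> borel_measurable (borel \<Otimes>\<^sub>M (N \<Otimes>\<^sub>M borel))"
proof (induction m)
  case (Suc m)
  define P where "P = (\<lambda>w. picard (\<lambda>s u. F (y (fst (snd w)) s) (radial_cut R u)) (snd (snd w)) m (fst w))"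
  define g where "g = (\<lambda>s p x. F (y p s) (radial_cut R (P (s, p, x))))"
  have P: "P \<in> borel_measurable (borel \<Otimes>\<^sub>M (N \<Otimes>\<^sub>M borel))"
    using Suc by (simp add: P_def case_prod_unfold)
  have "(\<lambda>w. (fst w, fst (snd w))) \<in> borel \<Otimes>\<^sub>M (N \<Otimes>\<^sub>M (borel :: ell2 measure)) \<rightarrow>\<^sub>M borel \<Otimes>\<^sub>M N"
    by measurable
  from measurable_compose[OF this y]
  have "(\<lambda>w. y (fst (snd w)) (fst w)) \<in> borel_measurable (borel \<Otimes>\<^sub>M (N \<Otimes>\<^sub>M (borel :: ell2 measure)))"
    by simp
  then have "(\<lambda>w. (y (fst (snd w)) (fst w), radial_cut R (P w)))
      \<in> borel \<Otimes>\<^sub>M (N \<Otimes>\<^sub>M borel) \<rightarrow>\<^sub>M borel \<Otimes>\<^sub>M borel"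
    by (intro measurable_Pair measurable_compose[OF P radial_cut_measurable[OF R]])
  from measurable_compose[OF this field_measurable]
  have g [measurable]: "(\<lambda>w. g (fst w) (fst (snd w)) (snd (snd w))) \<in> borel_measurable (borel \<Otimes>\<^sub>M (N \<Otimes>\<^sub>M borel))"
    by (simp add: g_def)
  show ?case
  proof (rule borel_measurable_ell2I)
    fix i
    \<comment> \<open>Passing to a coordinate gives a real Lebesgue integral, and the upper limit
      \<open>t\<close> moves into the integrand, so measurability of parameter integrals
      applies.\<close>
    have eq: "coord (picard (\<lambda>s u. F (y p s) (radial_cut R u)) x (Suc m) t) i
        = coord x i + (LINT s|lborel. (if 0 \<le> s \<and> s \<le> t then coord (g s p x) i else 0))"
      if p: "p \<in> space N" for t p x
    proof -
      have gc: "continuous_on {0..t} (\<lambda>s. g s p x)"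
        unfolding g_def P_def fst_conv snd_conv
        by (rule picard_continuous_on(2)[OF cut_field_continuous_on[OF yc[OF p] R]])
      then have cc: "continuous_on {0..t} (\<lambda>s. coord (g s p x) i)"
        by (rule bounded_linear.continuous_on[OF bounded_linear_coord])
      have "coord (integral {0..t} (\<lambda>s. g s p x)) i = integral {0..t} (\<lambda>s. coord (g s p x) i)"
        using integral_linear[OF integrable_continuous_real[OF gc] bounded_linear_coord] by (simp add: o_def)
      also have "\<dots> = (LINT s:{0..t}|lborel. coord (g s p x) i)"
        by (rule set_borel_integral_eq_integral(2)[symmetric, OF borel_integrable_atLeastAtMost'[OF cc]])
      also have "\<dots> = (LINT s|lborel. (if 0 \<le> s \<and> s \<le> t then coord (g s p x) i else 0))"
        unfolding set_lebesgue_integral_def by (intro Bochner_Integration.integral_cong) auto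
      finally show ?thesis by (simp add: g_def P_def)
    qed
    have "(\<lambda>v. (snd v, snd (fst v))) \<in> (borel \<Otimes>\<^sub>M (N \<Otimes>\<^sub>M (borel :: ell2 measure))) \<Otimes>\<^sub>M lborel
        \<rightarrow>\<^sub>M borel \<Otimes>\<^sub>M (N \<Otimes>\<^sub>M borel)"
      by measurable
    from measurable_compose[OF measurable_compose[OF this g] coord_measurable[of i]]
    have [measurable]: "(\<lambda>v. coord (g (snd v) (fst (snd (fst v))) (snd (snd (fst v)))) i)
        \<in> borel_measurable ((borel \<Otimes>\<^sub>M (N \<Otimes>\<^sub>M borel)) \<Otimes>\<^sub>M lborel)"
      by simp
    have "(\<lambda>w. LINT s|lborel. (if 0 \<le> s \<and> s \<le> fst w then coord (g s (fst (snd w)) (snd (snd w))) i else 0))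
        \<in> borel_measurable (borel \<Otimes>\<^sub>M (N \<Otimes>\<^sub>M borel))"
      by (rule lborel.borel_measurable_lebesgue_integral) (simp add: case_prod_unfold)
    moreover have "(\<lambda>w. coord (snd (snd w)) i) \<in> borel_measurable (borel \<Otimes>\<^sub>M (N \<Otimes>\<^sub>M borel))"
      by (rule measurable_compose[OF _ coord_measurable]) measurable
    ultimately have "(\<lambda>w. coord (snd (snd w)) i + (LINT s|lborel. (if 0 \<le> s \<and> s \<le> fst w
          then coord (g s (fst (snd w)) (snd (snd w))) i else 0)))
        \<in> borel_measurable (borel \<Otimes>\<^sub>M (N \<Otimes>\<^sub>M borel))"
      by (intro borel_measurable_add)
    then show "(\<lambda>w. coord (case w of (t, p, x) \<Rightarrow> picard (\<lambda>s u. F (y p s) (radial_cut R u)) x (Suc m) t) i)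
        \<in> borel_measurable (borel \<Otimes>\<^sub>M (N \<Otimes>\<^sub>M borel))"
      by (rule measurable_cong[THEN iffD1, rotated])
        (auto simp: space_pair_measure eq simp del: picard.simps cong: if_cong)
  qed
qed simp

lemma flow_measurable:
  fixes y :: "'p \<Rightarrow> real \<Rightarrow> real"
  assumes y: "(\<lambda>(t, p). y p t) \<in> borel_measurable (borel \<Otimes>\<^sub>M N)"
    and yc: "\<And>p. p \<in> space N \<Longrightarrow> continuous_on UNIV (y p)"
  shows "(\<lambda>(t, p, x). flow (y p) t x)
    \<in> borel_measurable (restrict_space borel {0..} \<Otimes>\<^sub>M (N \<Otimes>\<^sub>M borel))"
proof -
  let ?M = "restrict_space borel {0..} \<Otimes>\<^sub>M (N \<Otimes>\<^sub>M (borel :: ell2 measure))"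
  define R where "R = (\<lambda>n. real (Suc n))"
  have R: "0 < R n" for n by (simp add: R_def)
  define p where "p = (\<lambda>n m (t, p, x). picard (\<lambda>s u. F (y p s) (radial_cut (R n) u)) x m t)"
  have pm: "p n m \<in> borel_measurable ?M" for n m
  proof -
    have "(\<lambda>w. (fst w, snd w)) \<in> ?M \<rightarrow>\<^sub>M borel \<Otimes>\<^sub>M (N \<Otimes>\<^sub>M borel)"
      by (intro measurable_Pair measurable_compose[OF measurable_fst] measurable_restrict_space1) auto
    from measurable_compose[OF this picard_measurable[OF y yc R, of n m]]
    show ?thesis by (simp add: p_def case_prod_unfold)
  qed
  \<comment> \<open>\<open>flow_approximation\<close> yields the intermediate limits separately for
    each path and initial value; \<open>lim\<close> selects them as one function of all
    arguments.\<close>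
  define w where "w = (\<lambda>n x. lim (\<lambda>m. p n m x))"
  have lim: "(\<lambda>m. p n m x) \<longlonglongrightarrow> w n x \<and> (\<lambda>n. w n x) \<longlonglongrightarrow> (\<lambda>(t, p, x). flow (y p) t x) x"
    if x: "x \<in> space ?M" for n x
  proof -
    obtain t a v where tav: "x = (t, a, v)" by (cases x) auto
    have t: "0 \<le> t" and a: "a \<in> space N" using x by (auto simp: tav space_pair_measure)
    obtain h where h: "\<And>n. (\<lambda>m. p n m x) \<longlonglongrightarrow> h n t" "(\<lambda>n. h n t) \<longlonglongrightarrow> flow (y a) t v"
      using flow_approximation(2)[OF yc[OF a], of v] t unfolding p_def tav R_def by auto
    have "w n x = h n t" for n unfolding w_def by (rule limI[OF h(1)])
    then show ?thesis using h by (simp add: tav)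
  qed
  have "w n \<in> borel_measurable ?M" for n
    by (rule borel_measurable_LIMSEQ_metric[where f = "p n"]) (use pm lim in blast)+
  then show ?thesis
    by (rule borel_measurable_LIMSEQ_metric[where f = w]) (use lim in blast)
qed

end

section \<open>Paths of sublinear growth and the absorbing radius\<close>

text \<open>The orientation matters: for \<open>t < 0\<close> this is minus the integral over
  \<open>{t..0}\<close>, the convention of the averages in \<open>admissible_paths\<close>.\<close>

definition primitive :: "(real \<Rightarrow> real) \<Rightarrow> real \<Rightarrow> real" where
  "primitive y t = (LBINT s=ereal 0..ereal t. y s)"

lemma primitive_0 [simp]: "primitive y 0 = 0"
  by (simp add: primitive_def zero_ereal_def[symmetric])

lemma primitive_has_derivative:
  assumes "continuous_on UNIV y"
  shows "(primitive y has_real_derivative y t) (at t within A)"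
proof -
  define b where "b = \<bar>t\<bar> + 1"
  have "((\<lambda>u. LBINT s=ereal 0..ereal u. y s) has_vector_derivative y t) (at t within {- b..b})"
    by (rule interval_integral_FTC2) (auto simp: b_def intro: continuous_on_subset[OF assms])
  then have "(primitive y has_real_derivative y t) (at t within {- b..b})"
    unfolding primitive_def[abs_def] by (simp add: has_real_derivative_iff_has_vector_derivative)
  moreover have "at t within {- b..b} = at t"
    by (rule at_within_Icc_at) (auto simp: b_def)
  ultimately have "(primitive y has_real_derivative y t) (at t)" by simp
  then show ?thesis by (rule has_field_derivative_at_within)
qed

lemma continuous_on_primitive:
  assumes "continuous_on UNIV y"
  shows "continuous_on A (primitive y)"
  by (intro continuous_at_imp_continuous_on ballI DERIV_isCont[OF primitive_has_derivative[OF assms]])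

lemma primitive_shift:
  assumes "continuous_on UNIV y"
  shows "primitive (\<lambda>s. y (t + s)) s = primitive y (t + s) - primitive y t"
proof -
  have yc: "continuous_on UNIV (\<lambda>s. y (t + s))"
    by (intro continuous_on_compose2[OF assms] continuous_intros) auto
  have "((\<lambda>s. primitive y (t + s)) has_real_derivative y (t + s)) (at s)" for s
    using primitive_has_derivative[OF assms, of "s + t" UNIV]
      DERIV_shift[of "primitive y" "y (s + t)" s t] by (simp add: add.commute)
  from DERIV_diff[OF primitive_has_derivative[OF yc] this]
  have "\<forall>s. ((\<lambda>s. primitive (\<lambda>s. y (t + s)) s - primitive y (t + s)) has_real_derivative 0) (at s)"
    by simp
  from DERIV_isconst_all[OF this, of s 0] show ?thesis by simp
qed

lemma primitive_cmult: "primitive (\<lambda>s. c * y s) t = c * primitive y t"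
  by (simp add: primitive_def)

lemma exp_decay_integrable:
  fixes g :: "real \<Rightarrow> real"
  assumes g: "continuous_on UNIV g" and a: "0 < a" and le: "\<And>s. 0 \<le> s \<Longrightarrow> g s \<le> b - a * s"
  shows "set_integrable lborel {0..} (\<lambda>s. exp (g s))"
    and "(LINT s:{0..}|lborel. exp (g s)) \<le> exp b / a"
proof -
  have gm [measurable]: "g \<in> borel_measurable borel" by (rule borel_measurable_continuous_onI[OF g])
  have lim: "((\<lambda>s. - exp (b - a * s) / a) \<longlongrightarrow> 0) at_top"
  proof -
    have "filterlim (\<lambda>s. - (a * s)) at_bot at_top"
      using filterlim_tendsto_pos_mult_at_top[OF tendsto_const a filterlim_ident]
      by (simp add: filterlim_uminus_at_top)
    then have "((\<lambda>s. exp b * exp (- (a * s))) \<longlongrightarrow> exp b * 0) at_top"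
      by (intro tendsto_intros filterlim_compose[OF exp_at_bot])
    then have "((\<lambda>s. exp (b - a * s)) \<longlongrightarrow> 0) at_top"
      by (simp add: exp_add[symmetric])
    then show ?thesis using tendsto_divide[of _ 0 _ "\<lambda>_. - a" "- a"] a by simp
  qed
  have "(\<integral>\<^sup>+s. ennreal (exp (b - a * s)) * indicator {0..} s \<partial>lborel) = 0 - (- exp (b - a * 0) / a)"
    by (rule nn_integral_FTC_atLeast[OF _ _ _ lim]) (use a in \<open>auto intro!: derivative_eq_intros\<close>)
  then have nn: "(\<integral>\<^sup>+s. ennreal (indicator {0..} s * exp (b - a * s)) \<partial>lborel) = exp b / a"
    by (simp add: mult.commute ennreal_mult' indicator_mult_ennreal)
  have h: "has_bochner_integral lborel (\<lambda>s. indicator {0..} s * exp (b - a * s)) (exp b / a)"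
    by (rule has_bochner_integral_nn_integral) (use a nn in auto)
  then have hi: "set_integrable lborel {0..} (\<lambda>s. exp (b - a * s))"
    by (simp add: set_integrable_def has_bochner_integral_iff)
  show gi: "set_integrable lborel {0..} (\<lambda>s. exp (g s))"
  proof (rule set_integrable_bound[OF hi])
    show "set_borel_measurable lborel {0..} (\<lambda>s. exp (g s))"
      unfolding set_borel_measurable_def by simp
  qed (use le in auto)
  have "(LINT s:{0..}|lborel. exp (g s)) \<le> (LINT s:{0..}|lborel. exp (b - a * s))"
    by (rule set_integral_mono[OF gi hi]) (use le in auto)
  also have "\<dots> = exp b / a"
    using h by (simp add: set_lebesgue_integral_def has_bochner_integral_iff)
  finally show "(LINT s:{0..}|lborel. exp (g s)) \<le> exp b / a" .
qed

text \<open>The bounds concern the past, because the radius is a pullback integral and temperedness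
  looks backwards. The additive constant turns limits at minus infinity into bounds for all
  \<open>t \<le> 0\<close>.\<close>

definition sublinear_path :: "(real \<Rightarrow> real) \<Rightarrow> bool" where
  "sublinear_path y \<longleftrightarrow> continuous_on UNIV y \<and>
     (\<forall>c>0. \<exists>C. \<forall>t\<le>0. \<bar>y t\<bar> \<le> C + c * \<bar>t\<bar> \<and> \<bar>primitive y t\<bar> \<le> C + c * \<bar>t\<bar>)"

lemma sublinear_pathD:
  assumes "sublinear_path y"
  shows "continuous_on UNIV y"
    and "0 < c \<Longrightarrow> \<exists>C. \<forall>t\<le>0. \<bar>y t\<bar> \<le> C + c * \<bar>t\<bar> \<and> \<bar>primitive y t\<bar> \<le> C + c * \<bar>t\<bar>"
  using assms by (auto simp: sublinear_path_def)

lemma sublinear_path_cmult: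
  assumes "sublinear_path y"
  shows "sublinear_path (\<lambda>s. e * y s)"
  unfolding sublinear_path_def
proof (intro conjI allI impI)
  show "continuous_on UNIV (\<lambda>s. e * y s)"
    by (intro continuous_intros sublinear_pathD(1)[OF assms])
  fix c :: real assume c: "0 < c"
  define d where "d = c / (\<bar>e\<bar> + 1)"
  have d: "0 < d" "\<bar>e\<bar> * d \<le> c" using c by (auto simp: d_def field_simps)
  obtain C where C: "\<And>t. t \<le> 0 \<Longrightarrow> \<bar>y t\<bar> \<le> C + d * \<bar>t\<bar> \<and> \<bar>primitive y t\<bar> \<le> C + d * \<bar>t\<bar>"
    using sublinear_pathD(2)[OF assms d(1)] by blast
  have *: "\<bar>e * x\<bar> \<le> \<bar>e\<bar> * C + c * \<bar>t\<bar>" if "\<bar>x\<bar> \<le> C + d * \<bar>t\<bar>" for x t :: real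
  proof -
    have "\<bar>e * x\<bar> \<le> \<bar>e\<bar> * (C + d * \<bar>t\<bar>)" unfolding abs_mult using that by (intro mult_left_mono) auto
    also have "\<dots> = \<bar>e\<bar> * C + (\<bar>e\<bar> * d) * \<bar>t\<bar>" by (simp add: algebra_simps)
    also have "\<dots> \<le> \<bar>e\<bar> * C + c * \<bar>t\<bar>" using d by (intro add_left_mono mult_right_mono) auto
    finally show ?thesis .
  qed
  show "\<exists>C. \<forall>t\<le>0. \<bar>e * y t\<bar> \<le> C + c * \<bar>t\<bar> \<and> \<bar>primitive (\<lambda>s. e * y s) t\<bar> \<le> C + c * \<bar>t\<bar>"
    using C * unfolding primitive_cmult by blast
qed

lemma sublinear_path_zero: "sublinear_path (\<lambda>_. 0)"
  unfolding sublinear_path_def by (auto simp: primitive_def intro!: exI[of _ 0] simp: mult_nonneg_nonpos)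

section \<open>The absorbing radius and the energy comparison\<close>

context lattice
begin

text \<open>The radius solves \<open>r' = (- \<delta> + 2 y) r + exp (- 2 y) / \<delta>\<close> along the path; it is the
  pullback limit of the solutions of this equation.\<close>

definition radius :: "(real \<Rightarrow> real) \<Rightarrow> real" where
  "radius y = (LINT s:{0..}|lborel. exp (- \<delta> * s - 2 * primitive y (- s) - 2 * y (- s))) / \<delta>"

lemma radius_nonneg: "0 \<le> radius y"
  using delta_pos unfolding radius_def set_lebesgue_integral_def
  by (intro divide_nonneg_pos Bochner_Integration.integral_nonneg) auto

lemma radius_exponent_continuous:
  assumes "continuous_on UNIV y"
  shows "continuous_on UNIV (\<lambda>s. - \<delta> * s - 2 * primitive y (- s) - 2 * y (- s))"
  by (intro continuous_intros continuous_on_compose2[OF assms]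
      continuous_on_compose2[OF continuous_on_primitive[OF assms, of UNIV]]) auto

text \<open>Quantitative because it is used with different constants: \<open>C\<close> growing
  linearly in time for temperedness, and \<open>c = \<epsilon>\<close> for uniformity in small
  noise. The 4 counts a path and its primitive, each doubled.\<close>

lemma radius_le:
  assumes y: "continuous_on UNIV y" and c: "4 * c < \<delta>"
    and C: "\<And>s. 0 \<le> s \<Longrightarrow> - 2 * primitive y (- s) - 2 * y (- s) \<le> C + 4 * c * s"
  shows "set_integrable lborel {0..} (\<lambda>s. exp (- \<delta> * s - 2 * primitive y (- s) - 2 * y (- s)))"
    and "radius y \<le> exp C / (\<delta> - 4 * c) / \<delta>"
proof -
  have le: "- \<delta> * s - 2 * primitive y (- s) - 2 * y (- s) \<le> C - (\<delta> - 4 * c) * s" if "0 \<le> s" for s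
    using C[OF that] by (simp add: algebra_simps)
  show "set_integrable lborel {0..} (\<lambda>s. exp (- \<delta> * s - 2 * primitive y (- s) - 2 * y (- s)))"
    by (rule exp_decay_integrable(1)[OF radius_exponent_continuous[OF y] _ le]) (use c in auto)
  show "radius y \<le> exp C / (\<delta> - 4 * c) / \<delta>"
    unfolding radius_def using delta_pos c
    by (intro divide_right_mono exp_decay_integrable(2)[OF radius_exponent_continuous[OF y] _ le]) auto
qed

lemma radius_integrable:
  assumes "sublinear_path y"
  shows "set_integrable lborel {0..} (\<lambda>s. exp (- \<delta> * s - 2 * primitive y (- s) - 2 * y (- s)))"
proof -
  obtain C where C: "\<And>t. t \<le> 0 \<Longrightarrow> \<bar>y t\<bar> \<le> C + \<delta> / 8 * \<bar>t\<bar> \<and> \<bar>primitive y t\<bar> \<le> C + \<delta> / 8 * \<bar>t\<bar>"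
    using sublinear_pathD(2)[OF assms, of "\<delta> / 8"] delta_pos by auto
  show ?thesis
  proof (rule radius_le(1)[OF sublinear_pathD(1)[OF assms], of "\<delta> / 8" "4 * C"])
    show "- 2 * primitive y (- s) - 2 * y (- s) \<le> 4 * C + 4 * (\<delta> / 8) * s" if "0 \<le> s" for s
      using C[of "- s"] that by simp linarith
  qed (use delta_pos in auto)
qed

text \<open>The substitution \<open>r = t - s\<close> turns the moving integral into a fixed
  integrand over the past of \<open>t\<close>; splitting at 0 isolates the constant
  \<open>J\<close>, and the rest is a primitive that can be differentiated.\<close>

lemma radius_along_path:
  assumes y: "sublinear_path y"
  shows "\<exists>J. \<forall>t\<ge>0. radius (\<lambda>s. y (t + s))
    = exp (- \<delta> * t + 2 * primitive y t) * (J + primitive (\<lambda>r. exp (\<delta> * r - 2 * primitive y r - 2 * y r)) t) / \<delta>"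
proof -
  note yc = sublinear_pathD(1)[OF y]
  define G where "G = (\<lambda>r. exp (\<delta> * r - 2 * primitive y r - 2 * y r))"
  have Gc: "continuous_on UNIV G"
    unfolding G_def by (intro continuous_intros yc continuous_on_primitive)
  have reflect: "(LINT r:{..t}|lborel. G r) = (LINT s:{0..}|lborel. G (t - s))" for t
  proof -
    have "(LINT r:{..t}|lborel. G r)
        = \<bar>- 1\<bar> *\<^sub>R (LINT s|lborel. indicator {..t} (t + - 1 * s) *\<^sub>R G (t + - 1 * s))"
      unfolding set_lebesgue_integral_def by (rule lborel_integral_real_affine) simp
    also have "\<dots> = (LINT s:{0..}|lborel. G (t - s))"
      unfolding set_lebesgue_integral_def by (auto simp: indicator_def intro!: Bochner_Integration.integral_cong)
    finally show ?thesis .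
  qed
  have "set_integrable lborel {0..} (\<lambda>s. G (0 - s))"
    using radius_integrable[OF y] by (simp add: G_def)
  moreover have "(\<lambda>s. indicator {..0} (0 + - 1 * s) *\<^sub>R G (0 + - 1 * s)) = (\<lambda>s. indicator {0..} s *\<^sub>R G (0 - s))"
    by (auto simp: indicator_def)
  ultimately have "integrable lborel (\<lambda>s. indicator {..0} (0 + - 1 * s) *\<^sub>R G (0 + - 1 * s))"
    by (simp only: set_integrable_def)
  then have "set_integrable lborel {..0} G"
    unfolding set_integrable_def
    by (rule lborel_integrable_real_affine_iff[of "- 1" "\<lambda>r. indicator {..0} r *\<^sub>R G r" 0,
          THEN iffD1, rotated]) simp
  then have i0: "set_integrable lborel {..<0} G"
    by (rule set_integrable_subset) auto
  define J where "J = (LINT r:{..<0}|lborel. G r)"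
  have split: "(LINT r:{..t}|lborel. G r) = J + primitive G t" if t: "0 \<le> t" for t
  proof -
    have "{..t} = {..<0} \<union> {0..t}" using t by auto
    then have "(LINT r:{..t}|lborel. G r) = J + (LINT r:{0..t}|lborel. G r)"
      unfolding J_def using i0
      by (simp only:, intro set_integral_Un)
        (auto intro!: borel_integrable_atLeastAtMost' continuous_on_subset[OF Gc])
    then show ?thesis using interval_integral_Icc[OF t, of G] by (simp add: primitive_def)
  qed
  have "radius (\<lambda>s. y (t + s)) = exp (- \<delta> * t + 2 * primitive y t) * (J + primitive G t) / \<delta>"
    if t: "0 \<le> t" for t
  proof -
    have "exp (- \<delta> * s - 2 * primitive (\<lambda>s. y (t + s)) (- s) - 2 * y (t + - s))
        = exp (- \<delta> * t + 2 * primitive y t) * G (t - s)" for s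
      unfolding primitive_shift[OF yc] G_def exp_add[symmetric] by (simp add: algebra_simps)
    then have "radius (\<lambda>s. y (t + s)) = exp (- \<delta> * t + 2 * primitive y t) * (LINT s:{0..}|lborel. G (t - s)) / \<delta>"
      unfolding radius_def by simp
    then show ?thesis unfolding reflect[symmetric] split[OF t] .
  qed
  then show ?thesis unfolding G_def by blast
qed

lemma radius_has_derivative:
  assumes y: "sublinear_path y" and t: "t \<in> {0..T}"
  shows "((\<lambda>t. radius (\<lambda>s. y (t + s))) has_real_derivative
    (- \<delta> + 2 * y t) * radius (\<lambda>s. y (t + s)) + exp (- 2 * y t) / \<delta>) (at t within {0..T})"
proof -
  note yc = sublinear_pathD(1)[OF y]
  define G where "G = (\<lambda>r. exp (\<delta> * r - 2 * primitive y r - 2 * y r))"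
  have Gc: "continuous_on UNIV G"
    unfolding G_def by (intro continuous_intros yc continuous_on_primitive)
  obtain J where J: "\<And>t. 0 \<le> t \<Longrightarrow> radius (\<lambda>s. y (t + s))
      = exp (- \<delta> * t + 2 * primitive y t) * (J + primitive G t) / \<delta>"
    using radius_along_path[OF y] unfolding G_def by blast
  define X where "X = exp (- \<delta> * t + 2 * primitive y t)"
  have "((\<lambda>t. exp (- \<delta> * t + 2 * primitive y t) * (J + primitive G t) / \<delta>) has_real_derivative
      (X * (- \<delta> + 2 * y t) * (J + primitive G t) + X * G t) / \<delta>) (at t within {0..T})"
    unfolding X_def
    by (rule derivative_eq_intros primitive_has_derivative yc Gc refl | simp add: delta_pos[THEN less_imp_neq, symmetric])+
  moreover have "X * G t = exp (- 2 * y t)"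
    unfolding X_def G_def exp_add[symmetric] by simp
  moreover have "radius (\<lambda>s. y (t + s)) = X * (J + primitive G t) / \<delta>" using J t by (simp add: X_def)
  ultimately have "((\<lambda>t. exp (- \<delta> * t + 2 * primitive y t) * (J + primitive G t) / \<delta>) has_real_derivative
      (- \<delta> + 2 * y t) * radius (\<lambda>s. y (t + s)) + exp (- 2 * y t) / \<delta>) (at t within {0..T})"
    by (simp add: add_divide_distrib mult_ac)
  then show ?thesis
    unfolding has_real_derivative_iff_has_vector_derivative
    by (rule has_vector_derivative_transform[OF t, rotated]) (simp add: J)
qed

lemma flow_solves:
  assumes "continuous_on UNIV y"
  shows "solves (\<lambda>t. F (y t)) x (\<lambda>t. flow y t x)"
proof -
  have wp: "well_posed (\<lambda>t. F (y t))" by (rule flow_approximation(1)[OF assms])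
  then have "\<exists>u. solves (\<lambda>t. F (y t)) x u" by (simp add: well_posed_def)
  then obtain u where u: "solves (\<lambda>t. F (y t)) x u" ..
  have eq: "flow y t x = u t" if "0 \<le> t" for t by (rule solution_map_eq[OF wp u that])
  show ?thesis
    unfolding solves_def
  proof (intro conjI allI impI)
    show "flow y 0 x = x" using eq[of 0] u by (simp add: solves_def)
    fix t :: real assume t: "0 \<le> t"
    have "(u has_vector_derivative F (y t) (u t)) (at t within {0..})" using u t by (simp add: solves_def)
    then have "((\<lambda>t. flow y t x) has_vector_derivative F (y t) (u t)) (at t within {0..})"
      by (rule has_vector_derivative_transform[rotated 2]) (use t eq in auto)
    then show "((\<lambda>t. flow y t x) has_vector_derivative F (y t) (flow y t x)) (at t within {0..})"
      using eq t by simp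
  qed
qed

text \<open>The multiple \<open>E k f * radius\<close> solves the comparison equation exactly, so
  its difference to the energy obeys a homogeneous inequality. A nonpositive initial difference
  gives forward invariance, and the exponential factor gives attraction.\<close>

lemma flow_dissipation:
  assumes y: "sublinear_path y" and t: "0 \<le> t"
  shows "E k (flow y t x) \<le> E k f * radius (\<lambda>s. y (t + s))
    + exp (- \<delta> * t + 2 * primitive y t) * (E k x - E k f * radius y)"
proof -
  note yc = sublinear_pathD(1)[OF y]
  define u where "u = (\<lambda>t. flow y t x)"
  define g where "g = (\<lambda>t. E k (u t) - E k f * radius (\<lambda>s. y (t + s)))"
  define A where "A = (\<lambda>t. - \<delta> * t + 2 * primitive y t)"
  have u: "trajectory t y u" "u 0 = x"
    using solves_trajectory[OF flow_solves[OF yc]] flow_solves[OF yc, of x]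
    by (auto simp: u_def solves_def)
  have "g t \<le> exp (A t - A 0) * g 0"
  proof (rule gronwall_differential[OF t])
    fix r assume r: "r \<in> {0..t}"
    have "(u has_vector_derivative F (y r) (u r)) (at r within {0..t})"
      using u(1) r by (simp add: trajectory_def)
    from tail_energy_derivative[OF q_ge_1 this, of k] DERIV_cmult[OF radius_has_derivative[OF y r], of "E k f"]
    show "(g has_real_derivative 2 * inner (F (y r) (u r)) (weight q k (u r))
        - E k f * ((- \<delta> + 2 * y r) * radius (\<lambda>s. y (r + s)) + exp (- 2 * y r) / \<delta>)) (at r within {0..t})"
      unfolding g_def by (rule DERIV_diff)
    show "(A has_real_derivative - \<delta> + 2 * y r) (at r within {0..t})"
      unfolding A_def by (rule derivative_eq_intros primitive_has_derivative yc refl | simp)+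
    show "2 * inner (F (y r) (u r)) (weight q k (u r))
        - E k f * ((- \<delta> + 2 * y r) * radius (\<lambda>s. y (r + s)) + exp (- 2 * y r) / \<delta>)
        \<le> (- \<delta> + 2 * y r) * g r"
      using tail_energy_dissipation[of "y r" "u r" k] by (simp add: g_def algebra_simps)
  qed
  then show ?thesis by (simp add: g_def A_def u_def u(2)[unfolded u_def])
qed

end

section \<open>Compactness through uniformly small tails\<close>

lemma compact_finite_box:
  assumes "finite I"
  shows "compact {(\<Sum>j\<in>I. a j *\<^sub>R unit_vec j) |a. \<forall>j\<in>I. \<bar>a j\<bar> \<le> (B::real)}"
  using assms
proof (induction I)
  case empty
  then show ?case by simp
next
  case (insert i I)
  have "compact ((\<lambda>r. r *\<^sub>R unit_vec i) ` {- B..B})"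
    by (intro compact_continuous_image continuous_intros) auto
  from compact_sums[OF this insert.IH]
  have "compact {x + y |x y. x \<in> (\<lambda>r. r *\<^sub>R unit_vec i) ` {- B..B}
      \<and> y \<in> {(\<Sum>j\<in>I. a j *\<^sub>R unit_vec j) |a. \<forall>j\<in>I. \<bar>a j\<bar> \<le> B}}" .
  moreover have "{x + y |x y. x \<in> (\<lambda>r. r *\<^sub>R unit_vec i) ` {- B..B}
      \<and> y \<in> {(\<Sum>j\<in>I. a j *\<^sub>R unit_vec j) |a. \<forall>j\<in>I. \<bar>a j\<bar> \<le> B}}
    = {(\<Sum>j\<in>insert i I. a j *\<^sub>R unit_vec j) |a. \<forall>j\<in>insert i I. \<bar>a j\<bar> \<le> B}" (is "?L = ?R")
  proof
    show "?L \<subseteq> ?R"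
    proof
      fix z assume "z \<in> ?L"
      then obtain r a where ra: "z = r *\<^sub>R unit_vec i + (\<Sum>j\<in>I. a j *\<^sub>R unit_vec j)" "\<bar>r\<bar> \<le> B"
        "\<forall>j\<in>I. \<bar>a j\<bar> \<le> B" by (auto simp: abs_le_iff)
      have "(\<Sum>j\<in>I. (a(i := r)) j *\<^sub>R unit_vec j) = (\<Sum>j\<in>I. a j *\<^sub>R unit_vec j)"
        using insert.hyps by (intro sum.cong) auto
      then have "z = (\<Sum>j\<in>insert i I. (a(i := r)) j *\<^sub>R unit_vec j)"
        using insert.hyps ra(1) by simp
      moreover have "\<forall>j\<in>insert i I. \<bar>(a(i := r)) j\<bar> \<le> B" using ra by simp
      ultimately show "z \<in> ?R" by blast
    qed
    show "?R \<subseteq> ?L"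
    proof
      fix z assume "z \<in> ?R"
      then obtain a where a: "z = (\<Sum>j\<in>insert i I. a j *\<^sub>R unit_vec j)" "\<forall>j\<in>insert i I. \<bar>a j\<bar> \<le> B" by blast
      then have "z = a i *\<^sub>R unit_vec i + (\<Sum>j\<in>I. a j *\<^sub>R unit_vec j)" using insert.hyps by simp
      moreover have "a i *\<^sub>R unit_vec i \<in> (\<lambda>r. r *\<^sub>R unit_vec i) ` {- B..B}"
        using a(2) by (auto simp: abs_le_iff)
      moreover have "\<forall>j\<in>I. \<bar>a j\<bar> \<le> B" using a(2) by simp
      ultimately show "z \<in> ?L" by blast
    qed
  qed
  ultimately show ?case by simp
qed

text \<open>Small tails put \<open>S\<close> within \<open>e / 4\<close> of a compact
  finite-dimensional box, hence total boundedness. The closure admits sets such as the range of a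
  sequence.\<close>

lemma compact_closure_of_uniform_tails:
  assumes q: "1 \<le> q" and B: "\<And>u. u \<in> S \<Longrightarrow> norm u \<le> B"
    and tails: "\<And>e. 0 < e \<Longrightarrow> \<exists>k. \<forall>u\<in>S. tail_energy q k u \<le> e"
  shows "compact (closure S)"
proof -
  have "\<exists>D. finite D \<and> closure S \<subseteq> (\<Union>x\<in>D. ball x e)" if e: "0 < e" for e
  proof -
    obtain k where k: "\<And>u. u \<in> S \<Longrightarrow> tail_energy q k u \<le> (e / 4)\<^sup>2" using tails[of "(e / 4)\<^sup>2"] e by auto
    define I where "I = {- int k<..<int k}"
    define C where "C = {(\<Sum>j\<in>I. a j *\<^sub>R unit_vec j) |a. \<forall>j\<in>I. \<bar>a j\<bar> \<le> B}"
    have "compact C" unfolding C_def by (rule compact_finite_box) (simp add: I_def)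
    then obtain D where D: "finite D" "C \<subseteq> (\<Union>x\<in>D. ball x (e / 4))"
      unfolding compact_eq_totally_bounded using e by (metis zero_less_divide_iff zero_less_numeral)
    have "closure S \<subseteq> (\<Union>x\<in>D. ball x e)"
    proof
      fix v assume "v \<in> closure S"
      then obtain u where u: "u \<in> S" "dist u v < e / 4"
        using e unfolding closure_approachable by (meson divide_pos_pos zero_less_numeral)
      define p where "p = (\<Sum>j\<in>I. coord u j *\<^sub>R unit_vec j)"
      have "(norm (u - p))\<^sup>2 \<le> (e / 4)\<^sup>2"
        using sum_outside_le_tail_energy[OF q, of u k] k[OF u(1)] by (simp add: p_def I_def)
      then have up: "dist u p \<le> e / 4" using e by (simp add: dist_norm power2_le_iff_abs_le)
      have "p \<in> C" unfolding C_def p_def using abs_coord_le_norm[of u] B[OF u(1)] by (blast intro: order_trans)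
      then obtain x where x: "x \<in> D" "dist x p < e / 4" using D(2) by auto
      have "dist x v \<le> dist x p + dist p u + dist u v"
        by (meson add_right_mono dist_triangle order_trans)
      then have "dist x v < e" using x(2) up u(2) e by (simp add: dist_commute)
      then show "v \<in> (\<Union>x\<in>D. ball x e)" using x(1) by auto
    qed
    then show ?thesis using D(1) by blast
  qed
  then show ?thesis by (simp add: compact_eq_totally_bounded complete_eq_closed)
qed

section \<open>The compact sets cut out by multiples of the forcing energies\<close>

context lattice
begin

text \<open>The case \<open>k = 0\<close> bounds the norm, and large \<open>k\<close> makes the
  tails uniformly small. The noise will enter only through the number \<rho>.\<close>

definition kset :: "real \<Rightarrow> ell2 set" where
  "kset \<rho> = {u. \<forall>k. E k u \<le> \<rho> * E k f}"

lemma zero_in_kset: "0 \<le> \<rho> \<Longrightarrow> 0 \<in> kset \<rho>"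
  using tail_energy_nonneg[OF q_ge_1] tail_energy_scaleR[OF q_ge_1, of _ 0 0] by (simp add: kset_def)

lemma kset_norm: "u \<in> kset \<rho> \<Longrightarrow> (norm u)\<^sup>2 \<le> \<rho> * (norm f)\<^sup>2"
  unfolding kset_def using tail_energy_0[OF q_ge_1] by (metis (mono_tags) mem_Collect_eq)

lemma closed_kset: "closed (kset \<rho>)"
  unfolding kset_def
  by (intro closed_Collect_all closed_Collect_le continuous_on_tail_energy q_ge_1 continuous_on_const)

lemma eventually_scaled_tail_less:
  assumes "0 < e" "0 \<le> \<rho>"
  shows "\<exists>k. \<rho> * E k f < e"
proof -
  have "0 < e / (\<rho> + 1)" using assms by simp
  then obtain k where "E k f < e / (\<rho> + 1)"
    using eventually_tail_energy_less[OF q, of "e / (\<rho> + 1)" f] eventually_happens by force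
  then have "(\<rho> + 1) * E k f < e" using assms by (simp add: field_simps)
  moreover have "\<rho> * E k f \<le> (\<rho> + 1) * E k f"
    using tail_energy_nonneg[OF q_ge_1, of k f] by (intro mult_right_mono) auto
  ultimately show ?thesis by (meson le_less_trans)
qed

lemma compact_kset:
  assumes \<rho>: "0 \<le> \<rho>"
  shows "compact (kset \<rho>)"
proof -
  have "compact (closure (kset \<rho>))"
  proof (rule compact_closure_of_uniform_tails[OF q_ge_1])
    show "norm u \<le> sqrt (\<rho> * (norm f)\<^sup>2)" if "u \<in> kset \<rho>" for u
      by (rule real_le_rsqrt[OF kset_norm[OF that]])
    fix e :: real assume "0 < e"
    then obtain k where "\<rho> * E k f < e" using eventually_scaled_tail_less \<rho> by blast
    then show "\<exists>k. \<forall>u\<in>kset \<rho>. E k u \<le> e" unfolding kset_def by (blast intro: order_trans less_imp_le)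
  qed
  then show ?thesis using closed_kset by simp
qed

lemma kset_scale:
  assumes \<rho>: "0 \<le> \<rho>"
  shows "kset \<rho> = (\<lambda>u. sqrt \<rho> *\<^sub>R u) ` kset 1"
proof
  show "(\<lambda>u. sqrt \<rho> *\<^sub>R u) ` kset 1 \<subseteq> kset \<rho>"
    using \<rho> by (auto simp: kset_def tail_energy_scaleR q_ge_1 intro!: mult_left_mono)
  show "kset \<rho> \<subseteq> (\<lambda>u. sqrt \<rho> *\<^sub>R u) ` kset 1"
  proof
    fix u assume u: "u \<in> kset \<rho>"
    show "u \<in> (\<lambda>u. sqrt \<rho> *\<^sub>R u) ` kset 1"
    proof (cases "\<rho> = 0")
      case True
      then have "u = 0" using kset_norm[OF u] by simp
      then show ?thesis using True zero_in_kset[of 1] by force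
    next
      case False
      then have r: "0 < \<rho>" using \<rho> by simp
      have "(1 / sqrt \<rho>) *\<^sub>R u \<in> kset 1"
        using u r by (simp add: kset_def tail_energy_scaleR q_ge_1 power_divide field_simps)
      moreover have "u = sqrt \<rho> *\<^sub>R ((1 / sqrt \<rho>) *\<^sub>R u)" using r by simp
      ultimately show ?thesis by blast
    qed
  qed
qed

text \<open>Points obeying the bounds up to slacks tending to 0 form a precompact sequence whose
  limits obey the exact bounds. The slack \<eta> is common to all \<open>k\<close>, as
  \<open>pullback_energy\<close> delivers it.\<close>

lemma kset_attracts:
  assumes \<rho>: "0 \<le> \<rho>" and e: "0 < e"
  shows "\<exists>\<eta>>0. \<forall>u. (\<forall>k. E k u \<le> \<rho> * E k f + \<eta>) \<longrightarrow> (\<exists>v\<in>kset \<rho>. dist u v < e)"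
proof (rule ccontr)
  assume neg: "\<not> ?thesis"
  then have "\<exists>u. (\<forall>k. E k u \<le> \<rho> * E k f + \<eta>) \<and> (\<forall>v\<in>kset \<rho>. e \<le> dist u v)" if "0 < \<eta>" for \<eta>
    using that by (meson not_le)
  then have "\<exists>u. (\<forall>k. E k u \<le> \<rho> * E k f + 1 / real (Suc n)) \<and> (\<forall>v\<in>kset \<rho>. e \<le> dist u v)" for n
    by simp
  then obtain u where u: "\<And>n k. E k (u n) \<le> \<rho> * E k f + 1 / real (Suc n)"
      "\<And>n v. v \<in> kset \<rho> \<Longrightarrow> e \<le> dist (u n) v"
    by metis
  have "compact (closure (range u))"
  proof (rule compact_closure_of_uniform_tails[OF q_ge_1])
    show "norm v \<le> sqrt (\<rho> * (norm f)\<^sup>2 + 1)" if vr: "v \<in> range u" for v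
    proof (rule real_le_rsqrt)
      obtain n where n: "v = u n" using vr by blast
      have "1 / real (Suc n) \<le> 1" by simp
      then show "(norm v)\<^sup>2 \<le> \<rho> * (norm f)\<^sup>2 + 1"
        using u(1)[of 0 n] unfolding n tail_energy_0[OF q_ge_1] by linarith
    qed
    fix d :: real assume d: "0 < d"
    obtain k0 where k0: "\<rho> * E k0 f < d / 2" using eventually_scaled_tail_less[of "d / 2"] d \<rho> by auto
    \<comment> \<open>From index \<open>N\<close> on the slack is below \<open>d / 2\<close>; the
      finitely many earlier vectors have small tails individually, and the maximum of the windows
      serves all.\<close>
    obtain N where N: "1 / real (Suc N) < d / 2"
      using reals_Archimedean[of "d / 2"] d by (auto simp: inverse_eq_divide)
    have "\<forall>n<N. \<exists>k. E k (u n) < d"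
      using eventually_tail_energy_less[OF q d] eventually_happens by force
    then obtain \<kappa> where \<kappa>: "\<And>n. n < N \<Longrightarrow> E (\<kappa> n) (u n) < d" by metis
    define k where "k = Max (insert k0 (\<kappa> ` {..<N}))"
    have "E k (u n) \<le> d" for n
    proof (cases "n < N")
      case True
      then have "\<kappa> n \<le> k" unfolding k_def by (intro Max_ge) auto
      then show ?thesis using tail_energy_antimono[OF q_ge_1, of "\<kappa> n" k "u n"] \<kappa>[OF True] by simp
    next
      case False
      have "k0 \<le> k" unfolding k_def by (intro Max_ge) auto
      then have "E k (u n) \<le> E k0 (u n)" by (rule tail_energy_antimono[OF q_ge_1])
      also have "\<dots> \<le> \<rho> * E k0 f + 1 / real (Suc n)" by (rule u(1))
      also have "1 / real (Suc n) \<le> 1 / real (Suc N)" using False by (intro divide_left_mono) auto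
      finally show ?thesis using k0 N by simp
    qed
    then show "\<exists>k. \<forall>v\<in>range u. E k v \<le> d" by blast
  qed
  moreover have "\<forall>n. u n \<in> closure (range u)" using closure_subset[of "range u"] by blast
  ultimately obtain v r where v: "strict_mono r" "(u \<circ> r) \<longlonglongrightarrow> v"
    unfolding compact_def by metis
  have "E k v \<le> \<rho> * E k f" for k
  proof (rule LIMSEQ_le)
    show "(\<lambda>n. E k ((u \<circ> r) n)) \<longlonglongrightarrow> E k v"
      using continuous_on_tail_energy[OF q_ge_1, of UNIV k] v(2)
      by (auto simp: continuous_on_sequentially comp_def)
    have "(\<lambda>n. 1 / real (Suc (r n))) \<longlonglongrightarrow> 0"
      using LIMSEQ_subseq_LIMSEQ[OF LIMSEQ_inverse_real_of_nat v(1)]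
      by (simp add: comp_def inverse_eq_divide)
    from tendsto_add[OF tendsto_const this]
    show "(\<lambda>n. \<rho> * E k f + 1 / real (Suc (r n))) \<longlonglongrightarrow> \<rho> * E k f" by simp
    show "\<exists>N. \<forall>n\<ge>N. E k ((u \<circ> r) n) \<le> \<rho> * E k f + 1 / real (Suc (r n))" using u(1) by auto
  qed
  then have "v \<in> kset \<rho>" by (simp add: kset_def)
  then have "e \<le> dist ((u \<circ> r) n) v" for n using u(2) by simp
  moreover have "\<exists>n. dist ((u \<circ> r) n) v < e"
    using metric_LIMSEQ_D[OF v(2) e] by blast
  ultimately show False by (meson not_le)
qed

end

section \<open>Attractors of cocycles with a compact invariant attracting family\<close>

text \<open>\<open>x\<close> may lie outside \<open>K\<close>: orbits only approach the compact set,
  so uniform continuity on \<open>K\<close> alone would not do.\<close>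

lemma compact_uniform_continuity_at:
  fixes g :: "'a::metric_space \<Rightarrow> 'b::metric_space"
  assumes K: "compact K" and g: "continuous_on UNIV g" and e: "0 < e"
  shows "\<exists>d>0. \<forall>k\<in>K. \<forall>x. dist x k < d \<longrightarrow> dist (g x) (g k) < e"
proof (rule ccontr)
  assume neg: "\<not> ?thesis"
  then have "\<exists>k x. k \<in> K \<and> dist x k < d \<and> e \<le> dist (g x) (g k)" if "0 < d" for d
    using that by (meson not_le)
  then have "\<exists>k x. k \<in> K \<and> dist x k < 1 / real (Suc n) \<and> e \<le> dist (g x) (g k)" for n
    by simp
  then obtain k x where kx: "\<And>n. k n \<in> K" "\<And>n. dist (x n) (k n) < 1 / real (Suc n)"
      "\<And>n. e \<le> dist (g (x n)) (g (k n))"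
    by metis
  obtain l r where l: "strict_mono r" "(k \<circ> r) \<longlonglongrightarrow> l"
    using K kx(1) unfolding compact_def by metis
  have "(\<lambda>n. 1 / real (Suc (r n))) \<longlonglongrightarrow> 0"
    using LIMSEQ_subseq_LIMSEQ[OF LIMSEQ_inverse_real_of_nat l(1)]
    by (simp add: comp_def inverse_eq_divide)
  then have "(\<lambda>n. dist (x (r n)) (k (r n))) \<longlonglongrightarrow> 0"
    by (rule Lim_null_comparison[rotated]) (auto intro!: always_eventually less_imp_le[OF kx(2)] simp del: of_nat_Suc)
  moreover have "(\<lambda>n. dist (k (r n)) l) \<longlonglongrightarrow> 0"
    using l(2) by (simp add: tendsto_dist_iff[symmetric] comp_def)
  ultimately have "(\<lambda>n. dist (x (r n)) (k (r n)) + dist (k (r n)) l) \<longlonglongrightarrow> 0"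
    by (rule tendsto_add_zero)
  then have "(\<lambda>n. dist (x (r n)) l) \<longlonglongrightarrow> 0"
    by (rule Lim_null_comparison[rotated]) (auto intro!: always_eventually dist_triangle)
  then have "(\<lambda>n. x (r n)) \<longlonglongrightarrow> l" by (simp add: tendsto_dist_iff[symmetric])
  then have "(\<lambda>n. dist (g (x (r n))) (g (k (r n)))) \<longlonglongrightarrow> dist (g l) (g l)"
    using l(2) g by (intro tendsto_dist) (auto simp: continuous_on_sequentially comp_def)
  then have "e \<le> dist (g l) (g l)"
    by (rule LIMSEQ_le_const) (use kx(3) in blast)
  then show False using e by simp
qed

text \<open>Purely topological, so that one construction serves the random system and, over a
  one-point base, the deterministic one. Attraction to \<open>K\<close> is supplied in
  \<open>attractor_attracts\<close>, relative to a family \<open>D\<close>.\<close>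

locale attracted_cocycle =
  fixes W :: "'w set" and \<theta> :: "real \<Rightarrow> 'w \<Rightarrow> 'w"
    and \<phi> :: "real \<Rightarrow> 'w \<Rightarrow> 'a::metric_space \<Rightarrow> 'a" and K :: "'w \<Rightarrow> 'a set"
  assumes base: "\<omega> \<in> W \<Longrightarrow> \<theta> t \<omega> \<in> W" "\<omega> \<in> W \<Longrightarrow> \<theta> 0 \<omega> = \<omega>"
      "\<omega> \<in> W \<Longrightarrow> \<theta> s (\<theta> t \<omega>) = \<theta> (s + t) \<omega>"
    and cocycle: "\<omega> \<in> W \<Longrightarrow> 0 \<le> s \<Longrightarrow> 0 \<le> t \<Longrightarrow> \<phi> (t + s) \<omega> x = \<phi> t (\<theta> s \<omega>) (\<phi> s \<omega> x)"
    and continuous: "\<omega> \<in> W \<Longrightarrow> 0 \<le> t \<Longrightarrow> continuous_on UNIV (\<phi> t \<omega>)"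
    and K: "\<omega> \<in> W \<Longrightarrow> compact (K \<omega>)" "\<omega> \<in> W \<Longrightarrow> K \<omega> \<noteq> {}"
    and K_invariant: "\<omega> \<in> W \<Longrightarrow> 0 \<le> t \<Longrightarrow> x \<in> K \<omega> \<Longrightarrow> \<phi> t \<omega> x \<in> K (\<theta> t \<omega>)"
begin

definition slice :: "'w \<Rightarrow> real \<Rightarrow> 'a set" where
  "slice \<omega> t = \<phi> t (\<theta> (- t) \<omega>) ` K (\<theta> (- t) \<omega>)"

text \<open>The slices are nested, so integer times suffice, and a countable intersection stays
  accessible to measurability.\<close>

definition attractor :: "'w \<Rightarrow> 'a set" where
  "attractor \<omega> = (\<Inter>n. slice \<omega> (real n))"

lemma pullback_split:
  assumes "\<omega> \<in> W" "0 \<le> s" "0 \<le> t"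
  shows "\<phi> (s + t) (\<theta> (- (s + t)) \<omega>) x = \<phi> s (\<theta> (- s) \<omega>) (\<phi> t (\<theta> (- t) (\<theta> (- s) \<omega>)) x)"
  using cocycle[OF base(1)[OF assms(1)] assms(3,2), of "- (s + t)" x]
    base(3)[OF assms(1), of "- t" "- s"] base(3)[OF assms(1), of t "- (s + t)"]
  by (simp add: algebra_simps)

text \<open>Forward invariance: starting earlier only delivers, at the later starting time, a point
  already in \<open>K\<close>.\<close>

lemma slice_antimono:
  assumes "\<omega> \<in> W" "0 \<le> s" "s \<le> t"
  shows "slice \<omega> t \<subseteq> slice \<omega> s"
proof
  fix y assume "y \<in> slice \<omega> t"
  then obtain x where x: "x \<in> K (\<theta> (- t) \<omega>)" "y = \<phi> t (\<theta> (- t) \<omega>) x" by (auto simp: slice_def)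
  have "y = \<phi> s (\<theta> (- s) \<omega>) (\<phi> (t - s) (\<theta> (- t) \<omega>) x)"
    using pullback_split[of \<omega> s "t - s" x] assms x by (simp add: base)
  moreover have "\<phi> (t - s) (\<theta> (- t) \<omega>) x \<in> K (\<theta> (- s) \<omega>)"
    using K_invariant[of "\<theta> (- t) \<omega>" "t - s" x] assms x by (simp add: base)
  ultimately show "y \<in> slice \<omega> s" by (auto simp: slice_def)
qed

lemma slice_compact: "\<omega> \<in> W \<Longrightarrow> 0 \<le> t \<Longrightarrow> compact (slice \<omega> t)"
  unfolding slice_def
  by (intro compact_continuous_image continuous_on_subset[OF continuous] K base) auto

lemma slice_nonempty: "\<omega> \<in> W \<Longrightarrow> slice \<omega> t \<noteq> {}"
  using K(2)[OF base(1)] by (simp add: slice_def)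

text \<open>Cantor's intersection argument with a closed constraint: \<open>C\<close> will be the
  whole space for nonemptiness, the points at distance at least \<open>e\<close> for approximation,
  and a fibre of the flow for invariance.\<close>

lemma nested_slices:
  assumes \<omega>: "\<omega> \<in> W" and C: "closed C" and ne: "\<And>n. slice \<omega> (real n) \<inter> C \<noteq> {}"
  shows "attractor \<omega> \<inter> C \<noteq> {}"
proof -
  have "(slice \<omega> (real 0) \<inter> C) \<inter> (\<Inter>n\<in>UNIV. slice \<omega> (real n)) \<noteq> {}"
  proof (rule compact_imp_fip_image)
    show "compact (slice \<omega> (real 0) \<inter> C)" by (intro compact_Int_closed slice_compact \<omega> C) simp
    show "closed (slice \<omega> (real n))" for n by (intro compact_imp_closed slice_compact \<omega>) simp
    fix I :: "nat set" assume I: "finite I"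
    have "slice \<omega> (real (Max (insert 0 I))) \<subseteq> slice \<omega> (real n)" if "n \<in> insert 0 I" for n
      using I that by (intro slice_antimono \<omega>) (simp_all del: Max_insert)
    then have "slice \<omega> (real (Max (insert 0 I))) \<inter> C \<subseteq> slice \<omega> (real 0) \<inter> C \<inter> (\<Inter>n\<in>I. slice \<omega> (real n))"
      by blast
    then show "slice \<omega> (real 0) \<inter> C \<inter> (\<Inter>n\<in>I. slice \<omega> (real n)) \<noteq> {}" using ne by blast
  qed
  then show ?thesis unfolding attractor_def by blast
qed

lemma attractor_nonempty: "\<omega> \<in> W \<Longrightarrow> attractor \<omega> \<noteq> {}"
  using nested_slices[of \<omega> UNIV] slice_nonempty by auto

lemma attractor_subset_slice:
  assumes "\<omega> \<in> W" "0 \<le> t"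
  shows "attractor \<omega> \<subseteq> slice \<omega> t"
proof -
  obtain n where "t \<le> real n" using real_arch_simple by blast
  then show ?thesis using slice_antimono[OF assms(1,2)] unfolding attractor_def by blast
qed

lemma attractor_compact:
  assumes "\<omega> \<in> W"
  shows "compact (attractor \<omega>)"
proof -
  have "closed (attractor \<omega>)"
    unfolding attractor_def by (intro closed_INT ballI compact_imp_closed slice_compact assms) simp
  then have "compact (slice \<omega> 0 \<inter> attractor \<omega>)"
    by (intro compact_Int_closed slice_compact assms) simp
  moreover have "slice \<omega> 0 \<inter> attractor \<omega> = attractor \<omega>"
    using attractor_subset_slice[OF assms, of 0] by auto
  ultimately show ?thesis by simp
qed

lemma slice_near_attractor:
  assumes \<omega>: "\<omega> \<in> W" and e: "0 < e"
  shows "\<exists>n. \<forall>a\<in>slice \<omega> (real n). \<exists>b\<in>attractor \<omega>. dist a b < e"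
proof (rule ccontr)
  assume neg: "\<not> ?thesis"
  define C where "C = {x. e \<le> infdist x (attractor \<omega>)}"
  have "closed C"
    unfolding C_def by (intro closed_Collect_le continuous_intros)
  moreover have "slice \<omega> (real n) \<inter> C \<noteq> {}" for n
  proof -
    have "\<exists>a\<in>slice \<omega> (real n). \<forall>b\<in>attractor \<omega>. e \<le> dist a b" using neg by (meson not_le)
    then obtain a where "a \<in> slice \<omega> (real n)" "\<And>b. b \<in> attractor \<omega> \<Longrightarrow> e \<le> dist a b" by blast
    then have "a \<in> slice \<omega> (real n) \<inter> C"
      using attractor_nonempty[OF \<omega>] by (auto simp: C_def infdist_notempty intro!: cINF_greatest)
    then show ?thesis by blast
  qed
  ultimately have "attractor \<omega> \<inter> C \<noteq> {}" by (rule nested_slices[OF \<omega>])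
  then show False using e by (auto simp: C_def)
qed

lemma slice_shift:
  assumes \<omega>: "\<omega> \<in> W" and "0 \<le> s" "0 \<le> t"
  shows "slice (\<theta> t \<omega>) (t + s) = \<phi> t \<omega> ` slice \<omega> s"
proof -
  have "\<phi> (t + s) (\<theta> (- (t + s)) (\<theta> t \<omega>)) x = \<phi> t \<omega> (\<phi> s (\<theta> (- s) \<omega>) x)" for x
    using pullback_split[OF base(1)[OF \<omega>, of t] assms(3,2), of x] \<omega> by (simp add: base)
  moreover have "\<theta> (- (t + s)) (\<theta> t \<omega>) = \<theta> (- s) \<omega>" using \<omega> by (simp add: base)
  ultimately show ?thesis by (simp add: slice_def image_image)
qed

lemma attractor_invariant:
  assumes \<omega>: "\<omega> \<in> W" and t: "0 \<le> t"
  shows "\<phi> t \<omega> ` attractor \<omega> = attractor (\<theta> t \<omega>)"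
proof
  show "\<phi> t \<omega> ` attractor \<omega> \<subseteq> attractor (\<theta> t \<omega>)"
  proof -
    have "\<phi> t \<omega> x \<in> slice (\<theta> t \<omega>) (real n)" if x: "x \<in> attractor \<omega>" for x n
    proof -
      have "\<phi> t \<omega> x \<in> slice (\<theta> t \<omega>) (t + real n)"
        unfolding slice_shift[OF \<omega> of_nat_0_le_iff t] using x by (auto simp: attractor_def)
      then show ?thesis using slice_antimono[OF base(1)[OF \<omega>], of "real n" "t + real n" t] t by auto
    qed
    then show ?thesis by (auto simp: attractor_def)
  qed
  show "attractor (\<theta> t \<omega>) \<subseteq> \<phi> t \<omega> ` attractor \<omega>"
  proof
    fix y assume y: "y \<in> attractor (\<theta> t \<omega>)"
    \<comment> \<open>Each slice contains a preimage of \<open>y\<close>, possibly a different one;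
      compactness of the nested slices produces one lying in all of them.\<close>
    have "attractor \<omega> \<inter> {x. \<phi> t \<omega> x = y} \<noteq> {}"
    proof (rule nested_slices[OF \<omega>])
      show "closed {x. \<phi> t \<omega> x = y}"
        by (intro closed_Collect_eq continuous \<omega> t continuous_on_const)
      fix n
      have "y \<in> slice (\<theta> t \<omega>) (t + real n)"
        using attractor_subset_slice[OF base(1)[OF \<omega>], of "t + real n" t] t y by auto
      then show "slice \<omega> (real n) \<inter> {x. \<phi> t \<omega> x = y} \<noteq> {}"
        unfolding slice_shift[OF \<omega> of_nat_0_le_iff t] by auto
    qed
    then show "y \<in> \<phi> t \<omega> ` attractor \<omega>" by auto
  qed
qed

text \<open>The orbit is close to \<open>K\<close> at time \<open>- n\<close>, and the remaining
  time \<open>n\<close> carries it close to a slice that is itself close to the attractor.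
  Continuity near the compact set preserves the first closeness.\<close>

lemma attractor_attracts:
  assumes D: "\<And>\<omega> e. \<omega> \<in> W \<Longrightarrow> 0 < e \<Longrightarrow>
      \<forall>\<^sub>F t in at_top. \<forall>x\<in>D (\<theta> (- t) \<omega>). \<exists>k\<in>K \<omega>. dist (\<phi> t (\<theta> (- t) \<omega>) x) k < e"
    and \<omega>: "\<omega> \<in> W" and e: "0 < e"
  shows "\<forall>\<^sub>F t in at_top. \<forall>x\<in>D (\<theta> (- t) \<omega>). \<exists>a\<in>attractor \<omega>. dist (\<phi> t (\<theta> (- t) \<omega>) x) a < e"
proof -
  obtain n where n: "\<And>a. a \<in> slice \<omega> (real n) \<Longrightarrow> \<exists>b\<in>attractor \<omega>. dist a b < e / 2"
    using slice_near_attractor[OF \<omega>, of "e / 2"] e by auto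
  define \<omega>' where "\<omega>' = \<theta> (- real n) \<omega>"
  have \<omega>': "\<omega>' \<in> W" using \<omega> by (simp add: \<omega>'_def base)
  obtain d where d: "0 < d" "\<And>k x. k \<in> K \<omega>' \<Longrightarrow> dist x k < d \<Longrightarrow>
      dist (\<phi> (real n) \<omega>' x) (\<phi> (real n) \<omega>' k) < e / 2"
    using compact_uniform_continuity_at[OF K(1)[OF \<omega>'] continuous[OF \<omega>' of_nat_0_le_iff, of n], of "e / 2"] e
    by auto
  have "\<forall>\<^sub>F t in at_top. \<forall>x\<in>D (\<theta> (- t) \<omega>'). \<exists>k\<in>K \<omega>'. dist (\<phi> t (\<theta> (- t) \<omega>') x) k < d"
    by (rule D[OF \<omega>' d(1)])
  then have "\<forall>\<^sub>F t in at_top. \<forall>x\<in>D (\<theta> (- (t - real n)) \<omega>'). \<exists>k\<in>K \<omega>'.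
      dist (\<phi> (t - real n) (\<theta> (- (t - real n)) \<omega>') x) k < d"
  proof (rule eventually_compose_filterlim)
    show "filterlim (\<lambda>t. t - real n) at_top at_top"
      using filterlim_tendsto_add_at_top[OF tendsto_const[of "- real n"] filterlim_ident] by simp
  qed
  then show ?thesis
    using eventually_ge_at_top[of "real n"]
  proof (eventually_elim, intro ballI)
    fix t x assume near: "\<forall>x\<in>D (\<theta> (- (t - real n)) \<omega>'). \<exists>k\<in>K \<omega>'.
        dist (\<phi> (t - real n) (\<theta> (- (t - real n)) \<omega>') x) k < d"
      and t: "real n \<le> t" and x: "x \<in> D (\<theta> (- t) \<omega>)"
    have th: "\<theta> (- (t - real n)) \<omega>' = \<theta> (- t) \<omega>" using \<omega> by (simp add: \<omega>'_def base)
    define z where "z = \<phi> (t - real n) (\<theta> (- t) \<omega>) x"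
    have eq: "\<phi> t (\<theta> (- t) \<omega>) x = \<phi> (real n) \<omega>' z"
      using pullback_split[OF \<omega>, of "real n" "t - real n" x] t th by (simp add: \<omega>'_def z_def)
    obtain k where k: "k \<in> K \<omega>'" "dist z k < d" using near x th by (auto simp: z_def)
    have "\<phi> (real n) \<omega>' k \<in> slice \<omega> (real n)" using k(1) by (simp add: slice_def \<omega>'_def)
    then obtain a where a: "a \<in> attractor \<omega>" "dist (\<phi> (real n) \<omega>' k) a < e / 2" using n by blast
    have "dist (\<phi> (real n) \<omega>' z) a < e"
      using dist_triangle[of "\<phi> (real n) \<omega>' z" a "\<phi> (real n) \<omega>' k"] d(2)[OF k] a(2) by linarith
    then show "\<exists>a\<in>attractor \<omega>. dist (\<phi> t (\<theta> (- t) \<omega>) x) a < e" using a(1) eq by auto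
  qed
qed

text \<open>Nested compact slices shrink uniformly to their intersection, so distances converge;
  measurability passes from the slices to the attractor in this way.\<close>

lemma infdist_slice_tendsto:
  assumes \<omega>: "\<omega> \<in> W"
  shows "(\<lambda>n. infdist x (slice \<omega> (real n))) \<longlonglongrightarrow> infdist x (attractor \<omega>)"
proof (rule LIMSEQ_I)
  fix e :: real assume e: "0 < e"
  obtain N where N: "\<And>a. a \<in> slice \<omega> (real N) \<Longrightarrow> \<exists>b\<in>attractor \<omega>. dist a b < e / 2"
    using slice_near_attractor[OF \<omega>, of "e / 2"] e by auto
  have "norm (infdist x (slice \<omega> (real n)) - infdist x (attractor \<omega>)) < e" if "n \<ge> N" for n
  proof -
    have sub: "attractor \<omega> \<subseteq> slice \<omega> (real n)" by (rule attractor_subset_slice[OF \<omega>]) simp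
    have "infdist x (attractor \<omega>) - e / 2 \<le> dist x a" if a: "a \<in> slice \<omega> (real n)" for a
    proof -
      have "a \<in> slice \<omega> (real N)" using slice_antimono[OF \<omega>, of "real N" "real n"] a \<open>n \<ge> N\<close> by auto
      then obtain b where b: "b \<in> attractor \<omega>" "dist a b < e / 2" using N by blast
      have "infdist x (attractor \<omega>) \<le> dist x b" by (rule infdist_le[OF b(1)])
      then show ?thesis using b(2) dist_triangle[of x b a] by linarith
    qed
    then have "infdist x (attractor \<omega>) - e / 2 \<le> infdist x (slice \<omega> (real n))"
      using slice_nonempty[OF \<omega>] by (auto simp: infdist_notempty intro!: cINF_greatest)
    moreover have "infdist x (slice \<omega> (real n)) \<le> infdist x (attractor \<omega>)"
      by (rule infdist_mono[OF sub attractor_nonempty[OF \<omega>]])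
    ultimately show ?thesis using e by (simp add: abs_if)
  qed
  then show "\<exists>N. \<forall>n\<ge>N. norm (infdist x (slice \<omega> (real n)) - infdist x (attractor \<omega>)) < e" by blast
qed

end

section \<open>The lattice system driven by a stationary family of paths\<close>

context lattice
begin

lemma flow_0: "continuous_on UNIV y \<Longrightarrow> flow y 0 x = x"
  using flow_solves[of y x] by (simp add: solves_def)

text \<open>\<open>L\<close> depends only on \<open>T\<close>, \<open>Z\<close> and
  \<open>r\<close>. This uniformity over paths allows the noise intensity to tend to 0 after the
  time horizon is fixed.\<close>

lemma flow_close:
  assumes T: "0 \<le> T"
  shows "\<exists>L. \<forall>y z x x' d. continuous_on UNIV y \<longrightarrow> continuous_on UNIV z \<longrightarrow>
    (\<forall>t\<in>{0..T}. \<bar>y t\<bar> \<le> Z \<and> \<bar>z t\<bar> \<le> Z \<and> \<bar>y t - z t\<bar> \<le> d) \<longrightarrow> norm x \<le> r \<longrightarrow> norm x' \<le> r \<longrightarrow>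
    (norm (flow y T x - flow z T x'))\<^sup>2 \<le> ((norm (x - x'))\<^sup>2 + d\<^sup>2) * exp (L * T)"
proof -
  obtain B where B: "\<And>y u t. trajectory T y u \<Longrightarrow> (\<forall>t\<in>{0..T}. \<bar>y t\<bar> \<le> Z) \<Longrightarrow> norm (u 0) \<le> r \<Longrightarrow>
      t \<in> {0..T} \<Longrightarrow> norm (u t) \<le> B"
    using solution_bounds[of T Z r] by blast
  obtain L where L: "\<And>y z u v d T t. trajectory T y u \<Longrightarrow> trajectory T z v \<Longrightarrow>
     (\<forall>t\<in>{0..T}. \<bar>y t\<bar> \<le> Z \<and> \<bar>z t\<bar> \<le> Z \<and> norm (u t) \<le> B \<and> norm (v t) \<le> B \<and> \<bar>y t - z t\<bar> \<le> d) \<Longrightarrow>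
     t \<in> {0..T} \<Longrightarrow> (norm (u t - v t))\<^sup>2 \<le> ((norm (u 0 - v 0))\<^sup>2 + d\<^sup>2) * exp (L * t)"
    using stability_on_bounded[of Z B] by blast
  show ?thesis
  proof (intro exI[of _ L] allI impI)
    fix y z :: "real \<Rightarrow> real" and x x' :: ell2 and d
    assume y: "continuous_on UNIV y" and z: "continuous_on UNIV z"
      and bd: "\<forall>t\<in>{0..T}. \<bar>y t\<bar> \<le> Z \<and> \<bar>z t\<bar> \<le> Z \<and> \<bar>y t - z t\<bar> \<le> d"
      and x: "norm x \<le> r" "norm x' \<le> r"
    define u v where "u = (\<lambda>t. flow y t x)" and "v = (\<lambda>t. flow z t x')"
    have tr: "trajectory T y u" "trajectory T z v"
      unfolding u_def v_def
      by (rule solves_trajectory[OF flow_solves[OF y]], rule solves_trajectory[OF flow_solves[OF z]])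
    have init: "u 0 = x" "v 0 = x'" by (simp_all add: u_def v_def flow_0 y z)
    have "norm (u t) \<le> B" "norm (v t) \<le> B" if "t \<in> {0..T}" for t
      using B[OF tr(1) _ _ that] B[OF tr(2) _ _ that] bd x init by auto
    then have "(norm (u T - v T))\<^sup>2 \<le> ((norm (u 0 - v 0))\<^sup>2 + d\<^sup>2) * exp (L * T)"
      using bd T by (intro L[OF tr]) auto
    then show "(norm (flow y T x - flow z T x'))\<^sup>2 \<le> ((norm (x - x'))\<^sup>2 + d\<^sup>2) * exp (L * T)"
      by (simp add: init) (simp add: u_def v_def)
  qed
qed

section \<open>Continuity and cocycle property of the flow\<close>

lemma path_bounded:
  assumes "continuous_on UNIV (y :: real \<Rightarrow> real)"
  shows "\<exists>Z\<ge>0. \<forall>t\<in>{0..T}. \<bar>y t\<bar> \<le> Z"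
proof -
  have "bounded (y ` {0..T})"
    by (intro compact_imp_bounded compact_continuous_image continuous_on_subset[OF assms]) auto
  then obtain Z where "\<forall>t\<in>{0..T}. \<bar>y t\<bar> \<le> Z" by (auto simp: bounded_iff)
  then show ?thesis by (intro exI[of _ "\<bar>Z\<bar>"]) (auto intro: order_trans)
qed

lemma continuous_on_flow:
  assumes y: "continuous_on UNIV y" and T: "0 \<le> T"
  shows "continuous_on UNIV (flow y T)"
proof (rule continuous_at_imp_continuous_on, rule ballI)
  fix x0 :: ell2
  obtain Z where Z: "\<forall>t\<in>{0..T}. \<bar>y t\<bar> \<le> Z" using path_bounded[OF y] by blast
  obtain L where "\<And>y z x x' d. continuous_on UNIV y \<Longrightarrow> continuous_on UNIV z \<Longrightarrow>
      \<forall>t\<in>{0..T}. \<bar>y t\<bar> \<le> Z \<and> \<bar>z t\<bar> \<le> Z \<and> \<bar>y t - z t\<bar> \<le> d \<Longrightarrow> norm x \<le> norm x0 + 1 \<Longrightarrow>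
      norm x' \<le> norm x0 + 1 \<Longrightarrow>
      (norm (flow y T x - flow z T x'))\<^sup>2 \<le> ((norm (x - x'))\<^sup>2 + d\<^sup>2) * exp (L * T)"
    using flow_close[OF T, of Z "norm x0 + 1"] by blast
  from this[OF y y, of 0] Z have L: "norm x \<le> norm x0 + 1 \<Longrightarrow> norm x' \<le> norm x0 + 1 \<Longrightarrow>
      (norm (flow y T x - flow y T x'))\<^sup>2 \<le> ((norm (x - x'))\<^sup>2 + 0\<^sup>2) * exp (L * T)" for x x'
    by simp
  have "(exp (L * T / 2))-lipschitz_on (ball x0 1) (flow y T)"
  proof (rule lipschitz_onI)
    fix x x' assume "x \<in> ball x0 1" "x' \<in> ball x0 1"
    then have "norm x \<le> norm x0 + 1" "norm x' \<le> norm x0 + 1"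
      using norm_triangle_ineq2[of x x0] norm_triangle_ineq2[of x' x0]
      by (auto simp: dist_norm norm_minus_commute)
    from L[OF this] have "(norm (flow y T x - flow y T x'))\<^sup>2 \<le> (exp (L * T / 2) * norm (x - x'))\<^sup>2"
      by (simp add: power_mult_distrib exp_double[symmetric] mult.commute)
    then show "dist (flow y T x) (flow y T x') \<le> exp (L * T / 2) * dist x x'"
      unfolding dist_norm by (rule power2_le_imp_le) simp
  qed simp
  then have "continuous_on (ball x0 1) (flow y T)" by (rule lipschitz_on_continuous_on)
  then show "isCont (flow y T) x0" by (simp add: continuous_on_eq_continuous_at)
qed

lemma flow_cocycle:
  assumes y: "continuous_on UNIV y" and s: "0 \<le> s" and t: "0 \<le> t"
  shows "flow y (t + s) x = flow (\<lambda>r. y (s + r)) t (flow y s x)"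
proof -
  have yc: "continuous_on UNIV (\<lambda>r. y (s + r))"
    by (intro continuous_on_compose2[OF y] continuous_intros) auto
  have "solves (\<lambda>r. F (y (s + r))) (flow y s x) (\<lambda>r. flow y (s + r) x)"
    unfolding solves_def
  proof (intro conjI allI impI)
    fix r :: real assume r: "0 \<le> r"
    have "((\<lambda>r. s + r) has_vector_derivative 1) (at r within {0..})"
      by (auto intro!: derivative_eq_intros)
    moreover have "((\<lambda>t. flow y t x) has_vector_derivative F (y (s + r)) (flow y (s + r) x)) (at (s + r) within {0..})"
      using flow_solves[OF y, of x] s r by (simp add: solves_def)
    then have "((\<lambda>t. flow y t x) has_vector_derivative F (y (s + r)) (flow y (s + r) x))
        (at (s + r) within (\<lambda>r. s + r) ` {0..})"
      by (rule has_vector_derivative_within_subset) (use s in auto)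
    ultimately have "((\<lambda>t. flow y t x) \<circ> (\<lambda>r. s + r) has_vector_derivative 1 *\<^sub>R F (y (s + r)) (flow y (s + r) x))
        (at r within {0..})"
      by (rule vector_diff_chain_within)
    then show "((\<lambda>r. flow y (s + r) x) has_vector_derivative F (y (s + r)) (flow y (s + r) x)) (at r within {0..})"
      by (simp add: comp_def)
  qed simp
  from solution_map_eq[OF flow_approximation(1)[OF yc] this t]
  show ?thesis by (simp add: add.commute)
qed

end

locale driven_lattice = lattice +
  fixes W :: "'w set" and \<theta> :: "real \<Rightarrow> 'w \<Rightarrow> 'w" and y :: "'w \<Rightarrow> real \<Rightarrow> real"
  assumes base: "\<omega> \<in> W \<Longrightarrow> \<theta> t \<omega> \<in> W" "\<omega> \<in> W \<Longrightarrow> \<theta> 0 \<omega> = \<omega>"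
      "\<omega> \<in> W \<Longrightarrow> \<theta> s (\<theta> t \<omega>) = \<theta> (s + t) \<omega>"
    and path_shift: "\<omega> \<in> W \<Longrightarrow> y (\<theta> t \<omega>) s = y \<omega> (t + s)"
    and path_sublinear: "\<omega> \<in> W \<Longrightarrow> sublinear_path (y \<omega>)"
begin

lemma path_continuous: "\<omega> \<in> W \<Longrightarrow> continuous_on UNIV (y \<omega>)"
  using path_sublinear sublinear_pathD(1) by blast

lemma path_shift': "\<omega> \<in> W \<Longrightarrow> y (\<theta> t \<omega>) = (\<lambda>s. y \<omega> (t + s))"
  by (rule ext) (rule path_shift)

abbreviation \<phi> :: "real \<Rightarrow> 'w \<Rightarrow> ell2 \<Rightarrow> ell2" where "\<phi> t \<omega> \<equiv> flow (y \<omega>) t"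

abbreviation K :: "'w \<Rightarrow> ell2 set" where "K \<omega> \<equiv> kset (radius (y \<omega>))"

sublocale attracted_cocycle W \<theta> \<phi> K
proof
  fix \<omega> s t x assume \<omega>: "\<omega> \<in> W"
  note yc = path_continuous[OF \<omega>]
  show "compact (K \<omega>)" by (rule compact_kset[OF radius_nonneg])
  show "K \<omega> \<noteq> {}" using zero_in_kset[OF radius_nonneg] by blast
  show "continuous_on UNIV (\<phi> t \<omega>)" if "0 \<le> t" by (rule continuous_on_flow[OF yc that])
  show "\<phi> (t + s) \<omega> x = \<phi> t (\<theta> s \<omega>) (\<phi> s \<omega> x)" if "0 \<le> s" "0 \<le> t"
    using flow_cocycle[OF yc that, of x] by (simp add: path_shift' \<omega>)
  show "\<phi> t \<omega> x \<in> K (\<theta> t \<omega>)" if t: "0 \<le> t" and x: "x \<in> K \<omega>"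
  proof -
    have "E k (\<phi> t \<omega> x) \<le> radius (y (\<theta> t \<omega>)) * E k f" for k
    proof -
      have "E k (\<phi> t \<omega> x) \<le> E k f * radius (y (\<theta> t \<omega>))
          + exp (- \<delta> * t + 2 * primitive (y \<omega>) t) * (E k x - E k f * radius (y \<omega>))"
        using flow_dissipation[OF path_sublinear[OF \<omega>] t, of k x] by (simp add: path_shift' \<omega>)
      also have "exp (- \<delta> * t + 2 * primitive (y \<omega>) t) * (E k x - E k f * radius (y \<omega>)) \<le> 0"
        using x by (intro mult_nonneg_nonpos) (auto simp: kset_def mult.commute)
      finally show ?thesis by (simp add: mult.commute)
    qed
    then show ?thesis by (simp add: kset_def)
  qed
qed (simp_all add: base)

text \<open>The subexponential growth of \<open>D\<close> along the base flow is what temperedness provides.\<close>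

lemma pullback_energy:
  assumes \<omega>: "\<omega> \<in> W" and \<eta>: "0 < \<eta>"
    and D: "\<And>\<rho>. 0 < \<rho> \<Longrightarrow> \<forall>\<^sub>F t in at_top. \<forall>x\<in>D (\<theta> (- t) \<omega>). norm x \<le> exp (\<rho> * t)"
  shows "\<forall>\<^sub>F t in at_top. \<forall>x\<in>D (\<theta> (- t) \<omega>). \<forall>k. E k (\<phi> t (\<theta> (- t) \<omega>) x) \<le> radius (y \<omega>) * E k f + \<eta>"
proof -
  \<comment> \<open>Twice the primitive costs the rate \<open>\<delta> / 4\<close>, the squared
    initial norm another \<open>\<delta> / 4\<close>, and the decay \<open>\<delta> / 2\<close>
    remains.\<close>
  have d8: "0 < \<delta> / 8" using delta_pos by simp
  obtain C where C: "\<And>t. t \<le> 0 \<Longrightarrow> \<bar>primitive (y \<omega>) t\<bar> \<le> C + \<delta> / 8 * \<bar>t\<bar>"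
    using sublinear_pathD(2)[OF path_sublinear[OF \<omega>] d8] by blast
  have "((\<lambda>t. exp (2 * C) * exp (- (\<delta> / 2 * t))) \<longlongrightarrow> exp (2 * C) * 0) at_top"
    using filterlim_tendsto_pos_mult_at_top[OF tendsto_const _ filterlim_ident, of "\<delta> / 2"] delta_pos
    by (intro tendsto_intros filterlim_compose[OF exp_at_bot]) (simp add: filterlim_uminus_at_top)
  then have "\<forall>\<^sub>F t in at_top. exp (2 * C) * exp (- (\<delta> / 2 * t)) < \<eta>"
    using \<eta> by (intro order_tendstoD) auto
  then show ?thesis using D[OF d8] eventually_ge_at_top[of 0]
  proof eventually_elim
    case (elim t)
    show ?case
    proof (intro ballI allI)
      fix x k assume x: "x \<in> D (\<theta> (- t) \<omega>)"
      have t: "0 \<le> t" by (rule elim(3))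
      have \<omega>': "\<theta> (- t) \<omega> \<in> W" by (rule base(1)[OF \<omega>])
      have "radius (\<lambda>s. y (\<theta> (- t) \<omega>) (t + s)) = radius (y \<omega>)"
        by (simp add: path_shift \<omega>)
      then have "E k (\<phi> t (\<theta> (- t) \<omega>) x) \<le> E k f * radius (y \<omega>)
          + exp (- \<delta> * t + 2 * primitive (y (\<theta> (- t) \<omega>)) t) * (E k x - E k f * radius (y (\<theta> (- t) \<omega>)))"
        using flow_dissipation[OF path_sublinear[OF \<omega>'] t, of k x] by simp
      also have "\<dots> \<le> E k f * radius (y \<omega>)
          + exp (- \<delta> * t + 2 * primitive (y (\<theta> (- t) \<omega>)) t) * exp (\<delta> / 4 * t)"
      proof (intro add_left_mono mult_left_mono)
        have "E k x \<le> (norm x)\<^sup>2" by (rule tail_energy_le[OF q_ge_1])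
        also have "\<dots> \<le> (exp (\<delta> / 8 * t))\<^sup>2" using elim(2) x by (intro power_mono) auto
        also have "\<dots> = exp (\<delta> / 4 * t)" by (simp add: exp_double[symmetric])
        finally show "E k x - E k f * radius (y (\<theta> (- t) \<omega>)) \<le> exp (\<delta> / 4 * t)"
          using mult_nonneg_nonneg[OF tail_energy_nonneg[OF q_ge_1, of k f] radius_nonneg[of "y (\<theta> (- t) \<omega>)"]]
          by linarith
      qed simp
      also have "\<dots> \<le> E k f * radius (y \<omega>) + exp (2 * C - 3 * \<delta> / 4 * t) * exp (\<delta> / 4 * t)"
      proof (intro add_left_mono mult_right_mono)
        have "primitive (y (\<theta> (- t) \<omega>)) t = - primitive (y \<omega>) (- t)"
          unfolding path_shift'[OF \<omega>] primitive_shift[OF path_continuous[OF \<omega>]] by simp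
        then show "exp (- \<delta> * t + 2 * primitive (y (\<theta> (- t) \<omega>)) t) \<le> exp (2 * C - 3 * \<delta> / 4 * t)"
          using C[of "- t"] t by (simp add: abs_le_iff)
      qed simp
      also have "exp (2 * C - 3 * \<delta> / 4 * t) * exp (\<delta> / 4 * t) = exp (2 * C) * exp (- (\<delta> / 2 * t))"
        unfolding exp_add[symmetric] by simp
      finally show "E k (\<phi> t (\<theta> (- t) \<omega>) x) \<le> radius (y \<omega>) * E k f + \<eta>"
        using elim(1) by (simp add: mult.commute)
    qed
  qed
qed

lemma K_attracts:
  assumes \<omega>: "\<omega> \<in> W" and e: "0 < e"
    and D: "\<And>\<rho>. 0 < \<rho> \<Longrightarrow> \<forall>\<^sub>F t in at_top. \<forall>x\<in>D (\<theta> (- t) \<omega>). norm x \<le> exp (\<rho> * t)"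
  shows "\<forall>\<^sub>F t in at_top. \<forall>x\<in>D (\<theta> (- t) \<omega>). \<exists>k\<in>K \<omega>. dist (\<phi> t (\<theta> (- t) \<omega>) x) k < e"
proof -
  obtain \<eta> where \<eta>: "0 < \<eta>" "\<And>u. (\<forall>k. E k u \<le> radius (y \<omega>) * E k f + \<eta>) \<Longrightarrow> \<exists>v\<in>K \<omega>. dist u v < e"
    using kset_attracts[OF radius_nonneg[of "y \<omega>"] e] by blast
  have "\<forall>\<^sub>F t in at_top. \<forall>x\<in>D (\<theta> (- t) \<omega>). \<forall>k. E k (\<phi> t (\<theta> (- t) \<omega>) x) \<le> radius (y \<omega>) * E k f + \<eta>"
    by (rule pullback_energy[OF \<omega> \<eta>(1)]) (rule D)
  then show ?thesis by eventually_elim (use \<eta>(2) in blast)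
qed

text \<open>Invariance writes each point as an image from arbitrarily far in the past, so the slack
  in \<open>pullback_energy\<close> disappears. This places every random attractor, however
  obtained, in the absorbing set.\<close>

lemma invariant_subset_K:
  assumes \<omega>: "\<omega> \<in> W"
    and D: "\<And>\<rho>. 0 < \<rho> \<Longrightarrow> \<forall>\<^sub>F t in at_top. \<forall>x\<in>D (\<theta> (- t) \<omega>). norm x \<le> exp (\<rho> * t)"
    and inv: "\<And>t. 0 \<le> t \<Longrightarrow> D \<omega> \<subseteq> \<phi> t (\<theta> (- t) \<omega>) ` D (\<theta> (- t) \<omega>)"
  shows "D \<omega> \<subseteq> K \<omega>"
proof
  fix u assume u: "u \<in> D \<omega>"
  have "E k u \<le> radius (y \<omega>) * E k f" for k
  proof (rule field_le_epsilon)
    fix \<eta> :: real assume \<eta>: "0 < \<eta>"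
    have "\<forall>\<^sub>F t in at_top. \<forall>x\<in>D (\<theta> (- t) \<omega>). \<forall>k. E k (\<phi> t (\<theta> (- t) \<omega>) x) \<le> radius (y \<omega>) * E k f + \<eta>"
      by (rule pullback_energy[OF \<omega> \<eta>]) (rule D)
    from eventually_conj[OF this eventually_ge_at_top[of 0]]
    obtain t where t: "0 \<le> t" "\<forall>x\<in>D (\<theta> (- t) \<omega>). E k (\<phi> t (\<theta> (- t) \<omega>) x) \<le> radius (y \<omega>) * E k f + \<eta>"
      using eventually_happens[of _ "at_top :: real filter"] by force
    then show "E k u \<le> radius (y \<omega>) * E k f + \<eta>" using inv[OF t(1)] u by auto
  qed
  then show "u \<in> K \<omega>" by (simp add: kset_def)
qed

lemma K_subexponential:
  assumes \<omega>: "\<omega> \<in> W" and c: "0 < c"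
  shows "\<exists>B. \<forall>t\<ge>0. \<forall>u\<in>K (\<theta> (- t) \<omega>). norm u \<le> B * exp (c * t)"
proof -
  \<comment> \<open>A radius growing like \<open>exp (6 * d * t)\<close> gives norms growing like
    \<open>exp (3 * d * t)\<close>, hence \<open>c / 3\<close>; the bound
    \<open>\<delta> / 8\<close> keeps \<open>4 * d\<close> below \<delta>. The 6 counts two
    primitives and one path value, each doubled.\<close>
  define d where "d = min (c / 3) (\<delta> / 8)"
  have d: "0 < d" "6 * d \<le> 2 * c" "4 * d < \<delta>" using c delta_pos by (auto simp: d_def min_def)
  obtain C where C: "\<And>t. t \<le> 0 \<Longrightarrow> \<bar>y \<omega> t\<bar> \<le> C + d * \<bar>t\<bar> \<and> \<bar>primitive (y \<omega>) t\<bar> \<le> C + d * \<bar>t\<bar>"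
    using sublinear_pathD(2)[OF path_sublinear[OF \<omega>] d(1)] by blast
  define B where "B = sqrt (exp (6 * C) / (\<delta> - 4 * d) / \<delta>) * norm f"
  have "norm u \<le> B * exp (c * t)" if t: "0 \<le> t" and u: "u \<in> K (\<theta> (- t) \<omega>)" for t u
  proof -
    have le: "radius (y (\<theta> (- t) \<omega>)) \<le> exp (6 * C + 6 * d * t) / (\<delta> - 4 * d) / \<delta>"
    proof (rule radius_le(2)[OF path_continuous[OF base(1)[OF \<omega>]] d(3)])
      fix s :: real assume s: "0 \<le> s"
      have "primitive (y (\<theta> (- t) \<omega>)) (- s) = primitive (y \<omega>) (- t + - s) - primitive (y \<omega>) (- t)"
        unfolding path_shift'[OF \<omega>] by (rule primitive_shift[OF path_continuous[OF \<omega>]])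
      moreover have "\<bar>y \<omega> (- t + - s)\<bar> \<le> C + d * (t + s)" "\<bar>primitive (y \<omega>) (- t + - s)\<bar> \<le> C + d * (t + s)"
        "\<bar>primitive (y \<omega>) (- t)\<bar> \<le> C + d * t"
        using C[of "- t + - s"] C[of "- t"] s t by (auto simp: add.commute)
      ultimately show "- 2 * primitive (y (\<theta> (- t) \<omega>)) (- s) - 2 * y (\<theta> (- t) \<omega>) (- s)
          \<le> 6 * C + 6 * d * t + 4 * d * s"
        unfolding path_shift[OF \<omega>] by (simp add: abs_le_iff distrib_left)
    qed
    have "(norm u)\<^sup>2 \<le> radius (y (\<theta> (- t) \<omega>)) * (norm f)\<^sup>2" by (rule kset_norm[OF u])
    also have "\<dots> \<le> exp (6 * C + 6 * d * t) / (\<delta> - 4 * d) / \<delta> * (norm f)\<^sup>2"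
      by (rule mult_right_mono[OF le]) simp
    also have "\<dots> = exp (6 * d * t) * B\<^sup>2"
      using d delta_pos by (simp add: B_def power_mult_distrib exp_add)
    also have "\<dots> \<le> exp (2 * c * t) * B\<^sup>2" using mult_right_mono[OF d(2) t] by (intro mult_right_mono) auto
    also have "\<dots> = (B * exp (c * t))\<^sup>2" by (simp add: power_mult_distrib exp_double[symmetric] mult.assoc)
    finally show ?thesis
      by (rule power2_le_imp_le) (use d delta_pos in \<open>simp add: B_def\<close>)
  qed
  then show ?thesis by blast
qed

lemma attractor_subset_K: "\<omega> \<in> W \<Longrightarrow> attractor \<omega> \<subseteq> K \<omega>"
  using attractor_subset_slice[of \<omega> 0] by (auto simp: slice_def base flow_0 path_continuous)

end

section \<open>Attraction and temperedness in terms of real estimates\<close>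

text \<open>Extended-real limits become estimates on points, the form in which attraction is proved.
  An empty \<open>B\<close> is consistent: infinite infimum on the left, no witness on the
  right.\<close>

lemma semidist_tendsto_0_iff:
  fixes B :: "'a::metric_space set"
  shows "((\<lambda>t. semidist (A t) B) \<longlongrightarrow> 0) G \<longleftrightarrow> (\<forall>e>0. \<forall>\<^sub>F t in G. \<forall>a\<in>A t. \<exists>b\<in>B. dist a b < e)"
proof
  assume lim: "((\<lambda>t. semidist (A t) B) \<longlongrightarrow> 0) G"
  show "\<forall>e>0. \<forall>\<^sub>F t in G. \<forall>a\<in>A t. \<exists>b\<in>B. dist a b < e"
  proof (intro allI impI)
    fix e :: real assume "0 < e"
    then have "\<forall>\<^sub>F t in G. semidist (A t) B < ennreal e" using order_tendstoD(2)[OF lim] by simp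
    then show "\<forall>\<^sub>F t in G. \<forall>a\<in>A t. \<exists>b\<in>B. dist a b < e"
    proof (eventually_elim, intro ballI)
      fix t a assume le: "semidist (A t) B < ennreal e" and a: "a \<in> A t"
      have "(INF b\<in>B. ennreal (dist a b)) \<le> semidist (A t) B"
        unfolding semidist_def by (rule SUP_upper[OF a])
      then have "(INF b\<in>B. ennreal (dist a b)) < ennreal e" using le by (rule le_less_trans)
      then show "\<exists>b\<in>B. dist a b < e" by (auto simp: INF_less_iff ennreal_less_iff)
    qed
  qed
next
  assume ev: "\<forall>e>0. \<forall>\<^sub>F t in G. \<forall>a\<in>A t. \<exists>b\<in>B. dist a b < e"
  show "((\<lambda>t. semidist (A t) B) \<longlongrightarrow> 0) G"
  proof (rule order_tendstoI)
    fix x :: ennreal assume "0 < x"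
    \<comment> \<open>\<open>x\<close> may be infinite; a value strictly between 0 and
      \<open>x\<close> is finite and comes from a real number.\<close>
    then obtain z where z: "0 < z" "z < x" using dense by blast
    then have "z < top" using less_top_ennreal le_less_trans by (metis less_trans not_top_less top.not_eq_extremum)
    then obtain e where e: "z = ennreal e" "0 < e" using z(1) by (cases z) auto
    have "\<forall>\<^sub>F t in G. \<forall>a\<in>A t. \<exists>b\<in>B. dist a b < e" using ev e by blast
    then show "\<forall>\<^sub>F t in G. semidist (A t) B < x"
    proof eventually_elim
      case (elim t)
      have "semidist (A t) B \<le> ennreal e"
        unfolding semidist_def
      proof (rule SUP_least)
        fix a assume "a \<in> A t"
        then obtain b where "b \<in> B" "dist a b < e" using elim by blast
        then show "(INF b\<in>B. ennreal (dist a b)) \<le> ennreal e"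
          by (intro INF_lower2[of b]) (auto intro: ennreal_leI)
      qed
      then show ?case using z(2) e(1) by (meson le_less_trans)
    qed
  qed simp
qed

lemma tempered_random_set_growth:
  assumes "tempered_random_set M D" "\<omega> \<in> space M" "0 < \<rho>"
  shows "\<forall>\<^sub>F t in at_top. \<forall>x\<in>D (shift (- t) \<omega>). norm x \<le> exp (\<rho> * t)"
proof -
  have "((\<lambda>t. ennreal (exp (- \<rho> * t)) * (SUP x\<in>D (shift (- t) \<omega>). ennreal (norm x))) \<longlongrightarrow> 0) at_top"
    using assms by (simp add: tempered_random_set_def)
  then have "\<forall>\<^sub>F t in at_top. ennreal (exp (- \<rho> * t)) * (SUP x\<in>D (shift (- t) \<omega>). ennreal (norm x)) < 1"
    by (rule order_tendstoD) simp
  then show ?thesis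
  proof (eventually_elim, intro ballI)
    fix t x
    assume le: "ennreal (exp (- \<rho> * t)) * (SUP x\<in>D (shift (- t) \<omega>). ennreal (norm x)) < 1"
      and x: "x \<in> D (shift (- t) \<omega>)"
    have "ennreal (exp (- \<rho> * t) * norm x) = ennreal (exp (- \<rho> * t)) * ennreal (norm x)"
      by (simp add: ennreal_mult)
    also have "\<dots> \<le> ennreal (exp (- \<rho> * t)) * (SUP x\<in>D (shift (- t) \<omega>). ennreal (norm x))"
      by (intro mult_left_mono SUP_upper x) simp
    also note le
    finally have "exp (- \<rho> * t) * norm x < 1" by (simp add: ennreal_less_iff flip: ennreal_1)
    then have "exp (\<rho> * t) * (exp (- \<rho> * t) * norm x) < exp (\<rho> * t) * 1"
      by (intro mult_strict_left_mono) auto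
    then show "norm x \<le> exp (\<rho> * t)" by (simp add: mult.assoc[symmetric] exp_add[symmetric])
  qed
qed

lemma tempered_random_setI:
  assumes D: "random_set M D"
    and bd: "\<And>\<omega> c. \<omega> \<in> space M \<Longrightarrow> 0 < c \<Longrightarrow> \<exists>B. \<forall>t\<ge>0. \<forall>x\<in>D (shift (- t) \<omega>). norm x \<le> B * exp (c * t)"
  shows "tempered_random_set M D"
  unfolding tempered_random_set_def
proof (intro conjI D allI impI ballI)
  fix \<rho> :: real and \<omega> assume \<rho>: "0 < \<rho>" and \<omega>: "\<omega> \<in> space M"
  \<comment> \<open>Half the rate is granted to the growth of \<open>D\<close>; the other half
    remains as decay.\<close>
  obtain B where B: "\<And>t x. 0 \<le> t \<Longrightarrow> x \<in> D (shift (- t) \<omega>) \<Longrightarrow> norm x \<le> B * exp (\<rho> / 2 * t)"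
    using bd[OF \<omega>, of "\<rho> / 2"] \<rho> by auto
  have "((\<lambda>t. B * exp (- (\<rho> / 2 * t))) \<longlongrightarrow> B * 0) at_top"
    using filterlim_tendsto_pos_mult_at_top[OF tendsto_const _ filterlim_ident, of "\<rho> / 2"] \<rho>
    by (intro tendsto_intros filterlim_compose[OF exp_at_bot]) (simp add: filterlim_uminus_at_top)
  then have lim: "((\<lambda>t. ennreal (B * exp (- (\<rho> / 2 * t)))) \<longlongrightarrow> ennreal 0) at_top"
    by (intro tendsto_ennrealI) simp
  have le: "\<forall>\<^sub>F t in at_top. ennreal (exp (- \<rho> * t)) * (SUP x\<in>D (shift (- t) \<omega>). ennreal (norm x))
      \<le> ennreal (B * exp (- (\<rho> / 2 * t)))"
    using eventually_ge_at_top[of 0]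
  proof eventually_elim
    case (elim t)
    have "(SUP x\<in>D (shift (- t) \<omega>). ennreal (norm x)) \<le> ennreal (B * exp (\<rho> / 2 * t))"
      by (intro SUP_least ennreal_leI B elim)
    then have "ennreal (exp (- \<rho> * t)) * (SUP x\<in>D (shift (- t) \<omega>). ennreal (norm x))
        \<le> ennreal (exp (- \<rho> * t)) * ennreal (B * exp (\<rho> / 2 * t))"
      by (rule mult_left_mono) simp
    also have "\<dots> = ennreal (exp (- \<rho> * t) * (B * exp (\<rho> / 2 * t)))"
      by (rule ennreal_mult'[symmetric]) simp
    also have "exp (- \<rho> * t) * (B * exp (\<rho> / 2 * t)) = B * exp (- (\<rho> / 2 * t))"
      by (simp add: mult.left_commute exp_add[symmetric])
    finally show ?case .
  qed
  show "((\<lambda>t. ennreal (exp (- \<rho> * t)) * (SUP x\<in>D (shift (- t) \<omega>). ennreal (norm x))) \<longlongrightarrow> 0) at_top"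
    by (rule tendsto_sandwich[OF _ le tendsto_const]) (use lim in auto)
qed

text \<open>Being at distance at least the infimum is a closed condition, so it extends from
  \<open>T\<close> to its closure. With countable \<open>T\<close> the distance becomes a countable
  infimum.\<close>

lemma infdist_image_dense:
  fixes g :: "'a::metric_space \<Rightarrow> 'b::metric_space"
  assumes g: "continuous_on UNIV g" and T: "T \<subseteq> S" "S \<subseteq> closure T" "T \<noteq> {}"
  shows "infdist x (g ` S) = infdist x (g ` T)"
proof (rule antisym)
  show "infdist x (g ` S) \<le> infdist x (g ` T)"
    using T by (intro infdist_mono) auto
  have "closed {v. infdist x (g ` T) \<le> dist x (g v)}"
    by (intro closed_Collect_le continuous_intros g)
  moreover have "T \<subseteq> {v. infdist x (g ` T) \<le> dist x (g v)}" by (auto intro: infdist_le)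
  ultimately have "closure T \<subseteq> {v. infdist x (g ` T) \<le> dist x (g v)}" by (rule closure_minimal[rotated])
  then show "infdist x (g ` T) \<le> infdist x (g ` S)"
    using T by (subst (2) infdist_notempty) (auto intro!: cINF_greatest)
qed

lemma sublinear_from_limit:
  fixes g :: "real \<Rightarrow> real"
  assumes g: "continuous_on UNIV g" and lim: "((\<lambda>t. \<bar>g t\<bar> / \<bar>t\<bar>) \<longlongrightarrow> 0) at_bot" and c: "0 < c"
  shows "\<exists>C. \<forall>t\<le>0. \<bar>g t\<bar> \<le> C + c * \<bar>t\<bar>"
proof -
  have "\<forall>\<^sub>F t in at_bot. \<bar>g t\<bar> / \<bar>t\<bar> < c" using order_tendstoD(2)[OF lim c] .
  then obtain T where T: "\<And>t. t \<le> T \<Longrightarrow> \<bar>g t\<bar> / \<bar>t\<bar> < c" by (auto simp: eventually_at_bot_linorder)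
  \<comment> \<open>The bound -1 keeps \<open>t\<close> away from 0, where division by zero makes
    the quotient 0 and carries no information.\<close>
  define S where "S = min T (- 1)"
  have "bounded (g ` {S..0})"
    by (intro compact_imp_bounded compact_continuous_image continuous_on_subset[OF g]) auto
  then obtain B where B: "\<forall>t\<in>{S..0}. \<bar>g t\<bar> \<le> B" by (auto simp: bounded_iff)
  have "\<bar>g t\<bar> \<le> \<bar>B\<bar> + c * \<bar>t\<bar>" if t: "t \<le> 0" for t
  proof (cases "t \<le> S")
    case True
    then have "\<bar>g t\<bar> < c * \<bar>t\<bar>" using T[of t] by (simp add: S_def field_simps)
    then show ?thesis by simp
  next
    case False
    then have "\<bar>g t\<bar> \<le> B" using B t by simp
    then show ?thesis using c by (smt (verit) mult_nonneg_nonneg abs_ge_zero)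
  qed
  then show ?thesis by blast
qed

section \<open>The Ornstein-Uhlenbeck path\<close>

lemma shift_shift: "shift s (shift t \<omega>) = shift (s + t) \<omega>"
  by (rule ext) (simp add: shift_def add_ac)

locale wiener_paths =
  fixes P :: "(real \<Rightarrow> real) measure" and \<Omega> :: "(real \<Rightarrow> real) set"
  assumes wiener: "two_sided_wiener_measure P" and admissible: "admissible_paths P \<Omega>"
begin

abbreviation M :: "(real \<Rightarrow> real) measure" where "M \<equiv> restrict_space P \<Omega>"

lemma space_P: "space P = paths"
  using wiener by (simp add: two_sided_wiener_measure_def)

lemma Omega_paths: "\<omega> \<in> \<Omega> \<Longrightarrow> \<omega> \<in> paths"
  using admissible sets.sets_into_space[of \<Omega> P] space_P by (auto simp: admissible_paths_def)

lemma space_M: "space M = \<Omega>"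
  using Omega_paths space_P by (auto simp: space_restrict_space)

lemma shift_Omega: "\<omega> \<in> \<Omega> \<Longrightarrow> shift t \<omega> \<in> \<Omega>"
  using admissible by (auto simp: admissible_paths_def)

lemma shift_0: "\<omega> \<in> \<Omega> \<Longrightarrow> shift 0 \<omega> = \<omega>"
  using Omega_paths by (auto simp: shift_def paths_def)

lemma evaluation_measurable: "(\<lambda>\<omega>. \<omega> s) \<in> borel_measurable M"
proof -
  have "(\<lambda>\<omega>. \<omega> s) \<in> borel_measurable P"
  proof (rule borel_measurableI)
    fix S :: "real set" assume S: "open S"
    \<comment> \<open>Points are compact, so preimages under evaluation are among the subbasic sets
      of the compact-open topology.\<close>
    have "openin compact_open {\<omega> \<in> paths. \<omega> ` {s} \<subseteq> S}"
      unfolding compact_open_def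
      by (rule topology_generated_by_Basis, unfold mem_Collect_eq, intro exI[of _ "{s}"] exI[of _ S])
        (use S in auto)
    then have "{\<omega> \<in> paths. \<omega> ` {s} \<subseteq> S} \<in> sets P"
      using wiener by (auto simp: two_sided_wiener_measure_def)
    moreover have "{\<omega> \<in> paths. \<omega> ` {s} \<subseteq> S} = (\<lambda>\<omega>. \<omega> s) -` S \<inter> space P" by (auto simp: space_P)
    ultimately show "(\<lambda>\<omega>. \<omega> s) -` S \<inter> space P \<in> sets P" by simp
  qed
  then show ?thesis by (rule measurable_restrict_space1)
qed

text \<open>Freezing time on the grid of mesh \<open>1 / Suc n\<close> leaves countably many
  measurable evaluations; continuity of the paths gives convergence to the evaluation at the true
  time.\<close>

lemma joint_evaluation_measurable: "(\<lambda>(t, \<omega>). \<omega> t) \<in> borel_measurable (borel \<Otimes>\<^sub>M M)"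
proof (rule borel_measurable_LIMSEQ_metric)
  fix n :: nat
  show "(\<lambda>x. snd x (real_of_int \<lfloor>real (Suc n) * fst x\<rfloor> / real (Suc n))) \<in> borel_measurable (borel \<Otimes>\<^sub>M M)"
  proof (rule measurable_compose_countable[where f = "\<lambda>i x. snd x (real_of_int i / real (Suc n))"])
    show "(\<lambda>x. snd x (real_of_int i / real (Suc n))) \<in> borel_measurable (borel \<Otimes>\<^sub>M M)" for i :: int
      by (rule measurable_compose[OF measurable_snd evaluation_measurable])
    show "(\<lambda>x. \<lfloor>real (Suc n) * fst x\<rfloor>) \<in> borel \<Otimes>\<^sub>M M \<rightarrow>\<^sub>M count_space UNIV" by measurable
  qed
next
  fix x :: "real \<times> (real \<Rightarrow> real)" assume "x \<in> space (borel \<Otimes>\<^sub>M M)"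
  then have c: "continuous_on UNIV (snd x)"
    using Omega_paths by (auto simp: space_pair_measure space_M paths_def)
  have "(\<lambda>n. real_of_int \<lfloor>real (Suc n) * fst x\<rfloor> / real (Suc n)) \<longlonglongrightarrow> fst x"
  proof (rule LIM_zero_cancel, rule Lim_null_comparison)
    show "(\<lambda>n. 1 / real (Suc n)) \<longlonglongrightarrow> 0"
      using LIMSEQ_inverse_real_of_nat by (simp add: inverse_eq_divide)
    have "norm (real_of_int \<lfloor>real (Suc n) * fst x\<rfloor> / real (Suc n) - fst x) \<le> 1 / real (Suc n)" for n
    proof -
      have "\<bar>real_of_int \<lfloor>real (Suc n) * fst x\<rfloor> - real (Suc n) * fst x\<bar> \<le> 1" by linarith
      then have "\<bar>real_of_int \<lfloor>real (Suc n) * fst x\<rfloor> - real (Suc n) * fst x\<bar> / real (Suc n) \<le> 1 / real (Suc n)"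
        by (intro divide_right_mono) auto
      moreover have "real_of_int \<lfloor>real (Suc n) * fst x\<rfloor> / real (Suc n) - fst x
          = (real_of_int \<lfloor>real (Suc n) * fst x\<rfloor> - real (Suc n) * fst x) / real (Suc n)"
        by (simp add: diff_divide_distrib del: of_nat_Suc)
      ultimately show ?thesis by (simp add: abs_divide del: of_nat_Suc)
    qed
    then show "\<forall>\<^sub>F n in sequentially. norm (real_of_int \<lfloor>real (Suc n) * fst x\<rfloor> / real (Suc n) - fst x) \<le> 1 / real (Suc n)"
      by simp
  qed
  then show "(\<lambda>n. snd x (real_of_int \<lfloor>real (Suc n) * fst x\<rfloor> / real (Suc n))) \<longlonglongrightarrow> (case x of (t, \<omega>) \<Rightarrow> \<omega> t)"
    using c by (auto simp: continuous_on_sequentially comp_def case_prod_unfold)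
qed

lemma ou_measurable: "(\<lambda>(t, \<omega>). ou (shift t \<omega>)) \<in> borel_measurable (borel \<Otimes>\<^sub>M M)"
proof -
  have "(\<lambda>v. (fst (fst v) + snd v, snd (fst v))) \<in> (borel \<Otimes>\<^sub>M M) \<Otimes>\<^sub>M lborel \<rightarrow>\<^sub>M borel \<Otimes>\<^sub>M M"
    and "(\<lambda>v. (fst (fst v), snd (fst v))) \<in> (borel \<Otimes>\<^sub>M M) \<Otimes>\<^sub>M (lborel :: real measure) \<rightarrow>\<^sub>M borel \<Otimes>\<^sub>M M"
    by measurable
  from this[THEN measurable_compose, OF joint_evaluation_measurable]
  have [measurable]: "(\<lambda>v. snd (fst v) (fst (fst v) + snd v)) \<in> borel_measurable ((borel \<Otimes>\<^sub>M M) \<Otimes>\<^sub>M lborel)"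
    "(\<lambda>v. snd (fst v) (fst (fst v))) \<in> borel_measurable ((borel \<Otimes>\<^sub>M M) \<Otimes>\<^sub>M (lborel :: real measure))"
    by (simp_all add: case_prod_unfold)
  have "(\<lambda>w. LINT s|lborel. indicator {..0} s *\<^sub>R (exp s * (snd w (fst w + s) - snd w (fst w))))
      \<in> borel_measurable (borel \<Otimes>\<^sub>M M)"
    by (rule lborel.borel_measurable_lebesgue_integral) (simp add: case_prod_unfold)
  then show ?thesis
    by (simp add: ou_def shift_def set_lebesgue_integral_def case_prod_unfold)
qed

lemma ou_sublinear:
  assumes \<omega>: "\<omega> \<in> \<Omega>"
  shows "sublinear_path (\<lambda>t. ou (shift t \<omega>))"
  unfolding sublinear_path_def
proof (intro conjI allI impI)
  define z where "z = (\<lambda>t. ou (shift t \<omega>))"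
  have z: "continuous_on UNIV z" "((\<lambda>t. \<bar>z t\<bar> / \<bar>t\<bar>) \<longlongrightarrow> 0) at_bot"
    "((\<lambda>t. 1 / t * primitive z t) \<longlongrightarrow> 0) at_bot"
    using admissible \<omega> unfolding admissible_paths_def z_def primitive_def by auto
  show "continuous_on UNIV (\<lambda>t. ou (shift t \<omega>))" using z(1) by (simp add: z_def)
  fix c :: real assume c: "0 < c"
  have "((\<lambda>t. \<bar>primitive z t\<bar> / \<bar>t\<bar>) \<longlongrightarrow> 0) at_bot"
    using tendsto_rabs_zero[OF z(3)] by (simp add: abs_mult)
  then obtain C1 C2 where "\<And>t. t \<le> 0 \<Longrightarrow> \<bar>z t\<bar> \<le> C1 + c * \<bar>t\<bar>" "\<And>t. t \<le> 0 \<Longrightarrow> \<bar>primitive z t\<bar> \<le> C2 + c * \<bar>t\<bar>"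
    using sublinear_from_limit[OF z(1,2) c] sublinear_from_limit[OF continuous_on_primitive[OF z(1)] _ c] by blast
  then have "\<forall>t\<le>0. \<bar>z t\<bar> \<le> max C1 C2 + c * \<bar>t\<bar> \<and> \<bar>primitive z t\<bar> \<le> max C1 C2 + c * \<bar>t\<bar>"
    by (smt (verit) max.cobounded1 max.cobounded2)
  then show "\<exists>C. \<forall>t\<le>0. \<bar>ou (shift t \<omega>)\<bar> \<le> C + c * \<bar>t\<bar> \<and> \<bar>primitive (\<lambda>t. ou (shift t \<omega>)) t\<bar> \<le> C + c * \<bar>t\<bar>"
    unfolding z_def by blast
qed

end

section \<open>Existence and upper semicontinuity of the random attractors\<close>

lemma measurable_reparametrized_path:
  fixes y :: "'p \<Rightarrow> real \<Rightarrow> real"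
  assumes y: "(\<lambda>(t, p). y p t) \<in> borel_measurable (borel \<Otimes>\<^sub>M N)"
    and a: "a \<in> borel_measurable L" and b: "b \<in> L \<rightarrow>\<^sub>M N"
  shows "(\<lambda>x. y (b x) (a x)) \<in> borel_measurable L"
  using measurable_compose[OF measurable_Pair[OF a b] y] by simp

context lattice
begin

lemma radius_measurable:
  fixes y :: "'p \<Rightarrow> real \<Rightarrow> real"
  assumes y: "(\<lambda>(t, p). y p t) \<in> borel_measurable (borel \<Otimes>\<^sub>M N)"
  shows "(\<lambda>p. radius (y p)) \<in> borel_measurable N"
proof -
  \<comment> \<open>The integral over the past is written over the whole line with a cut-off
    integrand, the shape in which parameter integrals are measurable.\<close>
  have prim: "primitive h (- s) = - (LINT r|lborel. (if - s \<le> r \<and> r \<le> 0 then h r else 0))" if "0 \<le> s" for h s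
  proof -
    have "primitive h (- s) = - (LBINT r=ereal (- s)..ereal 0. h r)"
      unfolding primitive_def by (rule interval_integral_endpoints_reverse)
    also have "(LBINT r=ereal (- s)..ereal 0. h r) = (LINT r:{- s..0}|lborel. h r)"
      by (rule interval_integral_Icc) (use that in simp)
    also have "\<dots> = (LINT r|lborel. (if - s \<le> r \<and> r \<le> 0 then h r else 0))"
      unfolding set_lebesgue_integral_def by (intro Bochner_Integration.integral_cong) auto
    finally show ?thesis .
  qed
  have [measurable]: "(\<lambda>v. y (fst (fst v)) (snd v)) \<in> borel_measurable ((N \<Otimes>\<^sub>M lborel) \<Otimes>\<^sub>M lborel)"
    by (rule measurable_reparametrized_path[OF y]) measurable
  have [measurable]: "(\<lambda>v. y (fst v) (- snd v)) \<in> borel_measurable (N \<Otimes>\<^sub>M lborel)"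
    by (rule measurable_reparametrized_path[OF y]) measurable
  define J where "J = (\<lambda>v. LINT r|lborel. (if - snd v \<le> r \<and> r \<le> 0 then y (fst v) r else 0))"
  have [measurable]: "J \<in> borel_measurable (N \<Otimes>\<^sub>M lborel)"
    unfolding J_def
    by (rule lborel.borel_measurable_lebesgue_integral) (simp add: case_prod_unfold)
  have "(\<lambda>p. LINT s|lborel. (if 0 \<le> s then exp (- \<delta> * s + 2 * J (p, s) - 2 * y p (- s)) else 0)) \<in> borel_measurable N"
    by (rule lborel.borel_measurable_lebesgue_integral) (simp add: case_prod_unfold)
  moreover have "radius (y p) = (LINT s|lborel. (if 0 \<le> s then exp (- \<delta> * s + 2 * J (p, s) - 2 * y p (- s)) else 0)) / \<delta>" for p
    unfolding radius_def set_lebesgue_integral_def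
    by (intro arg_cong[of _ _ "\<lambda>x. x / \<delta>"] Bochner_Integration.integral_cong) (auto simp: prim J_def cong: if_cong)
  ultimately show ?thesis by simp
qed

section \<open>The deterministic global attractor\<close>

lemma deterministic_driven: "driven_lattice \<alpha> \<beta> \<gamma> \<nu> lam q {()} (\<lambda>_ _. ()) (\<lambda>_ _. 0)"
  by unfold_locales (auto simp: sublinear_path_zero)

lemma global_attractor_exists: "\<exists>A. global_attractor (flow (\<lambda>_. 0)) A"
proof -
  interpret driven_lattice \<alpha> \<beta> \<gamma> \<nu> lam q f "{()}" "\<lambda>_ _. ()" "\<lambda>_ _. 0"
    by (rule deterministic_driven)
  have "global_attractor (flow (\<lambda>_. 0)) (attractor ())"
    unfolding global_attractor_def semidist_tendsto_0_iff
  proof (intro conjI allI impI)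
    show "compact (attractor ())" by (rule attractor_compact) simp
    show "flow (\<lambda>_. 0) t ` attractor () = attractor ()" if "0 \<le> t" for t
      using attractor_invariant[of "()" t] that by simp
    fix r e :: real assume r: "0 < r" and e: "0 < e"
    have growth: "\<forall>\<^sub>F t in at_top. \<forall>x\<in>cball 0 r. norm x \<le> exp (\<rho> * t)" if \<rho>: "0 < \<rho>" for \<rho> :: real
    proof -
      have "filterlim (\<lambda>t. exp (\<rho> * t)) at_top at_top"
        by (intro filterlim_compose[OF exp_at_top] filterlim_tendsto_pos_mult_at_top[OF tendsto_const \<rho> filterlim_ident])
      then have "\<forall>\<^sub>F t in at_top. r \<le> exp (\<rho> * t)" by (simp add: filterlim_at_top)
      then show ?thesis by eventually_elim auto
    qed
    have "\<forall>\<^sub>F t in at_top. \<forall>x\<in>cball 0 r. \<exists>k\<in>attractor (). dist (flow (\<lambda>_. 0) t x) k < e"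
      by (rule attractor_attracts[where D = "\<lambda>_. cball 0 r" and \<omega> = "()"])
        (use K_attracts[where D = "\<lambda>_. cball 0 r"] growth e in auto)
    then show "\<forall>\<^sub>F t in at_top. \<forall>a\<in>flow (\<lambda>_. 0) t ` cball 0 r. \<exists>b\<in>attractor (). dist a b < e" by simp
  qed
  then show ?thesis by blast
qed

text \<open>An invariant bounded set is its own image at every time, hence attracted by the closed
  set \<open>B\<close>. Applied both ways this gives uniqueness.\<close>

lemma global_attractor_subset:
  assumes A: "global_attractor S A" and B: "global_attractor S B"
  shows "A \<subseteq> B"
proof
  fix a assume a: "a \<in> A"
  have cB: "closed B" using B by (auto simp: global_attractor_def intro: compact_imp_closed)
  have "bounded A" using A by (auto simp: global_attractor_def intro: compact_imp_bounded)
  then obtain r where "0 < r" "\<forall>x\<in>A. norm x \<le> r" unfolding bounded_pos by blast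
  then have r: "0 < r" "A \<subseteq> cball 0 r" by auto
  have "\<exists>b\<in>B. dist b a < e" if e: "0 < e" for e
  proof -
    have "\<forall>\<^sub>F t in at_top. \<forall>x\<in>S t ` cball 0 r. \<exists>b\<in>B. dist x b < e"
      using B r(1) e unfolding global_attractor_def semidist_tendsto_0_iff by blast
    from eventually_conj[OF this eventually_ge_at_top[of 0]]
    obtain t where t: "0 \<le> t" "\<forall>x\<in>S t ` cball 0 r. \<exists>b\<in>B. dist x b < e"
      using eventually_happens[of _ "at_top :: real filter"] by force
    have "a \<in> S t ` cball 0 r" using A t(1) a r(2) unfolding global_attractor_def by blast
    then show ?thesis using t(2) by (metis dist_commute)
  qed
  then show "a \<in> B" using closure_approachable[of a B] cB by simp
qed

end

locale random_lattice = lattice + wiener_paths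
begin

definition noise_path :: "real \<Rightarrow> (real \<Rightarrow> real) \<Rightarrow> real \<Rightarrow> real" where
  "noise_path \<epsilon> \<omega> t = \<epsilon> * ou (shift t \<omega>)"

lemma noise_path_eq: "noise_path \<epsilon> \<omega> = (\<lambda>t. \<epsilon> * ou (shift t \<omega>))"
  by (rule ext) (rule noise_path_def)

lemma random_flow_noise_path: "random_flow \<alpha> \<beta> \<gamma> \<nu> lam f \<epsilon> t \<omega> = flow (noise_path \<epsilon> \<omega>) t"
  by (simp add: random_flow_eq noise_path_eq)

lemma random_rhs_noise_path: "random_rhs \<alpha> \<beta> \<gamma> \<nu> lam f \<epsilon> \<omega> = (\<lambda>t. F (noise_path \<epsilon> \<omega> t))"
  by (simp add: random_rhs_def random_field_rescale[of _ _ _ _ _ _ \<epsilon>] noise_path_def)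

lemma driven: "driven_lattice \<alpha> \<beta> \<gamma> \<nu> lam q \<Omega> shift (noise_path \<epsilon>)"
  by unfold_locales
    (auto simp: shift_Omega shift_0 shift_shift noise_path_def add.commute
      intro!: sublinear_path_cmult[OF ou_sublinear, folded noise_path_eq])

lemma noise_path_measurable: "(\<lambda>(t, \<omega>). noise_path \<epsilon> \<omega> t) \<in> borel_measurable (borel \<Otimes>\<^sub>M M)"
  using borel_measurable_times[OF borel_measurable_const ou_measurable, of \<epsilon>]
  by (simp add: noise_path_def case_prod_unfold)

lemma noise_path_continuous: "\<omega> \<in> \<Omega> \<Longrightarrow> continuous_on UNIV (noise_path \<epsilon> \<omega>)"
  using driven_lattice.path_continuous[OF driven] .

lemma random_dynamical_system_flow:
  "random_dynamical_system M (random_flow \<alpha> \<beta> \<gamma> \<nu> lam f \<epsilon>)"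
proof -
  interpret driven_lattice \<alpha> \<beta> \<gamma> \<nu> lam q f \<Omega> shift "noise_path \<epsilon>" by (rule driven)
  show ?thesis
    unfolding random_dynamical_system_def random_flow_noise_path space_M
    using flow_measurable[OF noise_path_measurable] noise_path_continuous
    by (auto simp: space_M flow_0 cocycle continuous)
qed

section \<open>Existence of the random attractor\<close>

lemma random_attractor_exists: "\<exists>A. random_attractor M (random_flow \<alpha> \<beta> \<gamma> \<nu> lam f \<epsilon>) A"
proof -
  interpret driven_lattice \<alpha> \<beta> \<gamma> \<nu> lam q f \<Omega> shift "noise_path \<epsilon>" by (rule driven)
  \<comment> \<open>Scaling carries \<open>T\<close> to a dense subset of every absorbing set, so
    one countable set of parameters works for all \<omega>.\<close>
  obtain T where T: "countable T" "T \<subseteq> kset 1" "kset 1 \<subseteq> closure T" using separable by blast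
  have T0: "T \<noteq> {}" using T(3) zero_in_kset[of 1] by auto
  have slice_measurable: "(\<lambda>\<omega>. infdist x (slice \<omega> (real n))) \<in> borel_measurable M" for x n
  proof -
    define y where "y = (\<lambda>\<omega>. noise_path \<epsilon> (shift (- real n) \<omega>))"
    have y: "(\<lambda>(t, \<omega>). y \<omega> t) \<in> borel_measurable (borel \<Otimes>\<^sub>M M)"
    proof -
      have "(\<lambda>v. noise_path \<epsilon> (snd v) (fst v + - real n)) \<in> borel_measurable (borel \<Otimes>\<^sub>M M)"
        by (rule measurable_reparametrized_path[OF noise_path_measurable]) measurable
      then show ?thesis by (simp add: y_def noise_path_def shift_shift case_prod_unfold)
    qed
    have yc: "continuous_on UNIV (y \<omega>)" if "\<omega> \<in> space M" for \<omega>
      using that by (auto simp: y_def space_M intro: noise_path_continuous shift_Omega)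
    \<comment> \<open>\<open>g\<close> moves the random size of the absorbing set into the map, so
      that each slice is the image of the fixed set \<open>kset 1\<close>.\<close>
    define g where "g = (\<lambda>\<omega> u. flow (y \<omega>) (real n) (sqrt (radius (y \<omega>)) *\<^sub>R u))"
    have gm [measurable]: "(\<lambda>\<omega>. g \<omega> u) \<in> borel_measurable M" for u
    proof -
      have "(\<lambda>\<omega>. sqrt (radius (y \<omega>)) *\<^sub>R u) \<in> borel_measurable M"
        using radius_measurable[OF y] by measurable
      then have "(\<lambda>\<omega>. (real n, \<omega>, sqrt (radius (y \<omega>)) *\<^sub>R u))
          \<in> M \<rightarrow>\<^sub>M restrict_space borel {0..} \<Otimes>\<^sub>M (M \<Otimes>\<^sub>M borel)"
        by (intro measurable_Pair measurable_const measurable_ident) (auto simp: space_restrict_space)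
      from measurable_compose[OF this flow_measurable[OF y yc]]
      show ?thesis by (simp add: g_def)
    qed
    have eq: "infdist x (slice \<omega> (real n)) = (INF u\<in>T. dist x (g \<omega> u))" if \<omega>: "\<omega> \<in> space M" for \<omega>
    proof -
      have "slice \<omega> (real n) = g \<omega> ` kset 1"
        unfolding slice_def by (subst kset_scale[OF radius_nonneg]) (simp add: g_def y_def image_image)
      moreover have "continuous_on UNIV (g \<omega>)"
        unfolding g_def by (intro continuous_on_compose2[OF continuous_on_flow[OF yc[OF \<omega>]]] continuous_intros) auto
      ultimately show ?thesis
        using infdist_image_dense[OF _ T(2,3) T0, of "g \<omega>" x] T0
        by (simp add: infdist_notempty image_image)
    qed
    have "(\<lambda>\<omega>. INF u\<in>T. dist x (g \<omega> u)) \<in> borel_measurable M"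
      by (rule borel_measurable_cINF_real[OF T(1)]) measurable
    then show ?thesis by (rule measurable_cong[THEN iffD2, rotated]) (rule eq)
  qed
  have "random_set M attractor"
    unfolding random_set_def
  proof (intro conjI ballI allI)
    show "attractor \<omega> \<noteq> {}" if "\<omega> \<in> space M" for \<omega> using attractor_nonempty that by (simp add: space_M)
    show "(\<lambda>\<omega>. infdist x (attractor \<omega>)) \<in> borel_measurable M" for x
      by (rule borel_measurable_LIMSEQ_real[OF infdist_slice_tendsto slice_measurable]) (simp add: space_M)
  qed
  then have tempered: "tempered_random_set M attractor"
  proof (rule tempered_random_setI)
    fix \<omega> and c :: real assume \<omega>: "\<omega> \<in> space M" and "0 < c"
    then obtain B where B: "\<forall>t\<ge>0. \<forall>u\<in>K (shift (- t) \<omega>). norm u \<le> B * exp (c * t)"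
      using K_subexponential[of \<omega> c] by (auto simp: space_M)
    have "attractor (shift (- t) \<omega>) \<subseteq> K (shift (- t) \<omega>)" for t
      using \<omega> by (intro attractor_subset_K shift_Omega) (simp add: space_M)
    then show "\<exists>B. \<forall>t\<ge>0. \<forall>x\<in>attractor (shift (- t) \<omega>). norm x \<le> B * exp (c * t)"
      using B by (meson subsetD)
  qed
  have "random_attractor M (random_flow \<alpha> \<beta> \<gamma> \<nu> lam f \<epsilon>) attractor"
    unfolding random_attractor_def random_flow_noise_path space_M semidist_tendsto_0_iff
  proof (intro conjI ballI allI impI)
    show "tempered_random_set M attractor" by (rule tempered)
    fix \<omega> assume \<omega>: "\<omega> \<in> \<Omega>"
    show "compact (attractor \<omega>)" by (rule attractor_compact[OF \<omega>])
    show "flow (noise_path \<epsilon> \<omega>) t ` attractor \<omega> = attractor (shift t \<omega>)" if "0 \<le> t" for t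
      by (rule attractor_invariant[OF \<omega> that])
    fix D :: "(real \<Rightarrow> real) \<Rightarrow> ell2 set" and e :: real assume D: "tempered_random_set M D" and e: "0 < e"
    have "\<forall>\<^sub>F t in at_top. \<forall>x\<in>D (shift (- t) \<omega>). \<exists>a\<in>attractor \<omega>. dist (\<phi> t (shift (- t) \<omega>) x) a < e"
    proof (rule attractor_attracts[OF _ \<omega> e])
      fix \<omega> and e :: real assume \<omega>: "\<omega> \<in> \<Omega>" and e: "0 < e"
      show "\<forall>\<^sub>F t in at_top. \<forall>x\<in>D (shift (- t) \<omega>). \<exists>k\<in>K \<omega>. dist (\<phi> t (shift (- t) \<omega>) x) k < e"
        by (rule K_attracts[OF \<omega> e]) (rule tempered_random_set_growth[OF D], use \<omega> in \<open>simp_all add: space_M\<close>)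
    qed
    then show "\<forall>\<^sub>F t in at_top. \<forall>a\<in>flow (noise_path \<epsilon> (shift (- t) \<omega>)) t ` D (shift (- t) \<omega>). \<exists>b\<in>attractor \<omega>. dist a b < e"
      by simp
  qed
  then show ?thesis by blast
qed

section \<open>Upper semicontinuity of arbitrary families of random attractors\<close>

lemma random_attractor_subset_K:
  assumes A: "random_attractor M (random_flow \<alpha> \<beta> \<gamma> \<nu> lam f \<epsilon>) A" and \<omega>: "\<omega> \<in> \<Omega>"
  shows "A \<omega> \<subseteq> kset (radius (noise_path \<epsilon> \<omega>))"
proof -
  interpret driven_lattice \<alpha> \<beta> \<gamma> \<nu> lam q f \<Omega> shift "noise_path \<epsilon>" by (rule driven)
  show ?thesis
  proof (rule invariant_subset_K[OF \<omega>])
    show "\<forall>\<^sub>F t in at_top. \<forall>x\<in>A (shift (- t) \<omega>). norm x \<le> exp (\<rho> * t)" if "0 < \<rho>" for \<rho>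
      using A \<omega> that by (intro tempered_random_set_growth[of M]) (auto simp: random_attractor_def space_M)
    fix t :: real assume t: "0 \<le> t"
    have "random_flow \<alpha> \<beta> \<gamma> \<nu> lam f \<epsilon> t (shift (- t) \<omega>) ` A (shift (- t) \<omega>) = A (shift t (shift (- t) \<omega>))"
      using A t shift_Omega[OF \<omega>] unfolding random_attractor_def space_M by blast
    then show "A \<omega> \<subseteq> \<phi> t (shift (- t) \<omega>) ` A (shift (- t) \<omega>)"
      by (simp add: shift_shift shift_0[OF \<omega>] random_flow_noise_path)
  qed
qed

text \<open>As \<open>\<epsilon>\<close> tends to 0 the radius tends to its deterministic value \<open>1 / \<delta>\<^sup>2\<close>.\<close>

lemma eventually_radius_less:
  assumes \<omega>: "\<omega> \<in> \<Omega>"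
  shows "\<forall>\<^sub>F \<epsilon> in at_right 0. radius (noise_path \<epsilon> \<omega>) < 4 / \<delta>\<^sup>2"
proof -
  define z where "z = (\<lambda>t. ou (shift t \<omega>))"
  obtain C where C: "\<And>t. t \<le> 0 \<Longrightarrow> \<bar>z t\<bar> \<le> C + 1 * \<bar>t\<bar> \<and> \<bar>primitive z t\<bar> \<le> C + 1 * \<bar>t\<bar>"
    using sublinear_pathD(2)[OF ou_sublinear[OF \<omega>], of 1] unfolding z_def by auto
  have "((\<lambda>\<epsilon>. exp (4 * \<epsilon> * C) / (\<delta> - 4 * \<epsilon>) / \<delta>) \<longlongrightarrow> exp (4 * 0 * C) / (\<delta> - 4 * 0) / \<delta>) (at_right 0)"
    using delta_pos by (intro tendsto_intros) auto
  \<comment> \<open>The limit is \<open>1 / \<delta>\<^sup>2\<close>; the factor 4 leaves room and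
    has the square root 2 used for the radius \<open>r\<close> in
    \<open>upper_semicontinuity\<close>.\<close>
  moreover have "exp (4 * 0 * C) / (\<delta> - 4 * 0) / \<delta> < 4 / \<delta>\<^sup>2"
    using delta_pos by (simp add: power2_eq_square divide_strict_right_mono)
  ultimately have "\<forall>\<^sub>F \<epsilon> in at_right 0. exp (4 * \<epsilon> * C) / (\<delta> - 4 * \<epsilon>) / \<delta> < 4 / \<delta>\<^sup>2"
    by (rule order_tendstoD)
  moreover have "\<forall>\<^sub>F \<epsilon> in at_right 0. \<epsilon> < \<delta> / 4"
    using delta_pos by (intro eventually_at_right_real[of 0 "\<delta> / 4", THEN eventually_mono]) auto
  moreover have "\<forall>\<^sub>F \<epsilon>::real in at_right 0. 0 < \<epsilon>" by (rule eventually_at_right_less)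
  ultimately show ?thesis
  proof eventually_elim
    case (elim \<epsilon>)
    have "radius (noise_path \<epsilon> \<omega>) \<le> exp (4 * \<epsilon> * C) / (\<delta> - 4 * \<epsilon>) / \<delta>"
    proof (rule radius_le(2)[OF noise_path_continuous[OF \<omega>]])
      show "4 * \<epsilon> < \<delta>" using elim(2) by simp
      fix s :: real assume s: "0 \<le> s"
      have "- 2 * primitive z (- s) - 2 * z (- s) \<le> 4 * (C + s)"
        using C[of "- s"] s by (simp add: abs_le_iff)
      then have "\<epsilon> * (- 2 * primitive z (- s) - 2 * z (- s)) \<le> \<epsilon> * (4 * (C + s))"
        using elim(3) by (intro mult_left_mono) auto
      then show "- 2 * primitive (noise_path \<epsilon> \<omega>) (- s) - 2 * noise_path \<epsilon> \<omega> (- s) \<le> 4 * \<epsilon> * C + 4 * \<epsilon> * s"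
        unfolding noise_path_eq primitive_cmult z_def by (simp add: algebra_simps)
    qed
    then show ?case using elim(1) by simp
  qed
qed

lemma upper_semicontinuity:
  assumes \<A>: "global_attractor (flow (\<lambda>_. 0)) \<A>"
    and A: "\<And>\<epsilon>. 0 < \<epsilon> \<Longrightarrow> random_attractor M (random_flow \<alpha> \<beta> \<gamma> \<nu> lam f \<epsilon>) (A \<epsilon>)"
    and \<omega>: "\<omega> \<in> \<Omega>"
  shows "((\<lambda>\<epsilon>. semidist (A \<epsilon> \<omega>) \<A>) \<longlongrightarrow> 0) (at_right 0)"
  unfolding semidist_tendsto_0_iff
proof (intro allI impI)
  fix e :: real assume e: "0 < e"
  \<comment> \<open>The square root of the radius bound times \<open>norm f\<close>, enlarged by 1
    to be positive also for \<open>f = 0\<close>: a ball that contains the attractors over a fixed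
    \<omega> for all small \<epsilon>.\<close>
  define r where "r = 2 / \<delta> * norm f + 1"
  have r: "0 < r" using delta_pos by (simp add: r_def add_nonneg_pos)
  have "\<forall>\<^sub>F t in at_top. \<forall>x\<in>flow (\<lambda>_. 0) t ` cball 0 r. \<exists>b\<in>\<A>. dist x b < e / 2"
    using \<A> r half_gt_zero[OF e] unfolding global_attractor_def semidist_tendsto_0_iff by blast
  from eventually_conj[OF this eventually_ge_at_top[of 0]]
  obtain t where t: "0 \<le> t" "\<And>x. x \<in> cball 0 r \<Longrightarrow> \<exists>b\<in>\<A>. dist (flow (\<lambda>_. 0) t x) b < e / 2"
    using eventually_happens[of _ "at_top :: real filter"] by force
  \<comment> \<open>\<open>t\<close> comes from the deterministic attraction and does not depend on
    \<epsilon>. Points of \<open>A \<epsilon> \<omega>\<close> are traced back to this fixed earlier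
    noise, and both flows are compared on \<open>{0..t}\<close>.\<close>
  define \<omega>' where "\<omega>' = shift (- t) \<omega>"
  have \<omega>': "\<omega>' \<in> \<Omega>" unfolding \<omega>'_def by (rule shift_Omega[OF \<omega>])
  obtain Z where Z: "0 \<le> Z" "\<forall>s\<in>{0..t}. \<bar>ou (shift s \<omega>')\<bar> \<le> Z"
    using path_bounded[OF sublinear_pathD(1)[OF ou_sublinear[OF \<omega>']]] by blast
  obtain L where L: "\<And>y z x x' d. continuous_on UNIV y \<Longrightarrow> continuous_on UNIV z \<Longrightarrow>
      \<forall>s\<in>{0..t}. \<bar>y s\<bar> \<le> Z \<and> \<bar>z s\<bar> \<le> Z \<and> \<bar>y s - z s\<bar> \<le> d \<Longrightarrow> norm x \<le> r \<Longrightarrow> norm x' \<le> r \<Longrightarrow>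
      (norm (flow y t x - flow z t x'))\<^sup>2 \<le> ((norm (x - x'))\<^sup>2 + d\<^sup>2) * exp (L * t)"
    using flow_close[OF t(1), of Z r] by blast
  have "((\<lambda>\<epsilon>. (\<epsilon> * Z)\<^sup>2 * exp (L * t)) \<longlongrightarrow> (0 * Z)\<^sup>2 * exp (L * t)) (at_right 0)"
    by (intro tendsto_intros)
  then have small: "\<forall>\<^sub>F \<epsilon> in at_right 0. (\<epsilon> * Z)\<^sup>2 * exp (L * t) < (e / 2)\<^sup>2"
    using e by (intro order_tendstoD) auto
  have "\<forall>\<^sub>F \<epsilon>::real in at_right 0. \<epsilon> < 1"
    by (intro eventually_at_right_real[of 0 1, THEN eventually_mono]) auto
  moreover have "\<forall>\<^sub>F \<epsilon>::real in at_right 0. 0 < \<epsilon>" by (rule eventually_at_right_less)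
  ultimately show "\<forall>\<^sub>F \<epsilon> in at_right 0. \<forall>a\<in>A \<epsilon> \<omega>. \<exists>b\<in>\<A>. dist a b < e"
    using small eventually_radius_less[OF \<omega>']
  proof (eventually_elim, intro ballI)
    fix \<epsilon> :: real and a
    assume \<epsilon>1: "\<epsilon> < 1" and \<epsilon>0: "0 < \<epsilon>" and sm: "(\<epsilon> * Z)\<^sup>2 * exp (L * t) < (e / 2)\<^sup>2"
      and rad: "radius (noise_path \<epsilon> \<omega>') < 4 / \<delta>\<^sup>2" and a: "a \<in> A \<epsilon> \<omega>"
    have "random_flow \<alpha> \<beta> \<gamma> \<nu> lam f \<epsilon> t \<omega>' ` A \<epsilon> \<omega>' = A \<epsilon> (shift t \<omega>')"
      using A[OF \<epsilon>0] t(1) \<omega>' unfolding random_attractor_def space_M by blast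
    then have "flow (noise_path \<epsilon> \<omega>') t ` A \<epsilon> \<omega>' = A \<epsilon> \<omega>"
      by (simp add: random_flow_noise_path \<omega>'_def shift_shift shift_0[OF \<omega>])
    then obtain x where x: "x \<in> A \<epsilon> \<omega>'" "a = flow (noise_path \<epsilon> \<omega>') t x" using a by blast
    have "x \<in> kset (radius (noise_path \<epsilon> \<omega>'))" using random_attractor_subset_K[OF A[OF \<epsilon>0] \<omega>'] x(1) by blast
    from kset_norm[OF this] have "(norm x)\<^sup>2 \<le> radius (noise_path \<epsilon> \<omega>') * (norm f)\<^sup>2" .
    also have "\<dots> \<le> 4 / \<delta>\<^sup>2 * (norm f)\<^sup>2" using rad by (intro mult_right_mono) auto
    also have "\<dots> = (2 / \<delta> * norm f)\<^sup>2" by (simp add: power_mult_distrib power_divide)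
    finally have "norm x \<le> 2 / \<delta> * norm f" by (rule power2_le_imp_le) (use delta_pos in simp)
    then have xr: "norm x \<le> r" by (simp add: r_def)
    have bd: "\<bar>noise_path \<epsilon> \<omega>' s\<bar> \<le> \<epsilon> * Z" "\<epsilon> * Z \<le> Z" if "s \<in> {0..t}" for s
      using Z that \<epsilon>0 \<epsilon>1 by (auto simp: noise_path_def abs_mult intro!: mult_left_mono mult_left_le_one_le)
    have "(norm (flow (noise_path \<epsilon> \<omega>') t x - flow (\<lambda>_. 0) t x))\<^sup>2 \<le> ((norm (x - x))\<^sup>2 + (\<epsilon> * Z)\<^sup>2) * exp (L * t)"
    proof (rule L[OF noise_path_continuous[OF \<omega>'] continuous_on_const _ xr xr], intro ballI conjI)
      fix s assume s: "s \<in> {0..t}"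
      show "\<bar>noise_path \<epsilon> \<omega>' s\<bar> \<le> Z" using bd[OF s] by linarith
      show "\<bar>noise_path \<epsilon> \<omega>' s - 0\<bar> \<le> \<epsilon> * Z" using bd[OF s] by simp
    qed (use Z in simp)
    also have "\<dots> < (e / 2)\<^sup>2" using sm by simp
    finally have "dist a (flow (\<lambda>_. 0) t x) < e / 2"
      unfolding x(2) dist_norm by (rule power2_less_imp_less) (use e in simp)
    moreover obtain b where b: "b \<in> \<A>" "dist (flow (\<lambda>_. 0) t x) b < e / 2" using t(2)[of x] xr by auto
    ultimately have "dist a b < e" using dist_triangle[of a b "flow (\<lambda>_. 0) t x"] by linarith
    then show "\<exists>b\<in>\<A>. dist a b < e" using b(1) by blast
  qed
qed

end

theorem theorem5p1:
  fixes \<alpha> \<beta> \<gamma> \<nu> lam :: real and f :: ell2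
    and P :: "(real \<Rightarrow> real) measure" and \<Omega> :: "(real \<Rightarrow> real) set"
  assumes "\<alpha> > 0" and "\<beta> > 0" and "\<nu> > 0" and "lam > 0" and "0 < \<gamma>" and "\<gamma> < 1"
    and "lam > lambda_star \<alpha> \<beta> \<gamma> \<nu>"
    and "two_sided_wiener_measure P"
    and "admissible_paths P \<Omega>"
  shows "(\<forall>\<epsilon>>0.
            (\<forall>\<omega>\<in>\<Omega>. well_posed (random_rhs \<alpha> \<beta> \<gamma> \<nu> lam f \<epsilon> \<omega>)) \<and>
            random_dynamical_system (restrict_space P \<Omega>) (random_flow \<alpha> \<beta> \<gamma> \<nu> lam f \<epsilon>) \<and>
            (\<exists>A. random_attractor (restrict_space P \<Omega>) (random_flow \<alpha> \<beta> \<gamma> \<nu> lam f \<epsilon>) A)) \<and>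
         well_posed (deterministic_rhs \<alpha> \<beta> \<gamma> \<nu> lam f) \<and>
         (\<exists>!\<A>. global_attractor (deterministic_flow \<alpha> \<beta> \<gamma> \<nu> lam f) \<A>) \<and>
         (\<forall>\<A> A.
            global_attractor (deterministic_flow \<alpha> \<beta> \<gamma> \<nu> lam f) \<A> \<longrightarrow>
            (\<forall>\<epsilon>>0. random_attractor (restrict_space P \<Omega>) (random_flow \<alpha> \<beta> \<gamma> \<nu> lam f \<epsilon>) (A \<epsilon>)) \<longrightarrow>
            (AE \<omega> in restrict_space P \<Omega>.
               ((\<lambda>\<epsilon>. semidist (A \<epsilon> \<omega>) \<A>) \<longlongrightarrow> 0) (at_right 0)))"
proof -
  obtain q where "q > 1" "decay_rate \<alpha> \<beta> \<gamma> \<nu> lam q > 0"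
    using decay_rate_positive[OF assms(2,7)] .
  then interpret random_lattice \<alpha> \<beta> \<gamma> \<nu> lam q f P \<Omega>
    using assms by unfold_locales
  have wp: "well_posed (random_rhs \<alpha> \<beta> \<gamma> \<nu> lam f \<epsilon> \<omega>)" if "\<omega> \<in> \<Omega>" for \<epsilon> \<omega>
    unfolding random_rhs_noise_path by (rule flow_approximation(1)[OF noise_path_continuous[OF that]])
  have wd: "well_posed (deterministic_rhs \<alpha> \<beta> \<gamma> \<nu> lam f)"
    using flow_approximation(1)[OF continuous_on_const, of 0]
    by (simp add: deterministic_rhs_def deterministic_field_eq)
  have unique: "\<exists>!\<A>. global_attractor (deterministic_flow \<alpha> \<beta> \<gamma> \<nu> lam f) \<A>"
    unfolding deterministic_flow_eq
    using global_attractor_exists global_attractor_subset by (metis subset_antisym)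
  \<comment> \<open>Convergence holds at every point of \<Omega>, so no exceptional set
    arises.\<close>
  have upper: "AE \<omega> in restrict_space P \<Omega>. ((\<lambda>\<epsilon>. semidist (A \<epsilon> \<omega>) \<A>) \<longlongrightarrow> 0) (at_right 0)"
    if "global_attractor (deterministic_flow \<alpha> \<beta> \<gamma> \<nu> lam f) \<A>"
      "\<forall>\<epsilon>>0. random_attractor (restrict_space P \<Omega>) (random_flow \<alpha> \<beta> \<gamma> \<nu> lam f \<epsilon>) (A \<epsilon>)" for \<A> A
    using upper_semicontinuity[of \<A> A] that by (intro AE_I2) (simp add: deterministic_flow_eq space_M)
  show ?thesis
    by (intro conjI allI impI ballI wp wd unique upper random_dynamical_system_flow
        random_attractor_exists) auto
qed

end
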